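(* Let $K\in\mathbb N$, $T>0$, let $G:[0,\infty)\to\mathbb R^{K\times K}$ be a symmetric, nonnegative, nonincreasing, convex, nonconstant, and commuting decay kernel, and let $\mathbb T$ be a nonempty compact subset of $[0,T]$. Then the following assertions hold. (a) For $X_0\in\mathbb R^K$ there exists precisely one strategy $X^*\in\mathscr X(\mathbb T,X_0)$ (up to $\mathbb P$-indistinguishability) that minimizes the expected costs $\mathbb E[C_{\mathbb T}(X)]$ over all strategies $X\in\mathscr X(\mathbb T,X_0)$. Moreover, $X^*$ is deterministic and can be characterized as the unique strategy $X\in\mathscr X_{\mathrm{det}}(\mathbb T,X_0)$ that solves the following generalized Fredholm integral equation for some $\lambda\in\mathbb R^K$: $$\int_{\mathbb T}\widetilde G(t-s)\,dX_s=\lambda\qquad\text{for all }t\in\mathbb T.$$ (b) Let $\mathscr T$ denote the class of all finite time grids in $\mathbb T$ (i.e. nonempty finite subsets of $\mathbb T$). Then $$\inf_{\mathbb T'\in\mathscr T}\ \min_{\boldsymbol\xi\in\mathscr X(\mathbb T',X_0)}\mathbb E[C_{\mathbb T'}(\boldsymbol\xi)]=\mathbb E[C_{\mathbb T}(X^* )].$$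
   Context: A decay kernel is a continuous function $G:[0,\infty)\to\mathbb R^{K\times K}$. It is symmetric if $G(t)^\top=G(t)$ for all $t$; nonnegative if $x^\top G(t)x\ge0$ for all $x\in\mathbb R^K$, $t\ge0$; nonincreasing (resp. convex) if $t\mapsto x^\top G(t)x$ is nonincreasing (resp. convex) on $[0,\infty)$ for every $x\in\mathbb R^K$; nonconstant if the matrix-valued function $t\mapsto G(t)$ is not constant; commuting if $G(t)G(s)=G(s)G(t)$ for all $s,t\ge0$. For symmetric $G$ put $\widetilde G(t)=G(|t|)$, $t\in\mathbb R$. Let $(\Omega,\mathscr F,(\mathscr F_t)_{t\in[0,T]},\mathbb P)$ be a filtered probability space. Strategies on a compact set. Let $\mathbb T\subset[0,T]$ be compact. An admissible strategy for $\mathbb T$ is a left-continuous, adapted, bounded $K$-dimensional stochastic process $(X_t)_{t\ge 0}$ such that each component $t\mapsto X^i_t$ is of finite variation, $X_t=0$ for all $t>T$, the vector-valued random measure $dX_t$ (with $dX([a,b))=X_b-X_a$ for $0\le a<b$, so that it may have an atom at $0$) is supported on $\mathbb T$, and its components have $\mathbb P$-a.s. bounded total variation (i.e. bounded by a constant). $\mathscr X(\mathbb T,X_0)$ is the class of such strategies with initial value $X_0\in\mathbb R^K$ at $t=0$, and $\mathscr X_{\mathrm{det}}(\mathbb T,X_0)$ is the subset of deterministic ones (not depending on $\omega$). The costs of $X\in\mathscr X(\mathbb T,X_0)$ are $$C_{\mathbb T}(X)=\frac12\int_{\mathbb T}\Big(\int_{\mathbb T}\widetilde G(t-s)\,dX_s\Big)^\top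 dX_t .$$ Strategies on finite grids. For a finite set $\mathbb T'=\{t_1<\dots<t_N\}\subset[0,T]$, $\mathscr X(\mathbb T',X_0)$ is equivalently described as the set of $\boldsymbol\xi=(\xi_1,\dots,\xi_N)$ with $\xi_k$ a bounded $\mathscr F_{t_k}$-measurable $\mathbb R^K$-valued random variable and $X_0+\sum_{k=1}^N\xi_k=0$ $\mathbb P$-a.s. (via $X^{\boldsymbol\xi}_t=X_0+\sum_{t_k<t}\xi_k$), and then $C_{\mathbb T'}(\boldsymbol\xi)=\frac12\sum_{k,\ell=1}^N\xi_k^\top\widetilde G(t_k-t_\ell)\xi_\ell$.
   Formalization: "Nonconstant" is taken to mean that t ↦ xᵀG(t)x is not constant for every x ≠ 0; if only the matrix function G is nonconstant, uniqueness in (a) fails, e.g. for G(t) = diag(e^{-t}, 1) and 𝕋 = {0,1}. *)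

theory Defs
  imports "HOL-Probability.Probability"
begin

section \<open>Decay kernels\<close>

text \<open>A kernel is a function on \<open>real\<close> of which only the values on \<open>{0..}\<close> matter.\<close>

definition decay_kernel :: "(real \<Rightarrow> real^'k^'k) \<Rightarrow> bool" where
  "decay_kernel G \<longleftrightarrow> continuous_on {0..} G"

definition symmetric_kernel :: "(real \<Rightarrow> real^'k^'k) \<Rightarrow> bool" where
  "symmetric_kernel G \<longleftrightarrow> (\<forall>t\<ge>0. transpose (G t) = G t)"

definition nonnegative_kernel :: "(real \<Rightarrow> real^'k^'k) \<Rightarrow> bool" where
  "nonnegative_kernel G \<longleftrightarrow> (\<forall>x. \<forall>t\<ge>0. 0 \<le> x \<bullet> (G t *v x))"

definition nonincreasing_kernel :: "(real \<Rightarrow> real^'k^'k) \<Rightarrow> bool" where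
  "nonincreasing_kernel G \<longleftrightarrow> (\<forall>x. antimono_on {0..} (\<lambda>t. x \<bullet> (G t *v x)))"

definition convex_kernel :: "(real \<Rightarrow> real^'k^'k) \<Rightarrow> bool" where
  "convex_kernel G \<longleftrightarrow> (\<forall>x. convex_on {0..} (\<lambda>t. x \<bullet> (G t *v x)))"

text \<open>
  Like monotonicity and convexity, nonconstancy is a condition on the quadratic forms, for every
  nonzero direction \<open>x\<close>.  It would not be enough that the matrix-valued function \<open>G\<close> is not
  constant: for \<open>G(t) = diag(exp(-t), 1)\<close> the costs in the second coordinate depend only on the
  total of the trades, so that optimal strategies are not unique on a set with two points.  For
  one-dimensional kernels the two conditions coincide.
\<close>

definition nonconstant_kernel :: "(real \<Rightarrow> real^'k^'k) \<Rightarrow> bool" where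
  "nonconstant_kernel G \<longleftrightarrow> (\<forall>x. x \<noteq> 0 \<longrightarrow> \<not> (\<lambda>t. x \<bullet> (G t *v x)) constant_on {0..})"

definition commuting_kernel :: "(real \<Rightarrow> real^'k^'k) \<Rightarrow> bool" where
  "commuting_kernel G \<longleftrightarrow> (\<forall>s\<ge>0. \<forall>t\<ge>0. G t ** G s = G s ** G t)"

definition sym_ext :: "(real \<Rightarrow> real^'k^'k) \<Rightarrow> real \<Rightarrow> real^'k^'k" where
  "sym_ext G t = G \<bar>t\<bar>"


section \<open>Integrals with respect to left-continuous paths of finite variation\<close>

text \<open>
  The supremum of \<open>\<Sum>i. \<bar>f (t (i+1)) - f (t i)\<bar>\<close> over all finite increasing sequences in \<open>S\<close>.
\<close>

definition total_variation :: "real set \<Rightarrow> (real \<Rightarrow> real) \<Rightarrow> ennreal" where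
  "total_variation S f =
     (SUP ts \<in> {ts. sorted ts \<and> set ts \<subseteq> S}.
        \<Sum>i<length ts - 1. ennreal \<bar>f (ts ! Suc i) - f (ts ! i)\<bar>)"

definition variation_fun :: "(real \<Rightarrow> real) \<Rightarrow> real \<Rightarrow> real" where
  "variation_fun f t = enn2real (total_variation {0..t} f)"

text \<open>
  \<open>f t - f 0 = pos_variation f t - neg_variation f t\<close> for \<open>t \<ge> 0\<close> is the Jordan decomposition of
  \<open>f\<close>.  All three variation functions vanish on \<open>{..0}\<close>.
\<close>

definition pos_variation :: "(real \<Rightarrow> real) \<Rightarrow> real \<Rightarrow> real" where
  "pos_variation f t = (variation_fun f t + (f (max 0 t) - f 0)) / 2"

definition neg_variation :: "(real \<Rightarrow> real) \<Rightarrow> real \<Rightarrow> real" where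
  "neg_variation f t = (variation_fun f t - (f (max 0 t) - f 0)) / 2"

text \<open>
  The measure that assigns \<open>H b - H a\<close> to \<open>{a..<b}\<close>, for a nondecreasing left-continuous \<open>H\<close>.
  Since \<^const>\<open>interval_measure\<close> is made for right-continuous functions and intervals \<open>{a<..b}\<close>,
  the real line is reflected.
\<close>

definition left_interval_measure :: "(real \<Rightarrow> real) \<Rightarrow> real measure" where
  "left_interval_measure H = distr (interval_measure (\<lambda>u. - H (- u))) borel uminus"

text \<open>
  The integral of \<open>g\<close> over \<open>S\<close> with respect to the signed measure \<open>df\<close> on \<open>{0..}\<close> with
  \<open>df {a..<b} = f b - f a\<close> for \<open>0 \<le> a < b\<close>; this measure can have an atom at \<open>0\<close>.
\<close>

definition stieltjes_integral :: "real set \<Rightarrow> (real \<Rightarrow> real) \<Rightarrow> (real \<Rightarrow> real) \<Rightarrow> real" where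
  "stieltjes_integral S g f =
     set_lebesgue_integral (left_interval_measure (pos_variation f)) S g -
     set_lebesgue_integral (left_interval_measure (neg_variation f)) S g"

text \<open>The signed measure \<open>df\<close> is supported on the closed set \<open>S\<close>: \<open>\<bar>df\<bar>\<close> does not charge \<open>- S\<close>.\<close>

definition supported_on :: "(real \<Rightarrow> real) \<Rightarrow> real set \<Rightarrow> bool" where
  "supported_on f S \<longleftrightarrow> emeasure (left_interval_measure (variation_fun f)) (- S) = 0"


section \<open>Strategies on a compact set\<close>

definition filtered_prob_space :: "real \<Rightarrow> 'a measure \<Rightarrow> (real \<Rightarrow> 'a measure) \<Rightarrow> bool" where
  "filtered_prob_space T M F \<longleftrightarrow>
     prob_space M \<and>
     (\<forall>t\<in>{0..T}. subalgebra M (F t)) \<and>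
     (\<forall>s\<in>{0..T}. \<forall>t\<in>{0..T}. s \<le> t \<longrightarrow> subalgebra (F t) (F s))"

text \<open>
  The path properties of an admissible strategy, for a path \<open>x\<close> on \<open>{0..}\<close>.
\<close>

definition admissible_path :: "real \<Rightarrow> real set \<Rightarrow> real^'k \<Rightarrow> (real \<Rightarrow> real^'k) \<Rightarrow> bool" where
  "admissible_path T S x0 x \<longleftrightarrow>
     x 0 = x0 \<and>
     (\<forall>t>0. continuous (at_left t) x) \<and>
     (\<forall>i. \<forall>t\<ge>0. total_variation {0..t} (\<lambda>s. x s $ i) < \<infinity>) \<and>
     (\<forall>t>T. x t = 0) \<and>
     (\<forall>i. supported_on (\<lambda>s. x s $ i) S)"

text \<open>
  Path properties are required almost surely, in accordance with the condition
  \<open>X\<^sub>0 + \<Sum>\<xi>\<^sub>k = 0\<close> almost surely for strategies on finite grids.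
\<close>

definition strategies ::
    "real \<Rightarrow> 'a measure \<Rightarrow> (real \<Rightarrow> 'a measure) \<Rightarrow> real set \<Rightarrow> real^'k \<Rightarrow> (real \<Rightarrow> 'a \<Rightarrow> real^'k) set"
  where
  "strategies T M F S x0 = {X.
     (\<forall>t\<in>{0..T}. X t \<in> borel_measurable (F t)) \<and>
     (AE \<omega> in M. admissible_path T S x0 (\<lambda>t. X t \<omega>)) \<and>
     (\<exists>c. AE \<omega> in M. \<forall>t\<ge>0. norm (X t \<omega>) \<le> c) \<and>
     (\<exists>c. AE \<omega> in M. \<forall>i. total_variation {0..} (\<lambda>t. X t \<omega> $ i) \<le> ennreal c)}"

text \<open>Deterministic strategies are given by their single path.\<close>

definition det_strategies ::
    "real \<Rightarrow> 'a measure \<Rightarrow> (real \<Rightarrow> 'a measure) \<Rightarrow> real set \<Rightarrow> real^'k \<Rightarrow> (real \<Rightarrow> real^'k) set" where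
  "det_strategies T M F S x0 = {x. (\<lambda>t \<omega>. x t) \<in> strategies T M F S x0}"

definition indistinguishable ::
    "'a measure \<Rightarrow> (real \<Rightarrow> 'a \<Rightarrow> real^'k) \<Rightarrow> (real \<Rightarrow> 'a \<Rightarrow> real^'k) \<Rightarrow> bool" where
  "indistinguishable M X Y \<longleftrightarrow> (AE \<omega> in M. \<forall>t\<ge>0. X t \<omega> = Y t \<omega>)"

text \<open>The vector \<open>\<integral>\<^sub>S G(\<bar>t - s\<bar>) dx\<^sub>s\<close>.\<close>

definition kernel_integral ::
    "(real \<Rightarrow> real^'k^'k) \<Rightarrow> real set \<Rightarrow> (real \<Rightarrow> real^'k) \<Rightarrow> real \<Rightarrow> real^'k" where
  "kernel_integral G S x t =
     (\<chi> i. \<Sum>j\<in>UNIV. stieltjes_integral S (\<lambda>s. sym_ext G (t - s) $ i $ j) (\<lambda>s. x s $ j))"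

definition path_cost ::
    "(real \<Rightarrow> real^'k^'k) \<Rightarrow> real set \<Rightarrow> (real \<Rightarrow> real^'k) \<Rightarrow> real" where
  "path_cost G S x =
     1/2 * (\<Sum>i\<in>UNIV. stieltjes_integral S (\<lambda>t. kernel_integral G S x t $ i) (\<lambda>t. x t $ i))"

text \<open>
  The costs of a strategy are determined only outside a null set, hence measurable only with
  respect to the completion of the \<open>\<sigma>\<close>-algebra; the expectation is therefore taken there.
\<close>

definition expected_cost ::
    "'a measure \<Rightarrow> (real \<Rightarrow> real^'k^'k) \<Rightarrow> real set \<Rightarrow> (real \<Rightarrow> 'a \<Rightarrow> real^'k) \<Rightarrow> real" where
  "expected_cost M G S X = (\<integral>\<omega>. path_cost G S (\<lambda>t. X t \<omega>) \<partial>completion M)"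

definition fredholm_solution ::
    "(real \<Rightarrow> real^'k^'k) \<Rightarrow> real set \<Rightarrow> real^'k \<Rightarrow> (real \<Rightarrow> real^'k) \<Rightarrow> bool" where
  "fredholm_solution G S l x \<longleftrightarrow> (\<forall>t\<in>S. kernel_integral G S x t = l)"


section \<open>Strategies on finite grids\<close>

definition time_grids :: "real set \<Rightarrow> real set set" where
  "time_grids S = {S'. S' \<subseteq> S \<and> finite S' \<and> S' \<noteq> {}}"

text \<open>The trades are indexed by the grid points; values at other times are irrelevant.\<close>

definition grid_strategies ::
    "'a measure \<Rightarrow> (real \<Rightarrow> 'a measure) \<Rightarrow> real set \<Rightarrow> real^'k \<Rightarrow> (real \<Rightarrow> 'a \<Rightarrow> real^'k) set" where
  "grid_strategies M F S' x0 = {\<xi>.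
     (\<forall>t\<in>S'. \<xi> t \<in> borel_measurable (F t) \<and> (\<exists>c. \<forall>\<omega>\<in>space M. norm (\<xi> t \<omega>) \<le> c)) \<and>
     (AE \<omega> in M. x0 + (\<Sum>t\<in>S'. \<xi> t \<omega>) = 0)}"

definition expected_grid_cost ::
    "'a measure \<Rightarrow> (real \<Rightarrow> real^'k^'k) \<Rightarrow> real set \<Rightarrow> (real \<Rightarrow> 'a \<Rightarrow> real^'k) \<Rightarrow> real" where
  "expected_grid_cost M G S' \<xi> =
     (\<integral>\<omega>. 1/2 * (\<Sum>t\<in>S'. \<Sum>s\<in>S'. \<xi> t \<omega> \<bullet> (sym_ext G (t - s) *v \<xi> s \<omega>)) \<partial>M)"

end

(*
  Proof idea. A commuting family of symmetric matrices has an orthonormal basis of common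
  eigenvectors, so that the costs of a path split into the energies of its coordinates with respect
  to the convex kernels g given by the eigenvalues. Such a g is a uniform limit on compact intervals
  of nonnegative combinations of constants and tents max 0 (a - \<bar>t\<bar>); the energy of a signed
  measure m for a tent is the integral of m({u..<u + a})^2 over u. Hence the energy is strictly
  positive definite.

  In one coordinate, a probability measure on the compact set that minimizes the energy exists by
  Helly's theorem. Its potential is at least the minimal energy q on the set and equals q almost
  everywhere; as g is convex and nonincreasing, the potential at any other point is bounded by its
  values on the carrier, so it equals q on the whole set. This is the Fredholm equation. A path that
  solves it is orthogonal to all differences of strategies with the same initial value, and positive
  definiteness makes it the unique minimizer, even path by path for random strategies. Contracting
  the optimal measures to finite grids approximates the optimal costs.
*)

theory Submission
  imports Defs
begin

section \<open>Total variation\<close>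

text \<open>The Jordan decomposition behind the integrals depends nonlinearly on the path, while a
  change to the eigenbasis needs integrals that are linear in it. Calculations therefore go through
  Riemann sums, whose limits are the integrals; the same limits make the costs of a random strategy
  measurable. Candidates for the optimum are probability measures because signed measures of given
  mass offer no compactness: the energy does not control the total variation. The price is that
  minimality yields only an inequality for the potential on the set. The maximum principle turns it
  into an equality at every point of an arbitrary compact set, so convexity enters twice, through
  the tents and through this principle. Nonconstancy is needed for each eigenvalue separately: the
  energy of a constant kernel vanishes on all paths of total mass zero. Finite grids are compact
  sets, so grid minimizers come from the same argument.\<close>

definition vsum :: "(real \<Rightarrow> real) \<Rightarrow> real list \<Rightarrow> real" where
  "vsum f ts = (\<Sum>i<length ts - 1. \<bar>f (ts ! Suc i) - f (ts ! i)\<bar>)"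

lemma vsum_Nil [simp]: "vsum f [] = 0"
  by (simp add: vsum_def)

lemma vsum_singleton [simp]: "vsum f [p] = 0"
  by (simp add: vsum_def)

lemma vsum_snoc [simp]: "vsum f (ts @ [p, q]) = vsum f (ts @ [p]) + \<bar>f q - f p\<bar>"
proof -
  have "vsum f (ts @ [p, q]) = (\<Sum>i<Suc (length ts). \<bar>f ((ts @ [p, q]) ! Suc i) - f ((ts @ [p, q]) ! i)\<bar>)"
    by (simp add: vsum_def)
  also have "\<dots> = (\<Sum>i<length ts. \<bar>f ((ts @ [p, q]) ! Suc i) - f ((ts @ [p, q]) ! i)\<bar>) + \<bar>f q - f p\<bar>"
    by (simp add: nth_append)
  also have "(\<Sum>i<length ts. \<bar>f ((ts @ [p, q]) ! Suc i) - f ((ts @ [p, q]) ! i)\<bar>) =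
      (\<Sum>i<length ts. \<bar>f ((ts @ [p]) ! Suc i) - f ((ts @ [p]) ! i)\<bar>)"
    by (intro sum.cong) (auto simp: nth_append less_Suc_eq)
  finally show ?thesis
    by (simp add: vsum_def)
qed

lemma total_variation_eq_vsum:
  "total_variation S f = (SUP ts \<in> {ts. sorted ts \<and> set ts \<subseteq> S}. ennreal (vsum f ts))"
  unfolding total_variation_def vsum_def by (subst sum_ennreal) auto

lemma total_variation_leI:
  assumes "\<And>ts. sorted ts \<Longrightarrow> set ts \<subseteq> S \<Longrightarrow> vsum f ts \<le> c"
  shows "total_variation S f \<le> ennreal c"
  unfolding total_variation_eq_vsum using assms by (auto intro!: SUP_least ennreal_leI)

lemma vsum_le_total_variation:
  assumes "sorted ts" "set ts \<subseteq> S"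
  shows "ennreal (vsum f ts) \<le> total_variation S f"
  unfolding total_variation_eq_vsum using assms by (auto intro!: SUP_upper)

definition locally_bv :: "(real \<Rightarrow> real) \<Rightarrow> bool" where
  "locally_bv f \<longleftrightarrow> (\<forall>t\<ge>0. total_variation {0..t} f < \<infinity>)"

lemma locally_bv_less_top: "locally_bv f \<Longrightarrow> total_variation {0..t} f < \<top>"
proof (cases "t \<ge> 0")
  case False
  then have "total_variation {0..t} f \<le> ennreal 0"
    by (intro total_variation_leI) simp
  then show ?thesis
    by (simp add: le_less_trans)
qed (auto simp: locally_bv_def)

lemma variation_fun_nonneg: "0 \<le> variation_fun f t"
  by (simp add: variation_fun_def)

lemma variation_fun_nonpos_time:
  assumes "t \<le> 0"
  shows "variation_fun f t = 0"
proof -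
  have "vsum f ts \<le> 0" if "set ts \<subseteq> {0..t}" for ts
  proof -
    have "\<forall>i<length ts. ts ! i = 0"
      using that assms nth_mem by fastforce
    then show ?thesis
      by (auto simp: vsum_def intro!: sum_nonpos)
  qed
  then have "total_variation {0..t} f \<le> ennreal 0"
    by (intro total_variation_leI)
  then show ?thesis
    by (simp add: variation_fun_def)
qed

lemma vsum_le_variation_fun:
  assumes "locally_bv f" "sorted ts" "set ts \<subseteq> {0..t}"
  shows "vsum f ts \<le> variation_fun f t"
proof -
  have "ennreal (vsum f ts) \<le> ennreal (variation_fun f t)"
    unfolding variation_fun_def using vsum_le_total_variation[OF assms(2,3)] locally_bv_less_top[OF assms(1)]
    by simp
  then show ?thesis
    by (simp add: variation_fun_nonneg)
qed

lemma variation_fun_leI: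
  assumes "\<And>ts. sorted ts \<Longrightarrow> set ts \<subseteq> {0..t} \<Longrightarrow> vsum f ts \<le> c" "0 \<le> c"
  shows "variation_fun f t \<le> c"
proof -
  have "total_variation {0..t} f \<le> ennreal c"
    by (rule total_variation_leI) (use assms in auto)
  then have "enn2real (total_variation {0..t} f) \<le> enn2real (ennreal c)"
    by (rule enn2real_mono) simp
  then show ?thesis
    using assms(2) by (simp add: variation_fun_def)
qed

text \<open>A partition of \<open>{0..s}\<close> prolonged by \<open>s\<close> and \<open>t\<close>
  is a partition of \<open>{0..t}\<close>. That the increments of the variation dominate those of
  \<open>f\<close> makes both Jordan parts monotone.\<close>

lemma abs_diff_le_variation_fun:
  assumes f: "locally_bv f" and st: "0 \<le> s" "s \<le> t"
  shows "\<bar>f t - f s\<bar> \<le> variation_fun f t - variation_fun f s"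
proof -
  have ts: "vsum f ts \<le> variation_fun f t - \<bar>f t - f s\<bar>" if "sorted ts" "set ts \<subseteq> {0..s}" for ts
  proof (cases ts rule: rev_cases)
    case Nil
    have "vsum f ([] @ [s, t]) \<le> variation_fun f t"
      by (rule vsum_le_variation_fun) (use f st in auto)
    then show ?thesis
      unfolding vsum_snoc using Nil by simp
  next
    case (snoc us p)
    have "vsum f ((us @ [p]) @ [s, t]) \<le> variation_fun f t"
      by (rule vsum_le_variation_fun) (use f st that snoc in \<open>auto simp: sorted_append\<close>)
    then show ?thesis
      unfolding vsum_snoc using snoc by simp
  qed
  have "variation_fun f s \<le> variation_fun f t - \<bar>f t - f s\<bar>"
    using ts[of "[]"] by (intro variation_fun_leI ts) auto
  then show ?thesis
    by simp
qed

text \<open>Inserting \<open>s\<close> into the partition separates the increments counted by the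
  variation up to \<open>s\<close> from the later ones, which telescope against \<open>W\<close>.
  The induction removes the last point.\<close>

lemma vsum_le_dominated:
  assumes f: "locally_bv f" and "0 \<le> s"
    and W: "\<And>p q. s \<le> p \<Longrightarrow> p \<le> q \<Longrightarrow> \<bar>f q - f p\<bar> \<le> W q - W p"
    and "sorted (ts @ [q])" "set (ts @ [q]) \<subseteq> {0..}" "s \<le> q"
  shows "vsum f (ts @ [q]) \<le> variation_fun f s + (W q - W s)"
  using assms(4-6)
proof (induction ts arbitrary: q rule: rev_induct)
  case Nil
  then show ?case
    using W[of s q] variation_fun_nonneg[of f s] by simp
next
  case (snoc p ts)
  have split: "vsum f ((ts @ [p]) @ [q]) = vsum f (ts @ [p]) + \<bar>f q - f p\<bar>" for q
    by simp
  show ?case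
  proof (cases "s \<le> p")
    case True
    then have "vsum f (ts @ [p]) \<le> variation_fun f s + (W p - W s)"
      using snoc by (intro snoc.IH) (auto simp: sorted_append)
    then show ?thesis
      unfolding split using W[of p q] True snoc.prems by (auto simp: sorted_append)
  next
    case False
    \<comment> \<open>Here \<open>p < s \<le> q\<close>; the triangle inequality routes the
      increment from \<open>p\<close> to \<open>q\<close> through \<open>s\<close>.\<close>
    have "vsum f ((ts @ [p]) @ [s]) \<le> variation_fun f s"
      using False snoc f by (intro vsum_le_variation_fun) (force simp: sorted_append)+
    then show ?thesis
      unfolding split using W[of s q] snoc.prems by auto
  qed
qed

text \<open>Complements \<open>abs_diff_le_variation_fun\<close>: among all functions whose
  increments dominate those of \<open>f\<close>, the variation has the smallest increments. With
  \<open>W = 0\<close> it shows that the variation stops growing beyond \<open>T\<close>; with a sum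
  of monotone paths it locates the support of a strategy.\<close>

lemma variation_fun_diff_le:
  assumes f: "locally_bv f" and "0 \<le> s" "s \<le> t"
    and W: "\<And>p q. s \<le> p \<Longrightarrow> p \<le> q \<Longrightarrow> \<bar>f q - f p\<bar> \<le> W q - W p"
  shows "variation_fun f t - variation_fun f s \<le> W t - W s"
proof -
  have Wst: "0 \<le> W t - W s"
    using W[OF order_refl \<open>s \<le> t\<close>] by linarith
  have "vsum f ts \<le> variation_fun f s + (W t - W s)" if ts: "sorted ts" "set ts \<subseteq> {0..t}" for ts
  proof (cases ts rule: rev_cases)
    case Nil
    then show ?thesis
      using Wst variation_fun_nonneg[of f s] by simp
  next
    case (snoc us q)
    show ?thesis
    proof (cases "s \<le> q")
      case True
      have "vsum f ts \<le> variation_fun f s + (W q - W s)"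
        unfolding snoc by (rule vsum_le_dominated) (use assms ts snoc True in auto)
      then show ?thesis
        using W[of q t] True ts snoc by auto
    next
      case False
      have "vsum f ts \<le> variation_fun f s"
        using False ts snoc f by (intro vsum_le_variation_fun) (force simp: sorted_append)+
      then show ?thesis
        using Wst by auto
    qed
  qed
  then show ?thesis
    using variation_fun_leI[of t f "variation_fun f s + (W t - W s)"] Wst variation_fun_nonneg[of f s]
    by auto
qed

text \<open>This telescoping bound does not presuppose \<open>locally_bv f\<close>; it serves to
  establish it.\<close>

lemma vsum_le_increment:
  assumes W: "\<And>p q. 0 \<le> p \<Longrightarrow> p \<le> q \<Longrightarrow> \<bar>f q - f p\<bar> \<le> W q - W p"
    and "sorted (ts @ [q])" "set (ts @ [q]) \<subseteq> {0..}"
  shows "vsum f (ts @ [q]) \<le> W q - W 0"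
  using assms(2-3)
proof (induction ts arbitrary: q rule: rev_induct)
  case Nil
  then show ?case
    using W[of 0 q] by simp
next
  case (snoc p ts)
  have "vsum f ((ts @ [p]) @ [q]) = vsum f (ts @ [p]) + \<bar>f q - f p\<bar>"
    by simp
  moreover have "vsum f (ts @ [p]) \<le> W p - W 0"
    using snoc by (intro snoc.IH) (auto simp: sorted_append)
  ultimately show ?case
    using W[of p q] snoc.prems by (auto simp: sorted_append)
qed

lemma total_variation_le_increment:
  assumes W: "\<And>p q. 0 \<le> p \<Longrightarrow> p \<le> q \<Longrightarrow> \<bar>f q - f p\<bar> \<le> W q - W p"
    and "S \<subseteq> {0..}" and c: "\<And>t. t \<in> S \<Longrightarrow> W t - W 0 \<le> c" "0 \<le> c"
  shows "total_variation S f \<le> ennreal c"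
proof (rule total_variation_leI)
  fix ts assume ts: "sorted ts" "set ts \<subseteq> S"
  show "vsum f ts \<le> c"
  proof (cases ts rule: rev_cases)
    case Nil
    then show ?thesis using c by simp
  next
    case (snoc us q)
    have "vsum f ts \<le> W q - W 0"
      unfolding snoc by (rule vsum_le_increment) (use assms ts snoc in auto)
    then show ?thesis
      using c(1)[of q] ts snoc by auto
  qed
qed

lemma locally_bvI:
  assumes W: "\<And>p q. 0 \<le> p \<Longrightarrow> p \<le> q \<Longrightarrow> \<bar>f q - f p\<bar> \<le> W q - W p"
  shows "locally_bv f"
  unfolding locally_bv_def
proof safe
  fix t :: real assume "0 \<le> t"
  have "total_variation {0..t} f \<le> ennreal (W t - W 0)"
  proof (rule total_variation_le_increment[OF W])
    fix u assume "u \<in> {0..t}"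
    then show "W u - W 0 \<le> W t - W 0"
      using W[of u t] by auto
  next
    show "0 \<le> W t - W 0"
      using W[of 0 t] \<open>0 \<le> t\<close> by auto
  qed auto
  then show "total_variation {0..t} f < \<infinity>"
    by (simp add: le_less_trans)
qed

lemma locally_bv_sum:
  fixes f :: "'i \<Rightarrow> real \<Rightarrow> real"
  assumes "finite I" "\<And>i. i \<in> I \<Longrightarrow> locally_bv (f i)"
  shows "locally_bv (\<lambda>t. \<Sum>i\<in>I. c i * f i t)"
proof (rule locally_bvI)
  fix p q :: real assume pq: "0 \<le> p" "p \<le> q"
  have "\<bar>(\<Sum>i\<in>I. c i * f i q) - (\<Sum>i\<in>I. c i * f i p)\<bar> = \<bar>\<Sum>i\<in>I. c i * (f i q - f i p)\<bar>"
    by (simp add: sum_subtractf right_diff_distrib)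
  also have "\<dots> \<le> (\<Sum>i\<in>I. \<bar>c i\<bar> * \<bar>f i q - f i p\<bar>)"
    by (rule order_trans[OF sum_abs]) (simp add: abs_mult)
  also have "\<dots> \<le> (\<Sum>i\<in>I. \<bar>c i\<bar> * (variation_fun (f i) q - variation_fun (f i) p))"
    by (intro sum_mono mult_left_mono abs_diff_le_variation_fun assms pq) auto
  finally show "\<bar>(\<Sum>i\<in>I. c i * f i q) - (\<Sum>i\<in>I. c i * f i p)\<bar>
      \<le> (\<Sum>i\<in>I. \<bar>c i\<bar> * variation_fun (f i) q) - (\<Sum>i\<in>I. \<bar>c i\<bar> * variation_fun (f i) p)"
    by (simp add: sum_subtractf right_diff_distrib)
qed

text \<open>Monotonicity gives one half. For the other, a partition that nearly attains the
  variation at \<open>t\<close> is capped at \<open>u < t\<close>: the capped points lie in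
  \<open>{0..u}\<close>, and the capped sums converge as \<open>u\<close> tends to \<open>t\<close>
  because \<open>f\<close> is left-continuous at \<open>t\<close>.\<close>

lemma variation_fun_left_continuous:
  assumes f: "locally_bv f" and cont: "\<And>t. t > 0 \<Longrightarrow> continuous (at_left t) f"
  shows "continuous (at_left t) (variation_fun f)"
proof (cases "t \<le> 0")
  case True
  have "eventually (\<lambda>u. u < t) (at_left t)"
    by (simp add: eventually_at_filter)
  then have "eventually (\<lambda>u. variation_fun f t = variation_fun f u) (at_left t)"
    by eventually_elim (use True in \<open>simp add: variation_fun_nonpos_time\<close>)
  then show ?thesis
    unfolding continuous_within using tendsto_eventually by (metis (mono_tags, lifting) eventually_mono)
next
  case False
  then have t: "t > 0" by simp
  show ?thesis
    unfolding continuous_within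
  proof (rule order_tendstoI)
    fix c assume "variation_fun f t < c"
    have "eventually (\<lambda>u. 0 < u \<and> u < t) (at_left t)"
      using t eventually_at_left_field by blast
    then show "eventually (\<lambda>u. variation_fun f u < c) (at_left t)"
    proof eventually_elim
      case (elim u)
      then show ?case
        using abs_diff_le_variation_fun[OF f, of u t] \<open>variation_fun f t < c\<close> by auto
    qed
  next
    fix c assume c: "c < variation_fun f t"
    obtain ts where ts: "sorted ts" "set ts \<subseteq> {0..t}" "c < vsum f ts"
    proof -
      have "\<exists>ts. sorted ts \<and> set ts \<subseteq> {0..t} \<and> c < vsum f ts"
      proof (rule ccontr)
        assume *: "\<not> ?thesis"
        have "0 \<le> c"
          using * by (force dest: spec[of _ "[]"])
        then have "variation_fun f t \<le> c"
          using * by (intro variation_fun_leI) force+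
        then show False
          using c by simp
      qed
      then show ?thesis
        using that by blast
    qed
    have lim1: "((\<lambda>u. f (min u p)) \<longlongrightarrow> f p) (at_left t)" if "p \<in> {0..t}" for p
    proof (cases "p = t")
      case True
      have "eventually (\<lambda>u. u < t) (at_left t)"
        by (simp add: eventually_at_filter)
      then have "eventually (\<lambda>u. f u = f (min u p)) (at_left t)"
        by eventually_elim (simp add: True)
      with cont[OF t] show ?thesis
        unfolding continuous_within True using Lim_transform_eventually by fastforce
    next
      case False
      then have "p < t" using that by auto
      then have "eventually (\<lambda>u. p < u) (at_left t)"
        using eventually_at_left_field by blast
      then have "eventually (\<lambda>u. f (min u p) = f p) (at_left t)"
        by eventually_elim simp
      then show ?thesis
        by (rule tendsto_eventually)
    qed
    have "((\<lambda>u. vsum f (map (min u) ts)) \<longlongrightarrow> vsum f ts) (at_left t)"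
    proof -
      have mem: "ts ! i \<in> {0..t}" if "i < length ts" for i
        using ts(2) that nth_mem by blast
      have "((\<lambda>u. \<Sum>i<length ts - 1. \<bar>f (min u (ts ! Suc i)) - f (min u (ts ! i))\<bar>) \<longlongrightarrow> vsum f ts) (at_left t)"
        unfolding vsum_def by (intro tendsto_intros lim1 mem) auto
      then show ?thesis
        unfolding vsum_def by simp
    qed
    then have "eventually (\<lambda>u. c < vsum f (map (min u) ts)) (at_left t)"
      using ts(3) by (rule order_tendstoD)
    moreover have "eventually (\<lambda>u. 0 < u \<and> u < t) (at_left t)"
      using t eventually_at_left_field by blast
    ultimately show "eventually (\<lambda>u. c < variation_fun f u) (at_left t)"
    proof eventually_elim
      case (elim u)
      have "sorted (map (min u) ts)"
        using ts(1) by (auto simp: sorted_iff_nth_mono intro: min.coboundedI2)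
      moreover have "set (map (min u) ts) \<subseteq> {0..u}"
        using ts(2) elim by auto
      ultimately have "vsum f (map (min u) ts) \<le> variation_fun f u"
        by (rule vsum_le_variation_fun[OF f])
      then show ?case
        using elim by simp
    qed
  qed
qed

section \<open>Stieltjes integrals as limits of Riemann sums\<close>

definition carried_by :: "real set \<Rightarrow> real measure \<Rightarrow> bool" where
  "carried_by S A \<longleftrightarrow> finite_measure A \<and> sets A = sets borel \<and> (AE t in A. t \<in> S)"

text \<open>Functions on the whole line, although only values on a compact set matter: they are
  integrable against every finite Borel measure and can serve as test functions for weak
  convergence.\<close>

definition bcont :: "(real \<Rightarrow> real) \<Rightarrow> bool" where
  "bcont g \<longleftrightarrow> continuous_on UNIV g \<and> bounded (range g)"

lemma bcont_const [simp, intro]: "bcont (\<lambda>_. c)"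
  by (simp add: bcont_def)

lemma bcont_bound:
  assumes "bcont g"
  obtains C where "0 \<le> C" "\<And>t. \<bar>g t\<bar> \<le> C"
proof -
  obtain D where D: "\<And>t. \<bar>g t\<bar> \<le> D"
    using assms unfolding bcont_def bounded_iff by auto
  have "0 \<le> D"
    using D[of 0] by linarith
  then show ?thesis
    using D by (rule that)
qed

lemma bcontI: "continuous_on UNIV g \<Longrightarrow> (\<And>t. \<bar>g t\<bar> \<le> C) \<Longrightarrow> bcont g"
  unfolding bcont_def bounded_iff by auto

lemma bcont_sum [intro]:
  assumes "\<And>i. i \<in> I \<Longrightarrow> bcont (g i)"
  shows "bcont (\<lambda>t. \<Sum>i\<in>I. c i * g i t)"
proof -
  have cont: "continuous_on UNIV (\<lambda>t. \<Sum>i\<in>I. c i * g i t)"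
    using assms by (intro continuous_intros) (auto simp: bcont_def)
  have "\<exists>C. \<forall>t. \<bar>g i t\<bar> \<le> C" if "i \<in> I" for i
    using bcont_bound[OF assms[OF that]] by metis
  then obtain C where C: "\<And>i t. i \<in> I \<Longrightarrow> \<bar>g i t\<bar> \<le> C i"
    by metis
  have bound: "\<bar>\<Sum>i\<in>I. c i * g i t\<bar> \<le> (\<Sum>i\<in>I. \<bar>c i\<bar> * C i)" for t
    by (rule order_trans[OF sum_abs]) (auto simp: abs_mult intro!: sum_mono mult_left_mono C)
  show ?thesis
    using cont bound by (rule bcontI)
qed

lemma bcont_isCont: "bcont g \<Longrightarrow> isCont g t"
  by (simp add: bcont_def continuous_on_eq_continuous_at)

lemma bcont_measurable: "bcont g \<Longrightarrow> g \<in> borel_measurable borel"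
  by (auto simp: bcont_def intro: borel_measurable_continuous_onI)

lemma carried_by_space: "carried_by S A \<Longrightarrow> space A = UNIV"
  using sets_eq_imp_space_eq[of A borel] by (simp add: carried_by_def)

lemma carried_by_integrable:
  assumes A: "carried_by S A" and g: "bcont g"
  shows "integrable A g"
proof -
  interpret finite_measure A using A by (simp add: carried_by_def)
  obtain C where "\<And>t. \<bar>g t\<bar> \<le> C"
    using bcont_bound[OF g] by metis
  moreover have "g \<in> borel_measurable A"
    using bcont_measurable[OF g] A by (simp add: carried_by_def cong: measurable_cong_sets)
  ultimately show ?thesis
    by (intro integrable_const_bound[of _ C]) auto
qed

text \<open>The grid runs beyond \<open>T\<close>, so that the sum sees an atom at \<open>T\<close>.\<close>

definition rs_sum :: "real \<Rightarrow> nat \<Rightarrow> (real \<Rightarrow> real) \<Rightarrow> (real \<Rightarrow> real) \<Rightarrow> real" where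
  "rs_sum T n g f = (\<Sum>k<nat (\<lceil>T\<rceil> + 1) * Suc n.
     g (real k / Suc n) * (f (real (Suc k) / Suc n) - f (real k / Suc n)))"

lemma grid_tendsto: "(\<lambda>n. of_int \<lfloor>t * real (Suc n)\<rfloor> / Suc n) \<longlonglongrightarrow> (t::real)"
proof (rule Lim_null[THEN iffD2], rule tendsto_rabs_zero_cancel)
  have "\<bar>of_int \<lfloor>t * real (Suc n)\<rfloor> / Suc n - t\<bar> \<le> 1 / Suc n" for n
  proof -
    have "of_int \<lfloor>t * real (Suc n)\<rfloor> / Suc n - t = (of_int \<lfloor>t * real (Suc n)\<rfloor> - t * real (Suc n)) / Suc n"
      by (simp add: field_simps)
    moreover have "\<bar>of_int \<lfloor>t * real (Suc n)\<rfloor> - t * real (Suc n)\<bar> \<le> 1"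
      by linarith
    ultimately show ?thesis
      by (simp add: divide_right_mono)
  qed
  then show "(\<lambda>n. \<bar>of_int \<lfloor>t * real (Suc n)\<rfloor> / Suc n - t\<bar>) \<longlonglongrightarrow> 0"
    by (intro tendsto_sandwich[OF _ _ tendsto_const LIMSEQ_inverse_real_of_nat])
      (auto simp: inverse_eq_divide)
qed

text \<open>The increment of \<open>f\<close> over a cell is the measure of the cell, so the Riemann
  sum is exactly the integral of \<open>g\<close> taken at the left end point of the cell of
  \<open>t\<close>. Dominated convergence does the rest.\<close>

lemma rs_sum_tendsto_integral:
  assumes A: "carried_by {0..T} A" and "0 \<le> T" and g: "bcont g"
    and f: "\<And>s t. 0 \<le> s \<Longrightarrow> s \<le> t \<Longrightarrow> f t - f s = measure A {s..<t}"
  shows "(\<lambda>n. rs_sum T n g f) \<longlonglongrightarrow> (\<integral>t. g t \<partial>A)"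
proof -
  interpret finite_measure A using A by (simp add: carried_by_def)
  have [measurable_cong, simp]: "sets A = sets borel"
    using A by (simp add: carried_by_def)
  have [measurable]: "g \<in> borel_measurable borel"
    using g by (rule bcont_measurable)
  obtain C where C: "\<And>t. \<bar>g t\<bar> \<le> C"
    using bcont_bound[OF g] by metis
  define N where "N n = nat (\<lceil>T\<rceil> + 1) * Suc n" for n
  define I where "I n k = {real k / Suc n..<real (Suc k) / Suc n}" for n k
  have cell: "(\<Sum>k<N n. g (real k / Suc n) * indicator (I n k) t) = g (of_int \<lfloor>t * real (Suc n)\<rfloor> / Suc n)"
    if t: "t \<in> {0..T}" for t n
  proof -
    have fl: "0 \<le> \<lfloor>t * real (Suc n)\<rfloor>"
      using t by simp
    have "t * real (Suc n) < (of_int \<lceil>T\<rceil> + 1) * real (Suc n)"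
      using t by (intro mult_strict_right_mono) (auto, linarith)
    also have "\<dots> = real (N n)"
      using \<open>0 \<le> T\<close> by (simp add: N_def algebra_simps)
    finally have less: "nat \<lfloor>t * real (Suc n)\<rfloor> < N n"
      using fl by linarith
    have "t \<in> I n k \<longleftrightarrow> k = nat \<lfloor>t * real (Suc n)\<rfloor>" for k
    proof -
      have "t \<in> I n k \<longleftrightarrow> real k \<le> t * real (Suc n) \<and> t * real (Suc n) < real (Suc k)"
        by (auto simp: I_def field_simps)
      also have "\<dots> \<longleftrightarrow> int k = \<lfloor>t * real (Suc n)\<rfloor>"
        by linarith
      also have "\<dots> \<longleftrightarrow> k = nat \<lfloor>t * real (Suc n)\<rfloor>"
        using fl by linarith
      finally show ?thesis .
    qed
    then have "(\<Sum>k<N n. g (real k / Suc n) * indicator (I n k) t) =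
        (\<Sum>k<N n. if k = nat \<lfloor>t * real (Suc n)\<rfloor> then g (real k / Suc n) else 0)"
      by (intro sum.cong) (auto simp: indicator_def)
    also have "\<dots> = g (of_int \<lfloor>t * real (Suc n)\<rfloor> / Suc n)"
      using less fl by simp
    finally show ?thesis .
  qed
  have "rs_sum T n g f = (\<integral>t. g (of_int \<lfloor>t * real (Suc n)\<rfloor> / Suc n) \<partial>A)" for n
  proof -
    have "rs_sum T n g f = (\<Sum>k<N n. g (real k / Suc n) * measure A (I n k))"
      unfolding rs_sum_def N_def I_def by (intro sum.cong refl) (subst f, auto simp: divide_right_mono)
    also have "\<dots> = (\<integral>t. (\<Sum>k<N n. g (real k / Suc n) * indicator (I n k) t) \<partial>A)"
    proof (subst Bochner_Integration.integral_sum)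
      show "integrable A (\<lambda>t. g (real k / Suc n) * indicator (I n k) t)" for k
        by (intro integrable_mult_right integrable_real_indicator) (simp_all add: I_def emeasure_eq_measure)
    qed (simp add: carried_by_space[OF A])
    also have "\<dots> = (\<integral>t. g (of_int \<lfloor>t * real (Suc n)\<rfloor> / Suc n) \<partial>A)"
    proof (rule integral_cong_AE)
      show "AE t in A. (\<Sum>k<N n. g (real k / Suc n) * indicator (I n k) t) = g (of_int \<lfloor>t * real (Suc n)\<rfloor> / Suc n)"
        using A cell unfolding carried_by_def by (auto elim: eventually_mono)
      show "(\<lambda>t. \<Sum>k<N n. g (real k / Suc n) * indicator (I n k) t) \<in> borel_measurable A"
        by (intro borel_measurable_sum borel_measurable_times borel_measurable_const borel_measurable_indicator)
          (simp add: I_def)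
      show "(\<lambda>t. g (of_int \<lfloor>t * real (Suc n)\<rfloor> / Suc n)) \<in> borel_measurable A"
        by measurable
    qed
    finally show ?thesis .
  qed
  moreover have "(\<lambda>n. \<integral>t. g (of_int \<lfloor>t * real (Suc n)\<rfloor> / Suc n) \<partial>A) \<longlonglongrightarrow> (\<integral>t. g t \<partial>A)"
  proof (rule integral_dominated_convergence[where w="\<lambda>_. C"])
    have "(\<lambda>n. g (of_int \<lfloor>t * real (Suc n)\<rfloor> / Suc n)) \<longlonglongrightarrow> g t" for t
      by (rule isCont_tendsto_compose[OF bcont_isCont[OF g] grid_tendsto])
    then show "AE t in A. (\<lambda>n. g (of_int \<lfloor>t * real (Suc n)\<rfloor> / Suc n)) \<longlonglongrightarrow> g t"
      by simp
  qed (auto simp: C)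
  ultimately show ?thesis
    by simp
qed

lemma measure_Ico:
  assumes A: "carried_by S A" and "s \<le> t"
  shows "measure A {s..<t} = measure A {s..} - measure A {t..}"
proof -
  interpret finite_measure A using A by (simp add: carried_by_def)
  have "measure A {s..} = measure A ({s..<t} \<union> {t..})"
    using \<open>s \<le> t\<close> by (simp add: ivl_disj_un)
  also have "\<dots> = measure A {s..<t} + measure A {t..}"
    using A by (intro finite_measure_Union) (auto simp: carried_by_def)
  finally show ?thesis
    by simp
qed

lemma bcont_infdist: "bcont (\<lambda>t. min 1 (infdist t S))"
  by (rule bcontI[where C=1]) (auto intro!: continuous_intros simp: infdist_nonneg)

text \<open>Support in a closed set becomes the vanishing of the integral of one bounded continuous
  function, a form that survives weak limits, mixtures and limits of Riemann sums.\<close>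

lemma AE_in_closed_iff:
  fixes N :: "real measure"
  assumes N: "finite_measure N" "sets N = sets borel" and S: "closed S" "S \<noteq> {}"
  shows "(AE t in N. t \<in> S) \<longleftrightarrow> (\<integral>t. min 1 (infdist t S) \<partial>N) = 0"
proof -
  have "carried_by UNIV N"
    using N by (simp add: carried_by_def)
  then have "integrable N (\<lambda>t. min 1 (infdist t S))"
    using bcont_infdist by (rule carried_by_integrable)
  then have "(\<integral>t. min 1 (infdist t S) \<partial>N) = 0 \<longleftrightarrow> (AE t in N. min 1 (infdist t S) = 0)"
    by (intro integral_nonneg_eq_0_iff_AE) (auto simp: infdist_nonneg)
  moreover have "min 1 (infdist t S) = 0 \<longleftrightarrow> t \<in> S" for t
    using in_closed_iff_infdist_zero[OF S] by (auto simp: min_def)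
  ultimately show ?thesis
    by simp
qed

lemma AE_dominated:
  assumes A: "carried_by {0..T} A" and B: "\<And>i. i \<in> I \<Longrightarrow> carried_by {0..T} (B i)"
    and "0 \<le> T" and S: "closed S" "S \<noteq> {}"
    and BS: "\<And>i. i \<in> I \<Longrightarrow> AE t in B i. t \<in> S"
    and le: "\<And>s t. 0 \<le> s \<Longrightarrow> s \<le> t \<Longrightarrow> measure A {s..<t} \<le> (\<Sum>i\<in>I. c i * measure (B i) {s..<t})"
  shows "AE t in A. t \<in> S"
proof -
  define h where "h t = min 1 (infdist t S)" for t
  have h: "bcont h"
    unfolding h_def by (rule bcont_infdist)
  have h_nonneg: "0 \<le> h t" for t
    by (simp add: h_def infdist_nonneg)
  have incr: "measure X {0..<t} - measure X {0..<s} = measure X {s..<t}"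
    if "carried_by {0..T} X" "0 \<le> s" "s \<le> t" for X s t
    using that measure_Ico[of "{0..T}" X] by simp
  have lim: "(\<lambda>n. rs_sum T n h (\<lambda>t. measure X {0..<t})) \<longlonglongrightarrow> (\<integral>t. h t \<partial>X)" if "carried_by {0..T} X" for X
    using that \<open>0 \<le> T\<close> h incr[OF that] by (rule rs_sum_tendsto_integral)
  have B0: "(\<integral>t. h t \<partial>B i) = 0" if "i \<in> I" for i
    unfolding h_def using AE_in_closed_iff[of "B i", OF _ _ S] B[OF that] BS[OF that] by (simp add: carried_by_def)
  have "(\<lambda>n. \<Sum>i\<in>I. c i * rs_sum T n h (\<lambda>t. measure (B i) {0..<t})) \<longlonglongrightarrow> (\<Sum>i\<in>I. c i * (\<integral>t. h t \<partial>B i))"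
    by (intro tendsto_intros lim B)
  then have lim0: "(\<lambda>n. \<Sum>i\<in>I. c i * rs_sum T n h (\<lambda>t. measure (B i) {0..<t})) \<longlonglongrightarrow> 0"
    by (simp add: B0)
  have "rs_sum T n h (\<lambda>t. measure A {0..<t}) \<le> (\<Sum>i\<in>I. c i * rs_sum T n h (\<lambda>t. measure (B i) {0..<t}))" for n
  proof -
    let ?D = "\<lambda>X k. measure X {0..<real (Suc k) / Suc n} - measure X {0..<real k / Suc n}"
    have "?D A k \<le> (\<Sum>i\<in>I. c i * ?D (B i) k)" for k
    proof -
      have k: "0 \<le> real k / Suc n" "real k / Suc n \<le> real (Suc k) / Suc n"
        by (auto simp: divide_right_mono)
      show ?thesis
        using le[OF k] incr[OF A k] incr[OF B k] by simp
    qed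
    then have "rs_sum T n h (\<lambda>t. measure A {0..<t})
        \<le> (\<Sum>k<nat (\<lceil>T\<rceil> + 1) * Suc n. h (real k / Suc n) * (\<Sum>i\<in>I. c i * ?D (B i) k))"
      unfolding rs_sum_def by (intro sum_mono mult_left_mono h_nonneg) auto
    also have "\<dots> = (\<Sum>i\<in>I. c i * rs_sum T n h (\<lambda>t. measure (B i) {0..<t}))"
      unfolding rs_sum_def sum_distrib_left by (subst sum.swap) (simp add: mult_ac)
    finally show ?thesis .
  qed
  then have "(\<integral>t. h t \<partial>A) \<le> 0"
    by (intro LIMSEQ_le[OF lim[OF A] lim0]) auto
  moreover have "0 \<le> (\<integral>t. h t \<partial>A)"
    by (simp add: h_nonneg)
  ultimately have "(\<integral>t. h t \<partial>A) = 0"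
    by simp
  then show ?thesis
    unfolding h_def using AE_in_closed_iff[of A, OF _ _ S] A by (simp add: carried_by_def)
qed

section \<open>Measures of nondecreasing functions and of the Jordan parts of a path\<close>

lemma left_interval_measure_Ico:
  assumes mono: "mono H" and cont: "\<And>t. continuous (at_left t) H" and "s \<le> t"
  shows "emeasure (left_interval_measure H) {s..<t} = ennreal (H t - H s)"
proof -
  have [simp]: "uminus -` {s..<t} = {-t<..-s}"
    by auto
  have rc: "continuous (at_right a) (\<lambda>u. - H (- u))" for a
  proof -
    have "(H \<longlongrightarrow> H (- a)) (at_left (- a))"
      using cont[of "-a"] by (simp only: continuous_within)
    then have "((\<lambda>u. H (- u)) \<longlongrightarrow> H (- a)) (at_right a)"
      unfolding at_left_minus[of "-a"] by (simp add: filterlim_filtermap)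
    then show ?thesis
      unfolding continuous_within by (intro tendsto_intros)
  qed
  show ?thesis
    unfolding left_interval_measure_def
    using \<open>s \<le> t\<close> mono rc
    by (subst emeasure_distr) (auto simp: emeasure_interval_measure_Ioc mono_def)
qed

lemma sets_left_interval_measure [simp, measurable_cong]: "sets (left_interval_measure H) = sets borel"
  by (simp add: left_interval_measure_def)

lemma space_left_interval_measure [simp]: "space (left_interval_measure H) = UNIV"
  by (simp add: left_interval_measure_def)

lemma
  assumes mono: "mono H" and cont: "\<And>t. continuous (at_left t) H"
    and low: "\<And>t. t \<le> 0 \<Longrightarrow> H t = 0" and high: "\<And>t. T < t \<Longrightarrow> H t = c" and T: "0 \<le> T"
  shows left_interval_measure_carried_by: "carried_by {0..T} (left_interval_measure H)"
    and left_interval_measure_measure: "s \<le> t \<Longrightarrow> measure (left_interval_measure H) {s..<t} = H t - H s"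
proof -
  note Ico = left_interval_measure_Ico[OF mono cont]
  let ?L = "left_interval_measure H"
  have Hle: "H s \<le> H t" if "s \<le> t" for s t
    using mono that by (simp add: mono_def)
  have "0 \<le> c"
    using low[of 0] high[of "T+1"] Hle[of 0 "T+1"] T by simp
  show "measure ?L {s..<t} = H t - H s" if "s \<le> t"
    using Ico[OF that] Hle[OF that] by (simp add: measure_def)
  have "emeasure ?L UNIV = (SUP n. emeasure ?L {- real n..<real n})"
  proof -
    have "(\<Union>n. {- real n..<real n}) = UNIV"
    proof safe
      fix x :: real
      obtain n where "\<bar>x\<bar> < real n"
        using reals_Archimedean2 by blast
      then show "x \<in> (\<Union>n. {- real n..<real n})"
        by (auto intro!: exI[of _ n])
    qed auto
    moreover have "incseq (\<lambda>n. {- real n..<real n})"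
      by (auto simp: incseq_def)
    ultimately show ?thesis
      using SUP_emeasure_incseq[of "\<lambda>n. {- real n..<real n}" ?L] by (simp add: image_subset_iff)
  qed
  also have "\<dots> \<le> ennreal c"
  proof (rule SUP_least)
    fix n
    have "emeasure ?L {- real n..<real n} = ennreal (H n)"
      using low[of "-real n"] by (subst Ico) auto
    also have "H n \<le> H (max n (T + 1))"
      by (intro Hle) auto
    also have "\<dots> = c"
      by (intro high) auto
    finally show "emeasure ?L {- real n..<real n} \<le> ennreal c"
      by (auto intro: ennreal_leI)
  qed
  finally have fin: "finite_measure ?L"
    by (intro finite_measureI) (auto simp: top_unique)
  have "{..<0} = (\<Union>n. {- real n..<0::real})"
  proof safe
    fix x :: real assume "x < 0"
    obtain n where "- x < real n"
      using reals_Archimedean2 by blast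
    then show "x \<in> (\<Union>n. {- real n..<0})"
      using \<open>x < 0\<close> by (auto intro!: exI[of _ n])
  qed auto
  moreover have "(\<Union>n. {- real n..<0}) \<in> null_sets ?L"
  proof (rule null_sets_UN)
    show "{- real n..<0} \<in> null_sets ?L" for n
      using Ico[of "- real n" 0] by (auto simp: low null_sets_def)
  qed
  ultimately have 1: "{..<0} \<in> null_sets ?L"
    by simp
  \<comment> \<open>The intervals start strictly above \<open>T\<close>: a jump of \<open>H\<close>
    right after \<open>T\<close> is the atom at \<open>T\<close> and must not be counted outside
    \<open>{0..T}\<close>.\<close>
  have "{T<..} = (\<Union>n. {T + 1 / Suc n..<T + Suc n})"
  proof safe
    fix x assume "T < x"
    obtain n1 where n1: "1 / Suc n1 < x - T"
      using \<open>T < x\<close> nat_approx_posE[of "x - T"] by auto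
    obtain n2 where n2: "x - T < real n2"
      using reals_Archimedean2 by blast
    have "1 / Suc (max n1 n2) \<le> 1 / Suc n1"
      by (intro divide_left_mono) auto
    then show "x \<in> (\<Union>n. {T + 1 / Suc n..<T + Suc n})"
      using n1 n2 by (auto intro!: exI[of _ "max n1 n2"])
  next
    fix x n assume "x \<in> {T + 1 / Suc n..<T + Suc n}"
    moreover have "0 < 1 / real (Suc n)" by simp
    ultimately show "T < x" unfolding atLeastLessThan_iff by linarith
  qed
  moreover have "(\<Union>n. {T + 1 / Suc n..<T + Suc n}) \<in> null_sets ?L"
  proof (rule null_sets_UN)
    fix n
    have "1 / Suc n \<le> Suc n"
      by (simp add: field_simps)
    then have "emeasure ?L {T + 1 / Suc n..<T + Suc n} = 0"
      by (subst Ico) (auto simp: high)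
    then show "{T + 1 / Suc n..<T + Suc n} \<in> null_sets ?L"
      by (auto simp: null_sets_def)
  qed
  ultimately have 2: "{T<..} \<in> null_sets ?L"
    by simp
  have "AE t in ?L. t \<in> {0..T}"
    using AE_not_in[OF 1] AE_not_in[OF 2] by eventually_elim auto
  with fin show "carried_by {0..T} ?L"
    by (simp add: carried_by_def)
qed

text \<open>Vanishing beyond \<open>T\<close> fixes the total mass of \<open>df\<close> as
  \<open>- f 0\<close>. Left continuity is demanded at positive times only, since values at negative
  times carry no meaning and \<open>df\<close> may have an atom at \<open>0\<close>.\<close>

definition fv_path :: "real \<Rightarrow> (real \<Rightarrow> real) \<Rightarrow> bool" where
  "fv_path T f \<longleftrightarrow> 0 \<le> T \<and> locally_bv f \<and> (\<forall>t>0. continuous (at_left t) f) \<and> (\<forall>t>T. f t = 0)"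

lemma continuous_at_left_cong:
  fixes f h :: "real \<Rightarrow> 'b::topological_space"
  assumes "\<And>u. a < u \<Longrightarrow> u \<le> t \<Longrightarrow> f u = h u" "a < t"
  shows "continuous (at_left t) f \<longleftrightarrow> continuous (at_left t) h"
proof -
  have "eventually (\<lambda>u. a < u \<and> u < t) (at_left t)"
    using assms(2) eventually_at_left_field by blast
  then have "eventually (\<lambda>u. f u = h u) (at_left t)"
    by eventually_elim (use assms in auto)
  then show ?thesis
    unfolding continuous_within using assms by (subst tendsto_cong) auto
qed

lemma
  assumes f: "fv_path T f"
  shows variation_fun_mono: "mono (variation_fun f)"
    and pos_variation_mono: "mono (pos_variation f)"
    and neg_variation_mono: "mono (neg_variation f)"
    and variation_fun_cont: "\<And>t. continuous (at_left t) (variation_fun f)"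
    and pos_variation_cont: "\<And>t. continuous (at_left t) (pos_variation f)"
    and neg_variation_cont: "\<And>t. continuous (at_left t) (neg_variation f)"
    and variation_fun_const: "\<And>t. T < t \<Longrightarrow> variation_fun f t = variation_fun f (T + 1)"
    and pos_variation_const: "\<And>t. T < t \<Longrightarrow> pos_variation f t = (variation_fun f (T + 1) - f 0) / 2"
    and neg_variation_const: "\<And>t. T < t \<Longrightarrow> neg_variation f t = (variation_fun f (T + 1) + f 0) / 2"
    and pos_variation_low: "\<And>t. t \<le> 0 \<Longrightarrow> pos_variation f t = 0"
    and neg_variation_low: "\<And>t. t \<le> 0 \<Longrightarrow> neg_variation f t = 0"
proof -
  have bv: "locally_bv f" and lc: "\<And>t. t > 0 \<Longrightarrow> continuous (at_left t) f"
    and T: "0 \<le> T" and hi: "\<And>t. t > T \<Longrightarrow> f t = 0"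
    using f by (auto simp: fv_path_def)
  have incr: "\<bar>f (max 0 t) - f (max 0 s)\<bar> \<le> variation_fun f t - variation_fun f s" if "s \<le> t" for s t
  proof (cases "s \<le> 0")
    case True
    show ?thesis
    proof (cases "t \<le> 0")
      case True
      then show ?thesis
        using \<open>s \<le> 0\<close> by (simp add: variation_fun_nonpos_time)
    next
      case False
      then show ?thesis
        using \<open>s \<le> 0\<close> abs_diff_le_variation_fun[OF bv, of 0 t] by (simp add: variation_fun_nonpos_time)
    qed
  qed (use that abs_diff_le_variation_fun[OF bv, of s t] in auto)
  show "mono (variation_fun f)"
    using incr by (force simp: mono_def)
  show "mono (pos_variation f)" "mono (neg_variation f)"
    using incr by (force simp: mono_def pos_variation_def neg_variation_def intro!: divide_right_mono)+
  show V: "continuous (at_left t) (variation_fun f)" for t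
    using variation_fun_left_continuous[OF bv lc] .
  have m: "continuous (at_left t) (\<lambda>u. f (max 0 u))" for t
  proof (cases "t > 0")
    case True
    then show ?thesis
      using lc[OF True] continuous_at_left_cong[of 0 t "\<lambda>u. f (max 0 u)" f] by auto
  next
    case False
    then show ?thesis
      using continuous_at_left_cong[of "t - 1" t "\<lambda>u. f (max 0 u)" "\<lambda>_. f 0"] by auto
  qed
  show "continuous (at_left t) (pos_variation f)" "continuous (at_left t) (neg_variation f)" for t
    unfolding pos_variation_def neg_variation_def by (intro continuous_intros V m; simp)+
  show const: "variation_fun f t = variation_fun f (T + 1)" if "T < t" for t
  proof -
    \<comment> \<open>From a time \<open>u > T\<close> on the path is identically \<open>0\<close>,
      so the zero function dominates its increments. A jump right after \<open>T\<close> is already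
      contained in the variation up to \<open>u\<close>.\<close>
    have le: "variation_fun f v \<le> variation_fun f u" if "T < u" "u \<le> v" for u v
      using variation_fun_diff_le[OF bv, of u v "\<lambda>_. 0"] T that hi by auto
    show ?thesis
      using le[of t "T+1"] le[of "T+1" t] \<open>mono (variation_fun f)\<close> that
      by (cases t "T + 1" rule: linorder_cases) (auto simp: mono_def intro!: antisym)
  qed
  show "pos_variation f t = (variation_fun f (T + 1) - f 0) / 2"
    "neg_variation f t = (variation_fun f (T + 1) + f 0) / 2" if "T < t" for t
    using const[OF that] hi[OF that] T that by (auto simp: pos_variation_def neg_variation_def)
  show "pos_variation f t = 0" "neg_variation f t = 0" if "t \<le> 0" for t
    using that by (auto simp: pos_variation_def neg_variation_def variation_fun_nonpos_time)
qed

abbreviation pos_measure :: "(real \<Rightarrow> real) \<Rightarrow> real measure" where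
  "pos_measure f \<equiv> left_interval_measure (pos_variation f)"

abbreviation neg_measure :: "(real \<Rightarrow> real) \<Rightarrow> real measure" where
  "neg_measure f \<equiv> left_interval_measure (neg_variation f)"

lemma
  assumes f: "fv_path T f"
  shows pos_measure_carried_by: "carried_by {0..T} (pos_measure f)"
    and neg_measure_carried_by: "carried_by {0..T} (neg_measure f)"
    and variation_measure_carried_by: "carried_by {0..T} (left_interval_measure (variation_fun f))"
    and pos_measure_Ico: "s \<le> t \<Longrightarrow> measure (pos_measure f) {s..<t} = pos_variation f t - pos_variation f s"
    and neg_measure_Ico: "s \<le> t \<Longrightarrow> measure (neg_measure f) {s..<t} = neg_variation f t - neg_variation f s"
    and variation_measure_Ico: "s \<le> t \<Longrightarrow>
      measure (left_interval_measure (variation_fun f)) {s..<t} = variation_fun f t - variation_fun f s"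
proof -
  have T: "0 \<le> T" using f by (simp add: fv_path_def)
  note * = T pos_variation_mono[OF f] pos_variation_cont[OF f] pos_variation_low[OF f] pos_variation_const[OF f]
    neg_variation_mono[OF f] neg_variation_cont[OF f] neg_variation_low[OF f] neg_variation_const[OF f]
    variation_fun_mono[OF f] variation_fun_cont[OF f] variation_fun_nonpos_time variation_fun_const[OF f]
  show "carried_by {0..T} (pos_measure f)" "carried_by {0..T} (neg_measure f)"
    "carried_by {0..T} (left_interval_measure (variation_fun f))"
    by (rule left_interval_measure_carried_by; rule *; assumption)+
  show "measure (pos_measure f) {s..<t} = pos_variation f t - pos_variation f s" if "s \<le> t"
    by (rule left_interval_measure_measure[OF *(2-5) T that])
  show "measure (neg_measure f) {s..<t} = neg_variation f t - neg_variation f s" if "s \<le> t"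
    by (rule left_interval_measure_measure[OF *(6-9) T that])
  show "measure (left_interval_measure (variation_fun f)) {s..<t} = variation_fun f t - variation_fun f s" if "s \<le> t"
    by (rule left_interval_measure_measure[OF *(10-13) T that])
qed

definition path_integral :: "(real \<Rightarrow> real) \<Rightarrow> (real \<Rightarrow> real) \<Rightarrow> real" where
  "path_integral g f = (\<integral>t. g t \<partial>pos_measure f) - (\<integral>t. g t \<partial>neg_measure f)"

text \<open>The Jordan parts are not additive in \<open>f\<close>, but the Riemann sums are linear
  in it. Linearity of the integral in the path thus follows by uniqueness of limits.\<close>

lemma rs_sum_tendsto_path_integral:
  assumes f: "fv_path T f" and g: "bcont g"
  shows "(\<lambda>n. rs_sum T n g f) \<longlonglongrightarrow> path_integral g f"
proof -
  have T: "0 \<le> T" using f by (simp add: fv_path_def)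
  have "(\<lambda>n. rs_sum T n g (pos_variation f) - rs_sum T n g (neg_variation f)) \<longlonglongrightarrow> path_integral g f"
    unfolding path_integral_def
    using pos_measure_carried_by[OF f] neg_measure_carried_by[OF f] T g
    by (intro tendsto_diff rs_sum_tendsto_integral)
      (auto simp: pos_measure_Ico[OF f] neg_measure_Ico[OF f])
  moreover have "rs_sum T n g (pos_variation f) - rs_sum T n g (neg_variation f) = rs_sum T n g f" for n
    unfolding rs_sum_def sum_subtractf[symmetric]
    by (intro sum.cong refl) (simp add: pos_variation_def neg_variation_def field_simps)
  ultimately show ?thesis
    by simp
qed

lemma fv_path_sum:
  assumes "finite I" "\<And>i. i \<in> I \<Longrightarrow> fv_path T (f i)" "0 \<le> T"
  shows "fv_path T (\<lambda>t. \<Sum>i\<in>I. c i * f i t)"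
  using assms unfolding fv_path_def
  by (auto intro!: locally_bv_sum continuous_intros)

lemma path_integral_sum_path:
  assumes I: "finite I" and f: "\<And>i. i \<in> I \<Longrightarrow> fv_path T (f i)" and T: "0 \<le> T" and g: "bcont g"
  shows "path_integral g (\<lambda>t. \<Sum>i\<in>I. c i * f i t) = (\<Sum>i\<in>I. c i * path_integral g (f i))"
proof (rule LIMSEQ_unique)
  show "(\<lambda>n. rs_sum T n g (\<lambda>t. \<Sum>i\<in>I. c i * f i t)) \<longlonglongrightarrow> path_integral g (\<lambda>t. \<Sum>i\<in>I. c i * f i t)"
    by (intro rs_sum_tendsto_path_integral fv_path_sum assms)
  have "rs_sum T n g (\<lambda>t. \<Sum>i\<in>I. c i * f i t) = (\<Sum>i\<in>I. c i * rs_sum T n g (f i))" for n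
    unfolding rs_sum_def sum_distrib_left sum_subtractf[symmetric] right_diff_distrib
    by (subst sum.swap) (simp add: mult_ac)
  then show "(\<lambda>n. rs_sum T n g (\<lambda>t. \<Sum>i\<in>I. c i * f i t)) \<longlonglongrightarrow> (\<Sum>i\<in>I. c i * path_integral g (f i))"
    by (simp only:) (intro tendsto_intros rs_sum_tendsto_path_integral f g)
qed

lemma path_integral_sum_integrand:
  assumes f: "fv_path T f" and g: "\<And>i. i \<in> I \<Longrightarrow> bcont (g i)"
  shows "path_integral (\<lambda>t. \<Sum>i\<in>I. c i * g i t) f = (\<Sum>i\<in>I. c i * path_integral (g i) f)"
  using carried_by_integrable[OF pos_measure_carried_by[OF f]] carried_by_integrable[OF neg_measure_carried_by[OF f]] g
  by (simp add: path_integral_def sum_subtractf right_diff_distrib)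

lemma fv_path_diff: "fv_path T f \<Longrightarrow> fv_path T h \<Longrightarrow> fv_path T (\<lambda>t. f t - h t)"
  using fv_path_sum[of "{True, False}" T "\<lambda>b. if b then f else h" "\<lambda>b. if b then 1 else - 1"]
  by (auto simp: fv_path_def)

lemma path_integral_diff_path:
  assumes "fv_path T f" "fv_path T h" "bcont g"
  shows "path_integral g (\<lambda>t. f t - h t) = path_integral g f - path_integral g h"
  using path_integral_sum_path[of "{True, False}" T "\<lambda>b. if b then f else h" g "\<lambda>b. if b then 1 else - 1"] assms
  by (auto simp: fv_path_def)

text \<open>The Riemann sums telescope. Their last grid point lies beyond \<open>T\<close>, where
  \<open>f\<close> vanishes, so that only the initial value remains.\<close>

lemma path_integral_const:
  assumes f: "fv_path T f"
  shows "path_integral (\<lambda>_. c) f = - c * f 0"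
proof (rule LIMSEQ_unique[OF rs_sum_tendsto_path_integral[OF f]])
  have "rs_sum T n (\<lambda>_. c) f = - c * f 0" for n
  proof -
    have "rs_sum T n (\<lambda>_. c) f = c * (f (real (nat (\<lceil>T\<rceil> + 1) * Suc n) / Suc n) - f 0)"
      unfolding rs_sum_def sum_distrib_left[symmetric]
      by (subst sum_lessThan_telescope[of "\<lambda>k. f (real k / Suc n)"]) simp
    moreover have "real (nat (\<lceil>T\<rceil> + 1) * Suc n) / Suc n = real (nat (\<lceil>T\<rceil> + 1))"
      unfolding of_nat_mult by (rule nonzero_mult_div_cancel_right) simp
    moreover have "T < real (nat (\<lceil>T\<rceil> + 1))"
      by linarith
    ultimately show ?thesis
      using f by (simp add: fv_path_def)
  qed
  then show "(\<lambda>n. rs_sum T n (\<lambda>_. c) f) \<longlonglongrightarrow> - c * f 0"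
    by simp
qed auto

text \<open>Each Riemann sum is at most \<open>C\<close> times the variation of \<open>f\<close>
  along the grid. The bound is what makes the costs of random strategies essentially
  bounded.\<close>

lemma path_integral_bound:
  assumes f: "fv_path T f" and g: "bcont g" and C: "\<And>t. \<bar>g t\<bar> \<le> C"
    and V: "total_variation {0..} f \<le> ennreal v" "0 \<le> v"
  shows "\<bar>path_integral g f\<bar> \<le> C * v"
proof (rule LIMSEQ_le_const2)
  show "(\<lambda>n. \<bar>rs_sum T n g f\<bar>) \<longlonglongrightarrow> \<bar>path_integral g f\<bar>"
    by (intro tendsto_intros rs_sum_tendsto_path_integral f g)
  have "0 \<le> C" using C[of 0] by linarith
  have "\<bar>rs_sum T n g f\<bar> \<le> C * v" for n
  proof -
    define N where "N = nat (\<lceil>T\<rceil> + 1) * Suc n"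
    define ts where "ts = map (\<lambda>k. real k / Suc n) [0..<Suc N]"
    have "\<bar>rs_sum T n g f\<bar> \<le> (\<Sum>k<N. C * \<bar>f (real (Suc k) / Suc n) - f (real k / Suc n)\<bar>)"
      unfolding rs_sum_def N_def
      by (rule order_trans[OF sum_abs]) (auto simp: abs_mult intro!: sum_mono mult_right_mono C)
    also have "\<dots> = C * vsum f ts"
      unfolding vsum_def ts_def sum_distrib_left
      by (intro sum.cong) (auto simp: nth_append simp del: upt_Suc)
    also have "vsum f ts \<le> v"
    proof -
      have "sorted ts"
        unfolding ts_def by (auto simp: sorted_iff_nth_mono divide_right_mono simp del: upt_Suc)
      then have "ennreal (vsum f ts) \<le> ennreal v"
        by (intro order_trans[OF vsum_le_total_variation V(1)]) (auto simp: ts_def)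
      then show ?thesis
        using V(2) by simp
    qed
    finally show ?thesis
      using \<open>0 \<le> C\<close> by (simp add: mult_left_mono)
  qed
  then show "\<exists>N. \<forall>n\<ge>N. \<bar>rs_sum T n g f\<bar> \<le> C * v"
    by blast
qed

section \<open>Paths with a given measure, and the support of a path\<close>

lemma measure_atLeast_eq_0:
  assumes A: "carried_by {0..T} A" and "T < t"
  shows "measure A {t..} = 0"
proof -
  have "AE u in A. u \<notin> {t..}"
    using A \<open>T < t\<close> unfolding carried_by_def by (auto elim: eventually_mono)
  then show ?thesis
    using A by (auto simp: measure_eq_0_null_sets AE_iff_null_sets carried_by_space[OF A] carried_by_def)
qed

text \<open>The closed half-lines \<open>{u..}\<close> decrease to \<open>{t..}\<close> as
  \<open>u\<close> increases to \<open>t\<close>, so this is continuity of \<open>A\<close> from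
  above.\<close>

lemma measure_atLeast_left_continuous:
  assumes A: "carried_by S A"
  shows "continuous (at_left t) (\<lambda>u. measure A {u..})"
  unfolding continuous_within
proof (rule tendsto_at_left_sequentially[of "t - 1"])
  interpret finite_measure A using A by (simp add: carried_by_def)
  have [simp]: "sets A = sets borel"
    using A by (simp add: carried_by_def)
  fix X :: "nat \<Rightarrow> real" assume X: "\<And>n. X n < t" "\<And>n. t - 1 < X n" "incseq X" "X \<longlonglongrightarrow> t"
  have "(\<lambda>n. measure A {X n..}) \<longlonglongrightarrow> measure A (\<Inter>n. {X n..})"
    using X by (intro finite_Lim_measure_decseq) (auto simp: decseq_def incseq_def intro: order_trans)
  moreover have "(\<Inter>n. {X n..}) = {t..}"
    using X(1,4) by (auto intro: LIMSEQ_le_const2 order_trans[OF less_imp_le])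
  ultimately show "(\<lambda>n. measure A {X n..}) \<longlonglongrightarrow> measure A {t..}"
    by simp
qed simp

text \<open>The negative tail function is the path with \<open>df = A\<close> that vanishes beyond
  \<open>T\<close>. It is nondecreasing and hence dominates its own increments. The two integrals
  agree because they are limits of the same Riemann sums.\<close>

lemma
  assumes A: "carried_by {0..T} A" and T: "0 \<le> T" and f: "\<And>t. 0 \<le> t \<Longrightarrow> f t = - measure A {t..}"
  shows fv_path_measure: "fv_path T f"
    and path_integral_measure: "bcont g \<Longrightarrow> path_integral g f = (\<integral>t. g t \<partial>A)"
proof -
  have incr: "f t - f s = measure A {s..<t}" if "0 \<le> s" "s \<le> t" for s t
    using that by (simp add: f measure_Ico[OF A])
  have bv: "locally_bv f"
    by (rule locally_bvI[where W=f]) (use incr measure_nonneg in auto)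
  have "continuous (at_left t) f" if "t > 0" for t
  proof -
    have "continuous (at_left t) (\<lambda>u. - measure A {u..})"
      by (intro continuous_minus measure_atLeast_left_continuous[OF A])
    then show ?thesis
      using continuous_at_left_cong[of 0 t f "\<lambda>u. - measure A {u..}"] f that by auto
  qed
  moreover have "f t = 0" if "t > T" for t
  proof -
    show ?thesis
      using that T measure_atLeast_eq_0[OF A that] by (simp add: f)
  qed
  ultimately show fv: "fv_path T f"
    using bv T by (simp add: fv_path_def)
  show "path_integral g f = (\<integral>t. g t \<partial>A)" if g: "bcont g"
    by (rule LIMSEQ_unique[OF rs_sum_tendsto_path_integral[OF fv g] rs_sum_tendsto_integral[OF A T g incr]])
qed

lemma
  assumes f: "fv_path T f" and S: "supported_on f S" "closed S" "S \<noteq> {}"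
  shows supported_on_pos_measure: "AE t in pos_measure f. t \<in> S"
    and supported_on_neg_measure: "AE t in neg_measure f. t \<in> S"
proof -
  let ?V = "left_interval_measure (variation_fun f)"
  have T: "0 \<le> T" and bv: "locally_bv f"
    using f by (auto simp: fv_path_def)
  have "- S \<in> null_sets ?V"
    using S by (auto simp: supported_on_def null_sets_def)
  then have V: "AE t in ?V. t \<in> S"
    using AE_not_in by fastforce
  note dom = AE_dominated[where I="{()}" and B="\<lambda>_. ?V" and c="\<lambda>_. 1", OF _ variation_measure_carried_by[OF f] T S(2,3) V]
  have incr: "\<bar>f t - f s\<bar> \<le> variation_fun f t - variation_fun f s" if "0 \<le> s" "s \<le> t" for s t
    by (rule abs_diff_le_variation_fun[OF bv that])
  show "AE t in pos_measure f. t \<in> S"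
  proof (rule dom[OF pos_measure_carried_by[OF f]])
    fix s t :: real assume "0 \<le> s" "s \<le> t"
    then show "measure (pos_measure f) {s..<t} \<le> (\<Sum>i\<in>{()}. 1 * measure ?V {s..<t})"
      using incr[of s t] by (simp add: pos_measure_Ico[OF f] variation_measure_Ico[OF f] pos_variation_def abs_le_iff field_simps)
  qed
  show "AE t in neg_measure f. t \<in> S"
  proof (rule dom[OF neg_measure_carried_by[OF f]])
    fix s t :: real assume "0 \<le> s" "s \<le> t"
    then show "measure (neg_measure f) {s..<t} \<le> (\<Sum>i\<in>{()}. 1 * measure ?V {s..<t})"
      using incr[of s t] by (simp add: neg_measure_Ico[OF f] variation_measure_Ico[OF f] neg_variation_def abs_le_iff field_simps)
  qed
qed

text \<open>A dual form of support: integrals against \<open>df\<close> see only the values on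
  \<open>S\<close>. Unlike \<open>supported_on\<close>, which speaks of the variation of a single
  path, it passes directly to linear combinations, and so to coordinates in another basis.\<close>

definition charges_only :: "real \<Rightarrow> real set \<Rightarrow> (real \<Rightarrow> real) \<Rightarrow> bool" where
  "charges_only T S f \<longleftrightarrow> fv_path T f \<and>
     (\<forall>g h. bcont g \<longrightarrow> bcont h \<longrightarrow> (\<forall>t\<in>S. g t = h t) \<longrightarrow> path_integral g f = path_integral h f)"

lemma
  assumes f: "fv_path T f" and S: "supported_on f S" "closed S" "S \<noteq> {}"
  shows supported_on_charges_only: "charges_only T S f"
    and stieltjes_integral_eq_path_integral: "bcont g \<Longrightarrow> stieltjes_integral S g f = path_integral g f"
proof -
  note pos = supported_on_pos_measure[OF assms] and neg = supported_on_neg_measure[OF assms]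
  have cong: "(\<integral>t. g t \<partial>left_interval_measure H) = (\<integral>t. h t \<partial>left_interval_measure H)"
    if "AE t in left_interval_measure H. t \<in> S" "g \<in> borel_measurable borel" "h \<in> borel_measurable borel" "\<And>t. t \<in> S \<Longrightarrow> g t = h t"
    for g h :: "real \<Rightarrow> real" and H
  proof (rule integral_cong_AE)
    show "AE t in left_interval_measure H. g t = h t"
      using that(1) by eventually_elim (rule that(4))
  qed (use that in simp_all)
  have "path_integral g f = path_integral h f" if "bcont g" "bcont h" "\<forall>t\<in>S. g t = h t" for g h
    unfolding path_integral_def using that
    by (intro arg_cong2[where f="(-)"] cong[OF pos] cong[OF neg] bcont_measurable) auto
  then show "charges_only T S f"
    unfolding charges_only_def using f by blast
  show "stieltjes_integral S g f = path_integral g f" if "bcont g"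
  proof -
    have [measurable]: "S \<in> sets borel" "g \<in> borel_measurable borel"
      using S that by (auto intro: bcont_measurable)
    show ?thesis
      unfolding stieltjes_integral_def path_integral_def set_lebesgue_integral_def
      by (intro arg_cong2[where f="(-)"] cong[OF pos] cong[OF neg]) auto
  qed
qed

lemma charges_only_sum:
  assumes I: "finite I" and f: "\<And>i. i \<in> I \<Longrightarrow> charges_only T S (f i)" and T: "0 \<le> T"
  shows "charges_only T S (\<lambda>t. \<Sum>i\<in>I. c i * f i t)"
  unfolding charges_only_def
proof (intro conjI allI impI)
  have fv: "fv_path T (f i)" if "i \<in> I" for i
    using f[OF that] by (simp add: charges_only_def)
  then show "fv_path T (\<lambda>t. \<Sum>i\<in>I. c i * f i t)"
    by (intro fv_path_sum I T)
  fix g h assume *: "bcont g" "bcont h" "\<forall>t\<in>S. g t = h t"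
  have "path_integral g (\<lambda>t. \<Sum>i\<in>I. c i * f i t) = (\<Sum>i\<in>I. c i * path_integral g (f i))"
    by (rule path_integral_sum_path[OF I fv T *(1)])
  also have "\<dots> = (\<Sum>i\<in>I. c i * path_integral h (f i))"
  proof (intro sum.cong refl arg_cong2[where f="(*)"])
    fix i assume "i \<in> I"
    from f[OF this] show "path_integral g (f i) = path_integral h (f i)"
      unfolding charges_only_def using * by blast
  qed
  also have "\<dots> = path_integral h (\<lambda>t. \<Sum>i\<in>I. c i * f i t)"
    by (rule path_integral_sum_path[OF I fv T *(2), symmetric])
  finally show "path_integral g (\<lambda>t. \<Sum>i\<in>I. c i * f i t) = path_integral h (\<lambda>t. \<Sum>i\<in>I. c i * f i t)" .
qed

section \<open>Energy of measures and positive definiteness\<close>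

definition mutual_energy :: "(real \<Rightarrow> real) \<Rightarrow> real measure \<Rightarrow> real measure \<Rightarrow> real" where
  "mutual_energy k A B = (\<integral>t. (\<integral>s. k (t - s) \<partial>B) \<partial>A)"

text \<open>The energy of the signed measure \<open>A - B\<close>, expanded for an even kernel so
  that only positive measures appear.\<close>

definition diff_energy :: "(real \<Rightarrow> real) \<Rightarrow> real measure \<Rightarrow> real measure \<Rightarrow> real" where
  "diff_energy k A B = mutual_energy k A A - 2 * mutual_energy k A B + mutual_energy k B B"

lemma bcont_shift: "bcont k \<Longrightarrow> bcont (\<lambda>s. k (t - s))"
  unfolding bcont_def
  by (auto intro!: continuous_on_compose2[of UNIV k] continuous_intros elim: bounded_subset)

lemma bcont_add:
  assumes k: "bcont k" and h: "bcont h"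
  shows "bcont (\<lambda>t. k t + h t)"
proof -
  obtain C D where "\<And>t. \<bar>k t\<bar> \<le> C" "\<And>t. \<bar>h t\<bar> \<le> D"
    using bcont_bound[OF k] bcont_bound[OF h] by metis
  then have "\<bar>k t + h t\<bar> \<le> C + D" for t
    by (meson abs_triangle_ineq add_mono order_trans)
  moreover have "continuous_on UNIV (\<lambda>t. k t + h t)"
    using k h by (intro continuous_on_add) (auto simp: bcont_def)
  ultimately show ?thesis
    by (intro bcontI)
qed

lemma bcont_potential:
  assumes B: "carried_by S B" and k: "bcont k"
  shows "bcont (\<lambda>t. \<integral>s. k (t - s) \<partial>B)"
proof -
  interpret finite_measure B using B by (simp add: carried_by_def)
  have [measurable_cong]: "sets B = sets borel"
    using B by (simp add: carried_by_def)
  have [measurable]: "k \<in> borel_measurable borel"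
    using k by (rule bcont_measurable)
  obtain C where C: "\<And>t. \<bar>k t\<bar> \<le> C"
    using bcont_bound[OF k] by metis
  have "isCont (\<lambda>t. \<integral>s. k (t - s) \<partial>B) t" for t
    unfolding continuous_at_sequentially comp_def
  proof safe
    fix X :: "nat \<Rightarrow> real" assume X: "X \<longlonglongrightarrow> t"
    show "(\<lambda>n. \<integral>s. k (X n - s) \<partial>B) \<longlonglongrightarrow> (\<integral>s. k (t - s) \<partial>B)"
    proof (rule integral_dominated_convergence[where w="\<lambda>_. C"])
      have "(\<lambda>n. k (X n - s)) \<longlonglongrightarrow> k (t - s)" for s
        by (rule isCont_tendsto_compose[OF bcont_isCont[OF k]]) (intro tendsto_intros X)
      then show "AE s in B. (\<lambda>n. k (X n - s)) \<longlonglongrightarrow> k (t - s)"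
        by simp
    qed (auto simp: C)
  qed
  then have "continuous_on UNIV (\<lambda>t. \<integral>s. k (t - s) \<partial>B)"
    by (simp add: continuous_at_imp_continuous_on)
  moreover have "\<bar>\<integral>s. k (t - s) \<partial>B\<bar> \<le> C * measure B (space B)" for t
  proof -
    have "\<bar>\<integral>s. k (t - s) \<partial>B\<bar> \<le> (\<integral>s. \<bar>k (t - s)\<bar> \<partial>B)"
      by (rule integral_abs_bound)
    also have "\<dots> \<le> (\<integral>s. C \<partial>B)"
      by (intro integral_mono integrable_abs carried_by_integrable[OF B bcont_shift[OF k]]) (auto simp: C)
    finally show ?thesis
      by (simp add: mult.commute)
  qed
  ultimately show ?thesis
    by (rule bcontI)
qed

lemma mutual_energy_commute:
  assumes A: "carried_by S A" and B: "carried_by S' B" and k: "bcont k" "\<And>t. k (- t) = k t"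
  shows "mutual_energy k A B = mutual_energy k B A"
proof -
  interpret A: finite_measure A using A by (simp add: carried_by_def)
  interpret B: finite_measure B using B by (simp add: carried_by_def)
  interpret AB: pair_sigma_finite A B ..
  have [measurable_cong]: "sets A = sets borel" "sets B = sets borel"
    using A B by (auto simp: carried_by_def)
  have [measurable]: "k \<in> borel_measurable borel"
    using k(1) by (rule bcont_measurable)
  obtain C where C: "\<And>t. \<bar>k t\<bar> \<le> C"
    using bcont_bound[OF k(1)] by metis
  interpret ABf: finite_measure "A \<Otimes>\<^sub>M B"
    by (rule finite_measure_pair_measure) (unfold_locales)
  have "integrable (A \<Otimes>\<^sub>M B) (\<lambda>(t, s). k (t - s))"
    by (rule ABf.integrable_const_bound[of _ C]) (auto simp: C split: prod.split)
  then have "(\<integral>s. (\<integral>t. k (t - s) \<partial>A) \<partial>B) = (\<integral>t. (\<integral>s. k (t - s) \<partial>B) \<partial>A)"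
    by (rule AB.Fubini_integral)
  moreover have "k (t - s) = k (s - t)" for t s
    using k(2)[of "s - t"] by simp
  ultimately show ?thesis
    unfolding mutual_energy_def by simp
qed

lemma mutual_energy_const:
  "mutual_energy (\<lambda>_. c) A B = c * measure A (space A) * measure B (space B)"
  by (simp add: mutual_energy_def)

lemma mutual_energy_sum:
  assumes A: "carried_by S A" and B: "carried_by S' B" and k: "\<And>i. i \<in> I \<Longrightarrow> bcont (k i)"
  shows "mutual_energy (\<lambda>t. \<Sum>i\<in>I. c i * k i t) A B = (\<Sum>i\<in>I. c i * mutual_energy (k i) A B)"
proof -
  have "mutual_energy (\<lambda>t. \<Sum>i\<in>I. c i * k i t) A B = (\<integral>t. (\<Sum>i\<in>I. c i * (\<integral>s. k i (t - s) \<partial>B)) \<partial>A)"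
    unfolding mutual_energy_def using carried_by_integrable[OF B bcont_shift[OF k]] by simp
  also have "\<dots> = (\<Sum>i\<in>I. c i * mutual_energy (k i) A B)"
    unfolding mutual_energy_def using carried_by_integrable[OF A bcont_potential[OF B k]] by simp
  finally show ?thesis .
qed

lemma mutual_energy_add:
  assumes A: "carried_by S A" and B: "carried_by S' B" and k: "bcont k" "bcont h"
  shows "mutual_energy (\<lambda>t. k t + h t) A B = mutual_energy k A B + mutual_energy h A B"
  unfolding mutual_energy_def
  using carried_by_integrable[OF B bcont_shift[OF k(1)]] carried_by_integrable[OF B bcont_shift[OF k(2)]]
    carried_by_integrable[OF A bcont_potential[OF B k(1)]] carried_by_integrable[OF A bcont_potential[OF B k(2)]]
  by simp

text \<open>Differences of two points of \<open>{0..T}\<close> lie in \<open>{- T..T}\<close>, so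
  the two kernels are compared only there.\<close>

lemma mutual_energy_close:
  assumes A: "carried_by {0..T} A" and B: "carried_by {0..T} B" and k: "bcont k" "bcont h"
    and close: "\<And>t. \<bar>t\<bar> \<le> T \<Longrightarrow> \<bar>k t - h t\<bar> \<le> e"
  shows "\<bar>mutual_energy k A B - mutual_energy h A B\<bar> \<le> e * measure A (space A) * measure B (space B)"
proof -
  interpret A: finite_measure A using A by (simp add: carried_by_def)
  interpret B: finite_measure B using B by (simp add: carried_by_def)
  have intB: "integrable B (\<lambda>s. k (t - s))" "integrable B (\<lambda>s. h (t - s))" for t
    by (rule carried_by_integrable[OF B bcont_shift[OF k(1)]], rule carried_by_integrable[OF B bcont_shift[OF k(2)]])
  have intA: "integrable A (\<lambda>t. \<integral>s. k (t - s) \<partial>B)" "integrable A (\<lambda>t. \<integral>s. h (t - s) \<partial>B)"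
    by (rule carried_by_integrable[OF A bcont_potential[OF B k(1)]], rule carried_by_integrable[OF A bcont_potential[OF B k(2)]])
  have "AE t in A. \<bar>(\<integral>s. k (t - s) \<partial>B) - (\<integral>s. h (t - s) \<partial>B)\<bar> \<le> e * measure B (space B)"
    using A[unfolded carried_by_def, THEN conjunct2, THEN conjunct2]
  proof eventually_elim
    case (elim t)
    have "\<bar>(\<integral>s. k (t - s) \<partial>B) - (\<integral>s. h (t - s) \<partial>B)\<bar> = \<bar>\<integral>s. k (t - s) - h (t - s) \<partial>B\<bar>"
      using intB by simp
    also have "\<dots> \<le> (\<integral>s. \<bar>k (t - s) - h (t - s)\<bar> \<partial>B)"
      by (rule integral_abs_bound)
    also have "\<dots> \<le> (\<integral>s. e \<partial>B)"
    proof (rule integral_mono_AE)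
      show "AE s in B. \<bar>k (t - s) - h (t - s)\<bar> \<le> e"
        using B[unfolded carried_by_def, THEN conjunct2, THEN conjunct2]
        by eventually_elim (use elim in \<open>auto intro!: close\<close>)
    qed (auto intro!: integrable_abs Bochner_Integration.integrable_diff intB)
    finally show ?case
      by (simp add: mult.commute)
  qed
  moreover have "\<bar>mutual_energy k A B - mutual_energy h A B\<bar> \<le> (\<integral>t. \<bar>(\<integral>s. k (t - s) \<partial>B) - (\<integral>s. h (t - s) \<partial>B)\<bar> \<partial>A)"
    unfolding mutual_energy_def Bochner_Integration.integral_diff[OF intA, symmetric] by (rule integral_abs_bound)
  moreover have "(\<integral>t. \<bar>(\<integral>s. k (t - s) \<partial>B) - (\<integral>s. h (t - s) \<partial>B)\<bar> \<partial>A) \<le> (\<integral>t. e * measure B (space B) \<partial>A)" if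
    "AE t in A. \<bar>(\<integral>s. k (t - s) \<partial>B) - (\<integral>s. h (t - s) \<partial>B)\<bar> \<le> e * measure B (space B)"
    using that by (intro integral_mono_AE integrable_abs Bochner_Integration.integrable_diff intA) auto
  ultimately show ?thesis
    by (simp add: mult_ac)
qed

lemma diff_energy_close:
  assumes A: "carried_by {0..T} A" and B: "carried_by {0..T} B" and k: "bcont k" "bcont h"
    and close: "\<And>t. \<bar>t\<bar> \<le> T \<Longrightarrow> \<bar>k t - h t\<bar> \<le> e"
  shows "\<bar>diff_energy k A B - diff_energy h A B\<bar> \<le> e * (measure A (space A) + measure B (space B))\<^sup>2"
  using mutual_energy_close[OF A A k close] mutual_energy_close[OF A B k close] mutual_energy_close[OF B B k close]
  by (simp add: diff_energy_def power2_eq_square algebra_simps abs_le_iff)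

section \<open>Tent kernels\<close>

definition tent :: "real \<Rightarrow> real \<Rightarrow> real" where
  "tent a t = max 0 (a - \<bar>t\<bar>)"

lemma bcont_tent [intro]: "bcont (tent a)"
  unfolding tent_def by (rule bcontI[where C="\<bar>a\<bar>"]) (auto intro!: continuous_intros)

text \<open>
  \<open>max 0 (a - \<bar>t - s\<bar>)\<close> is the length of the set of all \<open>u\<close> such that \<open>{u..<u + a}\<close> contains \<open>s\<close> and \<open>t\<close>.
\<close>

lemma
  assumes A: "carried_by S A" and B: "carried_by S' B"
  shows window_integrable: "integrable lborel (\<lambda>u. measure A {u..<u + a} * measure B {u..<u + a})"
    and mutual_energy_tent: "mutual_energy (tent a) A B = (\<integral>u. measure A {u..<u + a} * measure B {u..<u + a} \<partial>lborel)"
proof -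
  interpret A: finite_measure A using A by (simp add: carried_by_def)
  interpret B: finite_measure B using B by (simp add: carried_by_def)
  have sets [measurable_cong, simp]: "sets A = sets borel" "sets B = sets borel"
    using A B by (auto simp: carried_by_def)
  interpret AL: pair_sigma_finite A lborel ..
  interpret BL: pair_sigma_finite B lborel ..
  \<comment> \<open>The indicator of the window takes values in \<open>ennreal\<close>, so that the
    order of integration can be exchanged for nonnegative functions, and it is jointly measurable in
    \<open>u\<close> and \<open>t\<close>.\<close>
  define J where "J u t = (if u \<le> t \<and> t < u + a then 1 else 0 :: ennreal)" for u t
  have [measurable]: "(\<lambda>p. J (fst p) (snd p)) \<in> borel_measurable (borel \<Otimes>\<^sub>M borel)"
    unfolding J_def by measurable
  have J: "J u \<in> borel_measurable X" if "sets X = sets borel" for X u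
    unfolding measurable_cong_sets[OF that refl] J_def by measurable
  have em: "emeasure X {u..<u + a} = (\<integral>\<^sup>+t. J u t \<partial>X)" if "sets X = sets borel" for X u
  proof -
    have "(\<integral>\<^sup>+t. J u t \<partial>X) = (\<integral>\<^sup>+t. indicator {u..<u + a} t \<partial>X)"
      by (intro nn_integral_cong) (auto simp: J_def indicator_def)
    then show ?thesis
      using that by (simp add: nn_integral_indicator)
  qed
  have "(\<integral>\<^sup>+u. ennreal (measure A {u..<u + a} * measure B {u..<u + a}) \<partial>lborel)
      = (\<integral>\<^sup>+u. (\<integral>\<^sup>+t. J u t \<partial>A) * (\<integral>\<^sup>+s. J u s \<partial>B) \<partial>lborel)"
    by (intro nn_integral_cong) (simp add: ennreal_mult em[symmetric] A.emeasure_eq_measure B.emeasure_eq_measure)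
  also have "\<dots> = (\<integral>\<^sup>+u. (\<integral>\<^sup>+t. (\<integral>\<^sup>+s. J u t * J u s \<partial>B) \<partial>A) \<partial>lborel)"
    by (intro nn_integral_cong) (simp add: nn_integral_cmult nn_integral_multc J)
  also have "\<dots> = (\<integral>\<^sup>+t. (\<integral>\<^sup>+u. (\<integral>\<^sup>+s. J u t * J u s \<partial>B) \<partial>lborel) \<partial>A)"
  proof (rule AL.Fubini')
    show "(\<lambda>(t, u). \<integral>\<^sup>+s. J u t * J u s \<partial>B) \<in> borel_measurable (A \<Otimes>\<^sub>M lborel)"
      unfolding J_def by measurable
  qed
  also have "\<dots> = (\<integral>\<^sup>+t. (\<integral>\<^sup>+s. (\<integral>\<^sup>+u. J u t * J u s \<partial>lborel) \<partial>B) \<partial>A)"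
  proof (rule nn_integral_cong, rule BL.Fubini')
    show "(\<lambda>(s, u). J u t * J u s) \<in> borel_measurable (B \<Otimes>\<^sub>M lborel)" for t
      unfolding J_def by measurable
  qed
  also have "\<dots> = (\<integral>\<^sup>+t. (\<integral>\<^sup>+s. ennreal (tent a (t - s)) \<partial>B) \<partial>A)"
  proof (intro nn_integral_cong)
    fix t s
    have "(\<integral>\<^sup>+u. J u t * J u s \<partial>lborel) = (\<integral>\<^sup>+u. indicator {max t s - a<..min t s} u \<partial>lborel)"
      by (intro nn_integral_cong) (auto simp: J_def indicator_def)
    also have "\<dots> = ennreal (tent a (t - s))"
    proof (cases "max t s - a \<le> min t s")
      case True
      then show ?thesis
        by (simp add: tent_def) (auto simp: max_def min_def intro!: arg_cong[where f=ennreal])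
    next
      case False
      then have "{max t s - a<..min t s} = {}"
        by auto
      then have "(\<integral>\<^sup>+u. indicator {max t s - a<..min t s} u \<partial>lborel) = (0::ennreal)"
        by (simp only:) simp
      moreover have "tent a (t - s) = 0"
        using False by (auto simp: tent_def max_def min_def abs_if split: if_splits)
      ultimately show ?thesis
        by simp
    qed
    finally show "(\<integral>\<^sup>+u. J u t * J u s \<partial>lborel) = ennreal (tent a (t - s))" .
  qed
  also have "\<dots> = (\<integral>\<^sup>+t. ennreal (\<integral>s. tent a (t - s) \<partial>B) \<partial>A)"
    by (intro nn_integral_cong nn_integral_eq_integral carried_by_integrable[OF B bcont_shift[OF bcont_tent]]) (auto simp: tent_def)
  also have "\<dots> = ennreal (mutual_energy (tent a) A B)"
    unfolding mutual_energy_def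
    by (intro nn_integral_eq_integral carried_by_integrable[OF A bcont_potential[OF B bcont_tent]]) (auto simp: tent_def)
  finally have *: "(\<integral>\<^sup>+u. ennreal (measure A {u..<u + a} * measure B {u..<u + a}) \<partial>lborel)
      = ennreal (mutual_energy (tent a) A B)" .
  have nn: "0 \<le> mutual_energy (tent a) A B"
    by (auto simp: mutual_energy_def tent_def)
  have m: "(\<lambda>u. measure X {u..<u + a}) \<in> borel_measurable borel" if X: "carried_by S'' X" for X S''
  proof -
    interpret X: finite_measure X using X by (simp add: carried_by_def)
    have [measurable_cong]: "sets X = sets borel" using X by (simp add: carried_by_def)
    have "(\<lambda>u. enn2real (\<integral>\<^sup>+t. J u t \<partial>X)) \<in> borel_measurable borel"
      by measurable
    then show ?thesis
      using em[of X] by (simp add: measure_def carried_by_def X \<open>sets X = sets borel\<close>)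
  qed
  have meas: "(\<lambda>u. measure A {u..<u + a} * measure B {u..<u + a}) \<in> borel_measurable lborel"
    using m[OF A] m[OF B] by simp
  show "integrable lborel (\<lambda>u. measure A {u..<u + a} * measure B {u..<u + a})"
    by (rule integrableI_nonneg) (use meas in \<open>auto simp: *\<close>)
  show "mutual_energy (tent a) A B = (\<integral>u. measure A {u..<u + a} * measure B {u..<u + a} \<partial>lborel)"
    by (subst integral_eq_nn_integral) (use meas nn in \<open>auto simp: *\<close>)
qed

lemma
  assumes A: "carried_by S A" and B: "carried_by S' B"
  shows diff_energy_tent: "diff_energy (tent a) A B =
      (\<integral>u. (measure A {u..<u + a} - measure B {u..<u + a})\<^sup>2 \<partial>lborel)"
    and diff_window_integrable: "integrable lborel (\<lambda>u. (measure A {u..<u + a} - measure B {u..<u + a})\<^sup>2)"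
proof -
  note int = window_integrable[OF A A, of a] window_integrable[OF A B, of a] window_integrable[OF B B, of a]
  have eq: "(measure A {u..<u + a} - measure B {u..<u + a})\<^sup>2 = measure A {u..<u + a} * measure A {u..<u + a}
      - 2 * (measure A {u..<u + a} * measure B {u..<u + a}) + measure B {u..<u + a} * measure B {u..<u + a}" for u
    by (simp add: power2_eq_square algebra_simps)
  show "diff_energy (tent a) A B = (\<integral>u. (measure A {u..<u + a} - measure B {u..<u + a})\<^sup>2 \<partial>lborel)"
    unfolding diff_energy_def mutual_energy_tent[OF A A] mutual_energy_tent[OF A B] mutual_energy_tent[OF B B] eq
    using int by simp
  show "integrable lborel (\<lambda>u. (measure A {u..<u + a} - measure B {u..<u + a})\<^sup>2)"
    unfolding eq using int by simp
qed

text \<open>Where a left-continuous function is nonzero, it stays nonzero on an interval to the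
  left, and this interval has positive Lebesgue measure.\<close>

lemma left_continuous_AE_zero:
  fixes F :: "real \<Rightarrow> real"
  assumes AE: "AE u in lborel. F u = 0" and cont: "continuous (at_left u) F"
  shows "F u = 0"
proof (rule ccontr)
  assume "F u \<noteq> 0"
  then have "eventually (\<lambda>v. F v \<noteq> 0) (at_left u)"
    using cont unfolding continuous_within by (rule tendsto_imp_eventually_ne[rotated])
  then obtain b where b: "b < u" "\<And>v. b < v \<Longrightarrow> v < u \<Longrightarrow> F v \<noteq> 0"
    unfolding eventually_at_left_field by auto
  have "AE v in lborel. v \<notin> {b<..<u}"
    using AE by eventually_elim (use b in auto)
  then have "{b<..<u} \<in> null_sets lborel"
    by (subst AE_iff_null_sets) auto
  then have "emeasure lborel {b<..<u} = 0"
    by (rule null_setsD1)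
  then show False
    using b(1) by simp
qed

text \<open>The windows of \<open>A\<close> and \<open>B\<close> have equal mass for almost every
  \<open>u\<close>, hence for every \<open>u\<close> by left continuity. So the difference of the
  tails has period \<open>a\<close>, and being \<open>0\<close> beyond \<open>T\<close> it is
  \<open>0\<close> everywhere.\<close>

lemma diff_energy_tent_zero:
  assumes A: "carried_by {0..T} A" and B: "carried_by {0..T} B" and "a > 0"
    and zero: "diff_energy (tent a) A B = 0"
  shows "measure A {u..} = measure B {u..}"
proof -
  define w where "w u = measure A {u..} - measure B {u..}" for u
  have window: "measure X {u..<u + a} = measure X {u..} - measure X {u + a..}" if "carried_by S X" for X S u
    using measure_Ico[OF that] \<open>a > 0\<close> by simp
  have "AE u in lborel. (measure A {u..<u + a} - measure B {u..<u + a})\<^sup>2 = 0"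
    using integral_nonneg_eq_0_iff_AE[OF diff_window_integrable[OF A B, of a]] zero
    by (simp add: diff_energy_tent[OF A B])
  then have AE: "AE u in lborel. w u - w (u + a) = 0"
    by (simp add: window[OF A] window[OF B] w_def algebra_simps)
  have cont: "continuous (at_left u) w" for u
    unfolding w_def by (intro continuous_diff measure_atLeast_left_continuous[OF A] measure_atLeast_left_continuous[OF B])
  have cont_shift: "continuous (at_left u) (\<lambda>u. w (u + a))" for u
  proof -
    have "(w \<longlongrightarrow> w (u + a)) (at_left (u + a))"
      using cont[of "u + a"] by (simp only: continuous_within)
    moreover have "filterlim (\<lambda>v. v + a) (at_left (u + a)) (at_left u)"
      by (auto simp: filterlim_at eventually_at_filter intro!: tendsto_eq_intros)
    ultimately show ?thesis
      unfolding continuous_within by (rule filterlim_compose)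
  qed
  have step: "w u = w (u + a)" for u
    using left_continuous_AE_zero[OF AE, of u] cont[of u] cont_shift[of u] by (simp add: continuous_diff)
  have iter: "w u = w (u + real n * a)" for n
  proof (induction n)
    case (Suc n)
    then show ?case
      using step[of "u + real n * a"] by (simp add: algebra_simps)
  qed simp
  obtain n where "T - u < real n * a"
    using reals_Archimedean3[OF \<open>a > 0\<close>] by metis
  then have "w (u + real n * a) = 0"
    unfolding w_def using measure_atLeast_eq_0[OF A] measure_atLeast_eq_0[OF B] by simp
  then show ?thesis
    using iter[of n] by (simp add: w_def)
qed

section \<open>Convex nonincreasing kernels as limits of mixtures of tents, and strict positive
  definiteness\<close>

definition scalar_kernel :: "(real \<Rightarrow> real) \<Rightarrow> bool" where
  "scalar_kernel g \<longleftrightarrow> continuous_on {0..} g \<and> (\<forall>t\<ge>0. 0 \<le> g t) \<and> antimono_on {0..} g \<and>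
     convex_on {0..} g \<and> \<not> g constant_on {0..}"

lemma
  assumes g: "scalar_kernel g"
  shows scalar_kernel_antimono: "0 \<le> s \<Longrightarrow> s \<le> t \<Longrightarrow> g t \<le> g s"
    and scalar_kernel_nonneg: "0 \<le> t \<Longrightarrow> 0 \<le> g t"
    and scalar_kernel_bcont: "bcont (\<lambda>t. g \<bar>t\<bar>)"
proof -
  show anti: "0 \<le> s \<Longrightarrow> s \<le> t \<Longrightarrow> g t \<le> g s" for s t
    using g unfolding scalar_kernel_def monotone_on_def by auto
  show nn: "0 \<le> t \<Longrightarrow> 0 \<le> g t" for t
    using g by (simp add: scalar_kernel_def)
  show "bcont (\<lambda>t. g \<bar>t\<bar>)"
  proof (rule bcontI[where C="g 0"])
    have "continuous_on {0..} g"
      using g by (simp add: scalar_kernel_def)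
    then show "continuous_on UNIV (\<lambda>t. g \<bar>t\<bar>)"
      by (rule continuous_on_compose2[where f="\<lambda>t. \<bar>t\<bar>"]) (intro continuous_intros, auto)
    show "\<bar>g \<bar>t\<bar>\<bar> \<le> g 0" for t
      using anti[of 0 "\<bar>t\<bar>"] nn[of "\<bar>t\<bar>"] by auto
  qed
qed

text \<open>The approximant interpolates \<open>g\<close> linearly at the nodes
  \<open>p k = k * h\<close>. On \<open>{0..}\<close> a tent has its only kink at its end
  \<open>a\<close>, so the weight of the tent ending at \<open>p (Suc k)\<close> is the jump of the
  slope there. These jumps are nonnegative by convexity, the last one by monotonicity.\<close>

lemma scalar_kernel_approx:
  assumes g: "scalar_kernel g" and "0 < L" "0 < e"
  shows "\<exists>n. \<exists>c a :: nat \<Rightarrow> real. (\<forall>k<n. 0 \<le> c k \<and> 0 < a k \<and> a k \<le> L) \<and>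
    (\<forall>t\<in>{0..L}. \<bar>g t - (g L + (\<Sum>k<n. c k * tent (a k) t))\<bar> \<le> e)"
proof -
  have "uniformly_continuous_on {0..L} g"
    using g unfolding scalar_kernel_def
    by (intro compact_uniformly_continuous) (auto intro: continuous_on_subset)
  then obtain d where d: "d > 0" "\<And>s t. s \<in> {0..L} \<Longrightarrow> t \<in> {0..L} \<Longrightarrow> dist s t < d \<Longrightarrow> dist (g s) (g t) < e"
    using \<open>0 < e\<close> unfolding uniformly_continuous_on_def by metis
  obtain n where n: "L < real n * d"
    using reals_Archimedean3[OF \<open>d > 0\<close>] by metis
  then have "n \<noteq> 0"
    using \<open>0 < L\<close> by (intro notI) simp
  define h where "h = L / n"
  have h: "0 < h" "h < d" "real n * h = L"
    using n \<open>n \<noteq> 0\<close> \<open>0 < L\<close> by (auto simp: h_def field_simps)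
  define p where "p k = real k * h" for k
  \<comment> \<open>The slope on the \<open>k\<close>-th cell, continued by \<open>0\<close> past
    the last node: the last weight is then minus the last slope.\<close>
  define s where "s k = (if k < n then (g (p (Suc k)) - g (p k)) / h else 0)" for k
  define c where "c k = s (Suc k) - s k" for k
  define a where "a k = p (Suc k)" for k
  define G where "G t = g L + (\<Sum>k<n. c k * tent (a k) t)" for t
  have p_nonneg: "0 \<le> p k" for k
    using h by (simp add: p_def)
  have p_Suc: "p (Suc k) = p k + h" for k
    by (simp add: p_def algebra_simps)
  have pn: "p n = L"
    using h by (simp add: p_def)
  have p_le: "p k \<le> L" if "k \<le> n" for k
    using that h unfolding p_def h(3)[symmetric] by (intro mult_right_mono) auto
  have c_nonneg: "0 \<le> c k" if "k < n" for k
  proof (cases "Suc k < n")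
    case True
    have "convex_on {0..} g"
      using g by (simp add: scalar_kernel_def)
    then have "g ((1 - 1/2) *\<^sub>R p k + (1/2) *\<^sub>R p (Suc (Suc k))) \<le> (1 - 1/2) * g (p k) + (1/2) * g (p (Suc (Suc k)))"
      by (rule convex_onD) (auto simp: p_nonneg)
    moreover have "(1 - 1/2) *\<^sub>R p k + (1/2) *\<^sub>R p (Suc (Suc k)) = p (Suc k)"
      by (simp add: p_def algebra_simps)
    ultimately have "g (p (Suc k)) - g (p k) \<le> g (p (Suc (Suc k))) - g (p (Suc k))"
      by simp
    then show ?thesis
      using True that h by (simp add: c_def s_def divide_right_mono)
  next
    case False
    have "g (p (Suc k)) \<le> g (p k)"
      by (intro scalar_kernel_antimono[OF g] p_nonneg) (use h in \<open>simp add: p_Suc\<close>)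
    then show ?thesis
      using False that h by (simp add: c_def s_def divide_nonpos_pos)
  qed
  \<comment> \<open>Backward induction: at the last node \<open>L\<close> all tents vanish. From
    \<open>p (Suc j)\<close> down to \<open>p j\<close> exactly the tents with
    \<open>j \<le> k\<close> grow, each by \<open>h\<close>, and their weights telescope to minus
    the slope on the \<open>j\<close>-th cell.\<close>
  have G_node: "G (p j) = g (p j)" if "j \<le> n" for j
    using that
  proof (induction j rule: inc_induct)
    case base
    have "tent (a k) (p n) = 0" if "k < n" for k
      using p_le[of "Suc k"] that p_nonneg[of n] by (simp add: tent_def a_def pn)
    then show ?case
      by (simp add: G_def pn)
  next
    case (step j)
    have "G (p j) - G (p (Suc j)) = (\<Sum>k<n. c k * (tent (a k) (p j) - tent (a k) (p (Suc j))))"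
      by (simp add: G_def sum_subtractf right_diff_distrib)
    also have "\<dots> = (\<Sum>k<n. if j \<le> k then c k * h else 0)"
    proof (intro sum.cong refl)
      fix k
      have "tent (a k) (p j) - tent (a k) (p (Suc j)) = (if j \<le> k then h else 0)"
      proof (cases "j \<le> k")
        case True
        then have "p (Suc j) \<le> a k"
          using h unfolding a_def p_def by (intro mult_right_mono) auto
        then show ?thesis
          using True h p_nonneg[of j] by (simp add: tent_def p_Suc)
      next
        case False
        then have "a k \<le> p j"
          using h unfolding a_def p_def by (intro mult_right_mono) auto
        then show ?thesis
          using False h p_nonneg[of j] by (simp add: tent_def p_Suc)
      qed
      then show "c k * (tent (a k) (p j) - tent (a k) (p (Suc j))) = (if j \<le> k then c k * h else 0)"
        by simp
    qed
    also have "\<dots> = (\<Sum>k\<in>{j..<n}. c k * h)"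
      by (subst sum.If_cases) (auto intro!: sum.cong)
    also have "\<dots> = (\<Sum>k\<in>{j..<n}. s (Suc k) - s k) * h"
      by (simp add: c_def sum_distrib_right)
    also have "(\<Sum>k\<in>{j..<n}. s (Suc k) - s k) = s n - s j"
      using step.hyps by (intro sum_Suc_diff') simp
    also have "(s n - s j) * h = g (p j) - g (p (Suc j))"
      using step.hyps h by (simp add: s_def)
    finally show ?case
      using step.IH by simp
  qed
  have G_anti: "G v \<le> G u" if "0 \<le> u" "u \<le> v" for u v
    unfolding G_def using that by (intro add_left_mono sum_mono mult_left_mono c_nonneg) (auto simp: tent_def)
  have close: "\<bar>g t - G t\<bar> \<le> e" if t: "0 \<le> t" "t \<le> L" for t
  proof -
    obtain j where j: "j < n" "p j \<le> t" "t \<le> p (Suc j)"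
    proof (cases "t = L")
      case True
      have "n - 1 < n" "p (n - 1) \<le> L" "p (Suc (n - 1)) = L"
        using \<open>n \<noteq> 0\<close> p_le[of "n - 1"] pn by auto
      then show ?thesis
        using that[of "n - 1"] True by simp
    next
      case False
      define j where "j = nat \<lfloor>t / h\<rfloor>"
      have "0 \<le> t / h"
        using t h by simp
      then have "real j \<le> t / h" "t / h < real (Suc j)"
        unfolding j_def by linarith+
      then have j: "p j \<le> t" "t < p (Suc j)"
        using h by (auto simp: p_def field_simps)
      have "real j * h < real n * h"
        using j(1) t False h(3) by (simp add: p_def)
      then have "real j < real n"
        by (rule mult_right_less_imp_less) (use h in simp)
      then have "j < n"
        by simp
      then show ?thesis
        using that[of j] j by simp
    qed
    \<comment> \<open>On a cell \<open>g\<close> and \<open>G\<close> are both nonincreasing and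
      agree at the ends, so both stay within the oscillation of \<open>g\<close> there.\<close>
    have "dist (g (p j)) (g (p (Suc j))) < e"
      using j p_le[of "Suc j"] p_le[of j] p_nonneg[of j] p_nonneg[of "Suc j"] h
      by (intro d(2)) (auto simp: dist_real_def p_Suc)
    moreover have "g (p (Suc j)) \<le> g t" "g t \<le> g (p j)"
      using j t p_nonneg[of j] by (auto intro!: scalar_kernel_antimono[OF g])
    moreover have "G (p (Suc j)) \<le> G t" "G t \<le> G (p j)"
      using j t p_nonneg[of j] by (auto intro!: G_anti)
    ultimately show ?thesis
      using j G_node[of j] G_node[of "Suc j"] by (auto simp: dist_real_def abs_le_iff)
  qed
  have "0 < a k \<and> a k \<le> L" if "k < n" for k
    using p_le[of "Suc k"] that h by (simp add: a_def) (simp add: p_def)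
  then show ?thesis
    using c_nonneg close unfolding G_def by (intro exI[of _ n] exI[of _ c] exI[of _ a]) auto
qed

text \<open>Nothing controls the individual weights of the tents as the approximation improves, so
  positivity of each tent energy could be lost in the limit. A bound proportional to the value of
  the tent at one point \<open>\<alpha>\<close> survives: it is linear in the kernel and sums up to
  nearly \<open>g \<alpha> - g L\<close>. The constant part \<open>g L\<close> contributes a
  nonnegative square. With \<open>\<kappa> = 0\<close> the lemma gives mere nonnegativity.\<close>

lemma diff_energy_lower_bound:
  assumes g: "scalar_kernel g" and A: "carried_by {0..T} A" and B: "carried_by {0..T} B"
    and L: "0 < L" "T \<le> L" and \<alpha>: "0 \<le> \<alpha>" "\<alpha> \<le> L" and \<kappa>: "0 \<le> \<kappa>"
    and le: "\<And>a. 0 < a \<Longrightarrow> a \<le> L \<Longrightarrow> \<kappa> * tent a \<alpha> \<le> diff_energy (tent a) A B"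
  shows "\<kappa> * (g \<alpha> - g L) \<le> diff_energy (\<lambda>t. g \<bar>t\<bar>) A B"
proof (rule field_le_epsilon)
  fix \<delta> :: real assume "0 < \<delta>"
  define m where "m = (measure A (space A) + measure B (space B))\<^sup>2"
  \<comment> \<open>The approximation error enters twice: as \<open>\<kappa> * e\<close> at the
    point \<open>\<alpha>\<close> and as \<open>e * m\<close> in the energy.\<close>
  define e where "e = \<delta> / (\<kappa> + m + 1)"
  have m: "0 \<le> m" by (simp add: m_def)
  have e: "0 < e" "e * (\<kappa> + m) \<le> \<delta>"
    using \<open>0 < \<delta>\<close> m \<kappa> by (auto simp: e_def field_simps intro!: divide_pos_pos)
  obtain n and c a :: "nat \<Rightarrow> real" where *: "\<forall>k<n. 0 \<le> c k \<and> 0 < a k \<and> a k \<le> L"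
    "\<forall>t\<in>{0..L}. \<bar>g t - (g L + (\<Sum>k<n. c k * tent (a k) t))\<bar> \<le> e"
    using scalar_kernel_approx[OF g L(1) e(1)] by blast
  have c: "0 \<le> c k" and a: "0 < a k" "a k \<le> L" if "k < n" for k
    using *(1) that by auto
  have close: "\<bar>g t - (g L + (\<Sum>k<n. c k * tent (a k) t))\<bar> \<le> e" if "0 \<le> t" "t \<le> L" for t
    using *(2) that by simp
  define k where "k t = g L + (\<Sum>k<n. c k * tent (a k) t)" for t
  have bc: "bcont (\<lambda>t. \<Sum>k<n. c k * tent (a k) t)"
    by (intro bcont_sum bcont_tent)
  have k: "bcont k"
    unfolding k_def by (intro bcont_add bcont_const bc)
  have "\<bar>diff_energy (\<lambda>t. g \<bar>t\<bar>) A B - diff_energy k A B\<bar> \<le> e * m"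
    unfolding m_def
  proof (rule diff_energy_close[OF A B scalar_kernel_bcont[OF g] k])
    fix t assume "\<bar>t\<bar> \<le> T"
    then show "\<bar>g \<bar>t\<bar> - k t\<bar> \<le> e"
      using close[of "\<bar>t\<bar>"] L by (simp add: k_def tent_def)
  qed
  moreover have "diff_energy k A B =
      g L * (measure A (space A) - measure B (space B))\<^sup>2 + (\<Sum>k<n. c k * diff_energy (tent (a k)) A B)"
  proof -
    have me: "mutual_energy k X Y = g L * measure X (space X) * measure Y (space Y) + (\<Sum>k<n. c k * mutual_energy (tent (a k)) X Y)"
      if X: "carried_by {0..T} X" and Y: "carried_by {0..T} Y" for X Y
      unfolding k_def mutual_energy_add[OF X Y bcont_const bc] mutual_energy_const
      by (subst mutual_energy_sum[OF X Y]) auto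
    show ?thesis
      unfolding diff_energy_def me[OF A A] me[OF A B] me[OF B B]
      by (simp add: power2_eq_square algebra_simps sum.distrib sum_subtractf sum_distrib_left)
  qed
  moreover have "(\<Sum>k<n. c k * (\<kappa> * tent (a k) \<alpha>)) \<le> (\<Sum>k<n. c k * diff_energy (tent (a k)) A B)"
    using a c by (intro sum_mono mult_left_mono le) auto
  moreover have "(\<Sum>k<n. c k * (\<kappa> * tent (a k) \<alpha>)) = \<kappa> * (k \<alpha> - g L)"
    by (simp add: k_def sum_distrib_left mult_ac)
  moreover have "\<kappa> * (g \<alpha> - e - g L) \<le> \<kappa> * (k \<alpha> - g L)"
    using close[OF \<alpha>] \<kappa> by (intro mult_left_mono) (auto simp: k_def abs_le_iff)
  moreover have "0 \<le> g L * (measure A (space A) - measure B (space B))\<^sup>2"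
    using scalar_kernel_nonneg[OF g] L by simp
  ultimately have "\<kappa> * (g \<alpha> - e - g L) \<le> diff_energy (\<lambda>t. g \<bar>t\<bar>) A B + e * m"
    by linarith
  then show "\<kappa> * (g \<alpha> - g L) \<le> diff_energy (\<lambda>t. g \<bar>t\<bar>) A B + \<delta>"
    using e(2) by (simp add: algebra_simps)
qed

lemma diff_energy_tent_nonneg:
  assumes "carried_by S A" "carried_by S' B"
  shows "0 \<le> diff_energy (tent a) A B"
  by (simp add: diff_energy_tent[OF assms])

lemma
  assumes g: "scalar_kernel g" and A: "carried_by {0..T} A" and B: "carried_by {0..T} B"
  shows diff_energy_nonneg: "0 \<le> diff_energy (\<lambda>t. g \<bar>t\<bar>) A B"
    and diff_energy_zero: "diff_energy (\<lambda>t. g \<bar>t\<bar>) A B = 0 \<Longrightarrow> measure A {u..} = measure B {u..}"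
proof -
  show "0 \<le> diff_energy (\<lambda>t. g \<bar>t\<bar>) A B"
    using diff_energy_lower_bound[OF g A B, of "max 1 T" 0 0] diff_energy_tent_nonneg[OF A B] by simp
  show "measure A {u..} = measure B {u..}" if zero: "diff_energy (\<lambda>t. g \<bar>t\<bar>) A B = 0"
  proof (rule ccontr)
    assume ne: "measure A {u..} \<noteq> measure B {u..}"
    obtain p where p: "0 \<le> p" "g p \<noteq> g 0"
      using g unfolding scalar_kernel_def constant_on_def by force
    \<comment> \<open>\<open>L\<close> reaches beyond \<open>T\<close> and beyond a point where
      \<open>g\<close> has dropped, so \<open>g L < g 0\<close>, and the level midway between them
      is attained at some \<open>\<alpha> > 0\<close>.\<close>
    define L where "L = max 1 (max T p)"
    have L: "0 < L" "T \<le> L" "p \<le> L"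
      by (auto simp: L_def)
    have gL: "g L < g 0"
      using scalar_kernel_antimono[OF g, of p L] scalar_kernel_antimono[OF g, of 0 p] p L by auto
    have "\<exists>\<alpha>\<ge>0. \<alpha> \<le> L \<and> g \<alpha> = (g 0 + g L) / 2"
      using gL L g unfolding scalar_kernel_def
      by (intro IVT2') (auto intro: continuous_on_subset)
    then obtain \<alpha> where \<alpha>: "0 \<le> \<alpha>" "\<alpha> \<le> L" "g \<alpha> = (g 0 + g L) / 2"
      by auto
    have "\<alpha> \<noteq> 0"
      using \<alpha>(3) gL by (intro notI) simp
    then have "0 < \<alpha>"
      using \<alpha> by simp
    define D where "D a = diff_energy (tent a) A B" for a
    have D_pos: "0 < D a" if "0 < a" for a
      using diff_energy_tent_nonneg[OF A B, of a] diff_energy_tent_zero[OF A B that, of u] ne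
      by (auto simp: D_def less_le)
    define m where "m = (measure A (space A) + measure B (space B))\<^sup>2"
    \<comment> \<open>Tents with \<open>a \<le> \<alpha>\<close> vanish at \<open>\<alpha>\<close>
      and impose nothing on the bound. On the compact range \<open>{\<alpha>..L}\<close> the
      positive tent energy is Lipschitz continuous in \<open>a\<close> and so has a positive minimum
      \<open>D b\<close>. Since \<open>tent a \<alpha> \<le> L\<close>, the constant
      \<open>D b / L\<close> is admissible.\<close>
    have "\<bar>D a - D b\<bar> \<le> \<bar>a - b\<bar> * m" for a b
      unfolding D_def m_def by (rule diff_energy_close[OF A B]) (auto simp: tent_def)
    then have "continuous_on {\<alpha>..L} D"
      by (intro lipschitz_on_continuous_on[of m] lipschitz_onI) (auto simp: dist_real_def m_def mult.commute)
    then obtain b where b: "b \<in> {\<alpha>..L}" "\<And>a. a \<in> {\<alpha>..L} \<Longrightarrow> D b \<le> D a"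
      using continuous_attains_inf[of "{\<alpha>..L}" D] \<alpha> by auto
    have "D b / L * (g \<alpha> - g L) \<le> diff_energy (\<lambda>t. g \<bar>t\<bar>) A B"
    proof (rule diff_energy_lower_bound[OF g A B L(1,2) \<alpha>(1,2)])
      show "0 \<le> D b / L"
        using D_pos[of b] b \<open>0 < \<alpha>\<close> L by simp
      fix a assume a: "0 < a" "a \<le> L"
      show "D b / L * tent a \<alpha> \<le> diff_energy (tent a) A B"
      proof (cases "\<alpha> \<le> a")
        case True
        have "D b * tent a \<alpha> \<le> D b * L"
          using D_pos[of b] b \<open>0 < \<alpha>\<close> a by (intro mult_left_mono) (auto simp: tent_def)
        then have "D b / L * tent a \<alpha> \<le> D b"
          using L by (simp add: field_simps)
        also have "\<dots> \<le> D a"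
          using b(2) True a by simp
        finally show ?thesis
          by (simp add: D_def)
      next
        case False
        then show ?thesis
          using diff_energy_tent_nonneg[OF A B, of a] \<alpha> by (simp add: tent_def)
      qed
    qed
    moreover have "0 < D b / L * (g \<alpha> - g L)"
      using D_pos[of b] b \<open>0 < \<alpha>\<close> L gL \<alpha>(3) by (intro mult_pos_pos divide_pos_pos) auto
    ultimately show False
      using zero by simp
  qed
qed

section \<open>Equilibrium measures\<close>

definition prob_on :: "real set \<Rightarrow> real measure \<Rightarrow> bool" where
  "prob_on S A \<longleftrightarrow> prob_space A \<and> sets A = sets borel \<and> (AE t in A. t \<in> S)"

lemma prob_on_carried_by: "prob_on S A \<Longrightarrow> S \<subseteq> S' \<Longrightarrow> carried_by S' A"
  unfolding prob_on_def carried_by_def by (auto simp: prob_space_def elim: eventually_mono)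

text \<open>The convex combination of \<open>A\<close> and the point mass at \<open>t\<close> is
  realized as the law of a random point: a coin with success probability \<open>\<epsilon>\<close>
  decides between \<open>t\<close> and a sample of \<open>A\<close>. It is the competitor in the
  first variation of the energy.\<close>

lemma mixture_exists:
  assumes A: "prob_on S A" and S: "closed S" and t: "t \<in> S" and \<epsilon>: "0 \<le> \<epsilon>" "\<epsilon> \<le> 1"
  shows "\<exists>N. prob_on S N \<and> (\<forall>h. bcont h \<longrightarrow> (\<integral>s. h s \<partial>N) = (1 - \<epsilon>) * (\<integral>s. h s \<partial>A) + \<epsilon> * h t)"
proof -
  define B where "B = measure_pmf (bernoulli_pmf \<epsilon>)"
  define N where "N = distr (B \<Otimes>\<^sub>M A) borel (\<lambda>(b, s). if b then t else s)"
  interpret A: prob_space A using A by (simp add: prob_on_def)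
  interpret B: prob_space B unfolding B_def by (rule prob_space_measure_pmf)
  interpret BA: pair_prob_space B A ..
  have setsA [measurable_cong]: "sets A = sets borel" "sets B = sets (count_space UNIV)"
    using A by (auto simp: prob_on_def B_def)
  have meas [measurable]: "(\<lambda>(b, s). if b then t else s) \<in> borel_measurable (B \<Otimes>\<^sub>M A)"
    by measurable
  interpret N: prob_space N
    unfolding N_def using meas by (rule BA.prob_space_distr)
  have setsN: "sets N = sets borel"
    by (simp add: N_def)
  have carr: "carried_by UNIV A" "carried_by UNIV N"
    using setsA setsN by (auto simp: carried_by_def A.finite_measure_axioms N.finite_measure_axioms)
  have int: "(\<integral>s. h s \<partial>N) = (1 - \<epsilon>) * (\<integral>s. h s \<partial>A) + \<epsilon> * h t" if h: "bcont h" for h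
  proof -
    have [measurable]: "h \<in> borel_measurable borel"
      using h by (rule bcont_measurable)
    have "integrable N h"
      by (rule carried_by_integrable[OF carr(2) h])
    then have int: "integrable (B \<Otimes>\<^sub>M A) (\<lambda>p. h ((\<lambda>(b, s). if b then t else s) p))"
      unfolding N_def by (subst (asm) integrable_distr_eq) auto
    have "(\<integral>s. h s \<partial>N) = (\<integral>p. h ((\<lambda>(b, s). if b then t else s) p) \<partial>(B \<Otimes>\<^sub>M A))"
      unfolding N_def by (rule integral_distr) auto
    also have "\<dots> = (\<integral>b. (\<integral>s. h (if b then t else s) \<partial>A) \<partial>B)"
      by (subst BA.integral_fst'[OF int, symmetric]) simp
    also have "\<dots> = (1 - \<epsilon>) * (\<integral>s. h s \<partial>A) + \<epsilon> * h t"
      unfolding B_def using \<epsilon> by (simp add: A.prob_space)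
    finally show ?thesis .
  qed
  have "S \<noteq> {}" using t by auto
  have "(\<integral>s. min 1 (infdist s S) \<partial>A) = 0"
    using AE_in_closed_iff[OF A.finite_measure_axioms setsA(1) S \<open>S \<noteq> {}\<close>] A by (simp add: prob_on_def)
  then have "(\<integral>s. min 1 (infdist s S) \<partial>N) = 0"
    using int[OF bcont_infdist] t by simp
  then have "AE s in N. s \<in> S"
    by (subst AE_in_closed_iff[OF N.finite_measure_axioms _ S \<open>S \<noteq> {}\<close>]) (auto simp: setsN)
  then have "prob_on S N"
    using N.prob_space_axioms by (simp add: prob_on_def setsN)
  then show ?thesis
    using int by blast
qed

text \<open>All mass lies in one bounded interval, so tightness is immediate. The support passes to
  the limit by testing with the truncated distance to the closed set \<open>S\<close>.\<close>

lemma prob_on_weak_limit: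
  fixes A :: "nat \<Rightarrow> real measure"
  assumes A: "\<And>n. prob_on S (A n)" and S: "closed S" "S \<noteq> {}" "S \<subseteq> {0..T}"
  shows "\<exists>r M. strict_mono r \<and> prob_on S M \<and>
    (\<forall>h. bcont h \<longrightarrow> (\<lambda>n. \<integral>s. h s \<partial>A (r n)) \<longlonglongrightarrow> (\<integral>s. h s \<partial>M))"
proof -
  have rd: "real_distribution (A n)" for n
    using A[of n] by (simp add: prob_on_def real_distribution_def real_distribution_axioms_def)
  have T: "0 \<le> T" using S by auto
  \<comment> \<open>Tightness is stated with intervals \<open>{a<..b}\<close>; starting at
    \<open>-1\<close> keeps a possible atom at \<open>0\<close>.\<close>
  have one: "measure (A n) {-1<..T} = 1" for n
  proof -
    interpret real_distribution "A n" by (rule rd)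
    have "AE t in A n. t \<in> {-1<..T}"
      using A[of n, unfolded prob_on_def, THEN conjunct2, THEN conjunct2] by eventually_elim (use S(3) in auto)
    then show ?thesis
      by (intro prob_eq_1[THEN iffD2]) auto
  qed
  have "tight A"
    unfolding tight_def
  proof (intro conjI allI impI rd)
    fix \<epsilon> :: real assume "\<epsilon> > 0"
    then show "\<exists>a b. a < b \<and> (\<forall>n. 1 - \<epsilon> < measure (A n) {a<..b})"
      using T by (intro exI[of _ "-1"] exI[of _ T]) (simp add: one)
  qed
  then obtain r M where r: "strict_mono (r :: nat \<Rightarrow> nat)" and M: "real_distribution M"
    and conv: "weak_conv_m (A \<circ> id \<circ> r) M"
    using tight_imp_convergent_subsubsequence[of A id] by (auto simp: strict_mono_id)
  interpret M: real_distribution M by (rule M)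
  have lim: "(\<lambda>n. \<integral>s. h s \<partial>A (r n)) \<longlonglongrightarrow> (\<integral>s. h s \<partial>M)" if h: "bcont h" for h
  proof -
    obtain C where C: "\<And>t. \<bar>h t\<bar> \<le> C"
      using bcont_bound[OF h] by metis
    show ?thesis
      by (rule weak_conv_imp_integral_bdd_continuous_conv[where \<mu>="\<lambda>n. A (r n)" and B=C])
        (use rd M conv C bcont_isCont[OF h] in \<open>auto simp: comp_def\<close>)
  qed
  have "(\<integral>s. min 1 (infdist s S) \<partial>A n) = 0" for n
    using AE_in_closed_iff[of "A n" S] A[of n] S by (simp add: prob_on_def prob_space_def)
  then have "(\<integral>s. min 1 (infdist s S) \<partial>M) = 0"
    using lim[OF bcont_infdist, of S] by (simp add: LIMSEQ_const_iff)
  then have "AE s in M. s \<in> S"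
    by (subst AE_in_closed_iff) (use S M.finite_measure_axioms in auto)
  then have "prob_on S M"
    using M.prob_space_axioms by (simp add: prob_on_def)
  then show ?thesis
    using r lim by blast
qed

text \<open>
  Positive definiteness bounds the energy of \<open>A\<close> from below by twice the mutual energy of \<open>A\<close> and
  \<open>M\<close> minus the energy of \<open>M\<close>.  This bound is weakly continuous in \<open>A\<close>, hence the energy is lower
  semicontinuous at \<open>M\<close>.
\<close>

lemma minimal_energy_exists:
  assumes g: "scalar_kernel g" and S: "compact S" "S \<noteq> {}" "S \<subseteq> {0..T}"
  shows "\<exists>M. prob_on S M \<and>
    (\<forall>A. prob_on S A \<longrightarrow> mutual_energy (\<lambda>t. g \<bar>t\<bar>) M M \<le> mutual_energy (\<lambda>t. g \<bar>t\<bar>) A A)"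
proof -
  define Q where "Q A = mutual_energy (\<lambda>t. g \<bar>t\<bar>) A A" for A
  define V where "V = Q ` {A. prob_on S A}"
  have cb: "carried_by {0..T} A" if "prob_on S A" for A
    using prob_on_carried_by[OF that S(3)] .
  have closedS: "closed S"
    using S by (simp add: compact_imp_closed)
  obtain t0 where "t0 \<in> S" using S by auto
  have [measurable]: "S \<in> sets borel"
    using closedS by simp
  have "AE t in return borel t0. t \<in> S"
    using \<open>t0 \<in> S\<close> by (subst AE_return) (simp_all, measurable)
  then have "prob_on S (return borel t0)"
    by (simp add: prob_on_def prob_space_return)
  then have ne: "V \<noteq> {}" by (auto simp: V_def)
  have "0 \<le> Q A" for A
    using scalar_kernel_nonneg[OF g] by (simp add: Q_def mutual_energy_def)
  then have bdd: "bdd_below V"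
    by (auto simp: V_def bdd_below_def)
  have "\<exists>A. prob_on S A \<and> Q A < Inf V + 1 / Suc n" for n
  proof -
    have "Inf V < Inf V + 1 / Suc n" by simp
    then obtain v where "v \<in> V" "v < Inf V + 1 / Suc n"
      using cInf_lessD[OF ne] by blast
    then show ?thesis by (auto simp: V_def)
  qed
  then obtain A where A: "\<And>n. prob_on S (A n)" "\<And>n. Q (A n) < Inf V + 1 / Suc n"
    by metis
  from prob_on_weak_limit[where A=A, OF A(1) closedS S(2,3)]
  obtain r M where r: "strict_mono r" and M: "prob_on S M"
    and conv: "\<forall>h. bcont h \<longrightarrow> (\<lambda>n. \<integral>s. h s \<partial>A (r n)) \<longlonglongrightarrow> (\<integral>s. h s \<partial>M)"
    by (elim exE conjE)
  note lim = conv[rule_format]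
  have k: "bcont (\<lambda>t. g \<bar>t\<bar>)" by (rule scalar_kernel_bcont[OF g])
  \<comment> \<open>With \<open>M\<close> fixed in one slot, the mutual energy is the integral of
    the potential of \<open>M\<close>, which is a bounded continuous test function.\<close>
  have "(\<lambda>n. mutual_energy (\<lambda>t. g \<bar>t\<bar>) (A (r n)) M) \<longlonglongrightarrow> Q M"
    unfolding Q_def mutual_energy_def by (rule lim[OF bcont_potential[OF cb[OF M] k]])
  then have l1: "(\<lambda>n. 2 * mutual_energy (\<lambda>t. g \<bar>t\<bar>) (A (r n)) M - Q M) \<longlonglongrightarrow> 2 * Q M - Q M"
    by (intro tendsto_intros)
  have "(\<lambda>n. Inf V + 1 / Suc n) \<longlonglongrightarrow> Inf V + 0"
    by (intro tendsto_intros LIMSEQ_Suc[OF lim_1_over_n])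
  then have l2: "(\<lambda>n. Inf V + 1 / Suc (r n)) \<longlonglongrightarrow> Inf V + 0"
    using LIMSEQ_subseq_LIMSEQ[OF _ r] by (simp add: comp_def)
  have "2 * mutual_energy (\<lambda>t. g \<bar>t\<bar>) (A (r n)) M - Q M \<le> Inf V + 1 / Suc (r n)" for n
    using diff_energy_nonneg[OF g cb[OF A(1)[of "r n"]] cb[OF M]] A(2)[of "r n"]
    unfolding diff_energy_def Q_def by linarith
  then have "Q M \<le> Inf V"
    using LIMSEQ_le[OF l1 l2] by auto
  moreover have "Inf V \<le> Q B" if "prob_on S B" for B
    using bdd that by (auto simp: V_def intro!: cInf_lower)
  ultimately have "Q M \<le> Q B" if "prob_on S B" for B
    using that order_trans by blast
  then show ?thesis
    using M unfolding Q_def by blast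
qed

text \<open>Moving the fraction \<open>\<epsilon>\<close> of the mass to \<open>t\<close> changes
  the energy by \<open>- 2 * \<epsilon> * (q - U t)\<close> plus the square of
  \<open>\<epsilon>\<close> times \<open>q - 2 * U t + g 0\<close>. If \<open>U t < q\<close>, a
  small \<open>\<epsilon>\<close> would lower the energy.\<close>

lemma potential_ge_minimal_energy:
  assumes g: "scalar_kernel g" and S: "closed S" "S \<subseteq> {0..T}" and M: "prob_on S M"
    and min: "\<And>A. prob_on S A \<Longrightarrow> mutual_energy (\<lambda>t. g \<bar>t\<bar>) M M \<le> mutual_energy (\<lambda>t. g \<bar>t\<bar>) A A"
    and t: "t \<in> S"
  shows "mutual_energy (\<lambda>t. g \<bar>t\<bar>) M M \<le> (\<integral>s. g \<bar>t - s\<bar> \<partial>M)"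
proof (rule ccontr)
  define q where "q = mutual_energy (\<lambda>t. g \<bar>t\<bar>) M M"
  define U where "U x = (\<integral>s. g \<bar>x - s\<bar> \<partial>M)" for x
  assume "\<not> ?thesis"
  then have less: "U t < q" by (simp add: q_def U_def)
  have k: "bcont (\<lambda>t. g \<bar>t\<bar>)" by (rule scalar_kernel_bcont[OF g])
  have cb: "carried_by {0..T} A" if "prob_on S A" for A
    using prob_on_carried_by[OF that S(2)] .
  \<comment> \<open>\<open>D\<close> exceeds the modulus of the second-order coefficient; choosing
    \<open>\<epsilon>\<close> with \<open>\<epsilon> * D \<le> q - U t\<close> keeps the quadratic
    term at no more than half of the linear gain.\<close>
  define D where "D = \<bar>q - 2 * U t + g 0\<bar> + 1"
  have "0 < D" by (simp add: D_def)
  define \<epsilon> where "\<epsilon> = min 1 ((q - U t) / D)"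
  have \<epsilon>: "0 < \<epsilon>" "\<epsilon> \<le> 1" "\<epsilon> * D \<le> q - U t"
    using less \<open>0 < D\<close> by (auto simp: \<epsilon>_def min_def field_simps)
  obtain N where N: "prob_on S N" and int: "\<And>h. bcont h \<Longrightarrow> (\<integral>s. h s \<partial>N) = (1 - \<epsilon>) * (\<integral>s. h s \<partial>M) + \<epsilon> * h t"
    using mixture_exists[OF M S(1) t less_imp_le[OF \<epsilon>(1)] \<epsilon>(2)] by blast
  have bU: "bcont U"
    unfolding U_def using bcont_potential[OF cb[OF M] k] .
  have UN: "(\<integral>s. g \<bar>x - s\<bar> \<partial>N) = (1 - \<epsilon>) * U x + \<epsilon> * g \<bar>x - t\<bar>" for x
    unfolding U_def using int[OF bcont_shift[OF k]] .
  have "(\<integral>s. g \<bar>s - t\<bar> \<partial>M) = U t"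
    unfolding U_def by (intro Bochner_Integration.integral_cong) (auto simp: abs_minus_commute)
  moreover have "bcont (\<lambda>s. g \<bar>s - t\<bar>)"
    using bcont_shift[OF k, of t] by (simp add: abs_minus_commute)
  ultimately have shiftN: "(\<integral>s. g \<bar>s - t\<bar> \<partial>N) = (1 - \<epsilon>) * U t + \<epsilon> * g 0" "integrable N (\<lambda>s. g \<bar>s - t\<bar>)"
    using int[of "\<lambda>s. g \<bar>s - t\<bar>"] carried_by_integrable[OF cb[OF N], of "\<lambda>s. g \<bar>s - t\<bar>"] by auto
  have "(\<integral>s. U s \<partial>M) = q"
    by (simp add: q_def mutual_energy_def U_def)
  then have UM: "(\<integral>s. U s \<partial>N) = (1 - \<epsilon>) * q + \<epsilon> * U t" "integrable N U"
    using int[OF bU] carried_by_integrable[OF cb[OF N] bU] by auto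
  have "mutual_energy (\<lambda>t. g \<bar>t\<bar>) N N = (\<integral>x. (1 - \<epsilon>) * U x + \<epsilon> * g \<bar>x - t\<bar> \<partial>N)"
    by (simp add: mutual_energy_def UN)
  also have "\<dots> = (1 - \<epsilon>) * ((1 - \<epsilon>) * q + \<epsilon> * U t) + \<epsilon> * ((1 - \<epsilon>) * U t + \<epsilon> * g 0)"
    using UM shiftN by simp
  also have "\<dots> = q - 2 * \<epsilon> * (q - U t) + \<epsilon> * (\<epsilon> * (q - 2 * U t + g 0))"
    by (simp add: algebra_simps)
  also have "\<dots> \<le> q - 2 * \<epsilon> * (q - U t) + \<epsilon> * (q - U t)"
  proof -
    have "\<epsilon> * (q - 2 * U t + g 0) \<le> \<epsilon> * D"
      using \<epsilon> by (intro mult_left_mono) (auto simp: D_def)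
    then have "\<epsilon> * (q - 2 * U t + g 0) \<le> q - U t"
      using \<epsilon>(3) by linarith
    then show ?thesis
      using \<epsilon> by (intro add_left_mono mult_left_mono) auto
  qed
  also have "\<dots> < q"
    using \<epsilon> less by (simp add: algebra_simps)
  finally show False
    using min[OF N] by (simp add: q_def)
qed

text \<open>
  The potential is convex on every interval that does not meet the carrier \<open>Z\<close>, and monotone on the
  two unbounded components of the complement of \<open>Z\<close>, so that it is dominated by its values on \<open>Z\<close>.
\<close>

lemma potential_maximum_principle:
  assumes g: "scalar_kernel g" and Z: "compact Z" "Z \<noteq> {}" and A: "carried_by Z A"
    and le: "\<And>z. z \<in> Z \<Longrightarrow> (\<integral>s. g \<bar>z - s\<bar> \<partial>A) \<le> q"
  shows "(\<integral>s. g \<bar>t - s\<bar> \<partial>A) \<le> q"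
proof -
  define U where "U x = (\<integral>s. g \<bar>x - s\<bar> \<partial>A)" for x
  have int: "integrable A (\<lambda>s. g \<bar>x - s\<bar>)" for x
    by (rule carried_by_integrable[OF A bcont_shift[OF scalar_kernel_bcont[OF g]]])
  have AE: "AE s in A. s \<in> Z"
    using A by (simp add: carried_by_def)
  have mono: "U t \<le> U a" if "\<And>s. s \<in> Z \<Longrightarrow> \<bar>a - s\<bar> \<le> \<bar>t - s\<bar>" for a
    unfolding U_def
  proof (rule integral_mono_AE[OF int int])
    show "AE s in A. g \<bar>t - s\<bar> \<le> g \<bar>a - s\<bar>"
      using AE by eventually_elim (auto intro!: scalar_kernel_antimono[OF g] that)
  qed
  have "U t \<le> q"
  proof (cases "Z \<inter> {..t} = {}")
    case True
    obtain b where b: "b \<in> Z" "\<And>z. z \<in> Z \<Longrightarrow> b \<le> z"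
      using compact_attains_inf[OF Z] by auto
    have "\<bar>b - s\<bar> \<le> \<bar>t - s\<bar>" if "s \<in> Z" for s
      using b that True by (force simp: abs_if)
    then show ?thesis
      using mono[of b] le[OF b(1)] by (force simp: U_def)
  next
    case left: False
    have "compact (Z \<inter> {..t})"
      using Z by (intro compact_Int_closed) auto
    then obtain a where a: "a \<in> Z" "a \<le> t" "\<And>z. z \<in> Z \<Longrightarrow> z \<le> t \<Longrightarrow> z \<le> a"
      using compact_attains_sup[OF _ left] by auto
    show ?thesis
    proof (cases "Z \<inter> {t..} = {}")
      case True
      have "\<bar>a - s\<bar> \<le> \<bar>t - s\<bar>" if "s \<in> Z" for s
      proof -
        have "s \<le> t"
          using True that by force
        then show ?thesis
          using a(2) a(3)[OF that] by simp
      qed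
      then show ?thesis
        using mono[of a] le[OF a(1)] by (force simp: U_def)
    next
      case right: False
      have "compact (Z \<inter> {t..})"
        using Z by (intro compact_Int_closed) auto
      then obtain b where b: "b \<in> Z" "t \<le> b" "\<And>z. z \<in> Z \<Longrightarrow> t \<le> z \<Longrightarrow> b \<le> z"
        using compact_attains_inf[OF _ right] by auto
      show ?thesis
      \<comment> \<open>Equality forces \<open>t = a\<close>, so that \<open>t\<close> itself
        belongs to \<open>Z\<close>.\<close>
      proof (cases "a = b")
        case True
        then show ?thesis
          using a b le[OF a(1)] by (simp add: U_def)
      next
        case False
        then have "a < b" using a b by simp
        define l where "l = (t - a) / (b - a)"
        have "l * (b - a) = t - a"
          using \<open>a < b\<close> by (simp add: l_def)
        then have "t = (1 - l) * a + l * b"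
          by (simp add: algebra_simps)
        moreover have "0 \<le> l" "l \<le> 1"
          using \<open>a < b\<close> a(2) b(2) by (auto simp: l_def)
        ultimately have l: "0 \<le> l" "l \<le> 1" "t = (1 - l) * a + l * b"
          by auto
        have cv: "convex_on {0..} g"
          using g by (simp add: scalar_kernel_def)
        have "g \<bar>t - s\<bar> \<le> (1 - l) * g \<bar>a - s\<bar> + l * g \<bar>b - s\<bar>" if s: "s \<in> Z" for s
        proof -
          \<comment> \<open>No point of \<open>Z\<close> lies strictly between \<open>a\<close> and
            \<open>b\<close>, so the distance to \<open>s\<close> is affine on this interval and
            convexity of \<open>g\<close> applies.\<close>
          have "\<bar>t - s\<bar> = (1 - l) *\<^sub>R \<bar>a - s\<bar> + l *\<^sub>R \<bar>b - s\<bar>"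
          proof (cases "s \<le> t")
            case True
            then have "s \<le> a" using a(3)[OF s] by simp
            then have "\<bar>t - s\<bar> = t - s" "\<bar>a - s\<bar> = a - s" "\<bar>b - s\<bar> = b - s"
              using \<open>a < b\<close> True by auto
            then show ?thesis
              using l(3) by (simp add: algebra_simps)
          next
            case False
            then have "b \<le> s" using b(3)[OF s] by simp
            then have "\<bar>t - s\<bar> = s - t" "\<bar>a - s\<bar> = s - a" "\<bar>b - s\<bar> = s - b"
              using \<open>a < b\<close> False by auto
            then show ?thesis
              using l(3) by (simp add: algebra_simps)
          qed
          then show ?thesis
            using convex_onD[OF cv l(1,2), of "\<bar>a - s\<bar>" "\<bar>b - s\<bar>"] by simp
        qed
        then have "AE s in A. g \<bar>t - s\<bar> \<le> (1 - l) * g \<bar>a - s\<bar> + l * g \<bar>b - s\<bar>"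
          using AE by (auto elim: eventually_mono)
        then have "U t \<le> (\<integral>s. (1 - l) * g \<bar>a - s\<bar> + l * g \<bar>b - s\<bar> \<partial>A)"
          unfolding U_def by (intro integral_mono_AE Bochner_Integration.integrable_add integrable_mult_right int)
        also have "\<dots> = (1 - l) * U a + l * U b"
          using int by (simp add: U_def)
        also have "\<dots> \<le> (1 - l) * q + l * q"
          using le[OF a(1)] le[OF b(1)] l unfolding U_def by (intro add_mono mult_left_mono) auto
        finally show ?thesis
          by (simp add: algebra_simps)
      qed
    qed
  qed
  then show ?thesis
    by (simp add: U_def)
qed

lemma equilibrium_exists:
  assumes g: "scalar_kernel g" and S: "compact S" "S \<noteq> {}" "S \<subseteq> {0..T}"
  shows "\<exists>M q. prob_on S M \<and> (\<forall>t\<in>S. (\<integral>s. g \<bar>t - s\<bar> \<partial>M) = q)"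
proof -
  obtain M where M: "prob_on S M"
    and min: "\<And>A. prob_on S A \<Longrightarrow> mutual_energy (\<lambda>t. g \<bar>t\<bar>) M M \<le> mutual_energy (\<lambda>t. g \<bar>t\<bar>) A A"
    using minimal_energy_exists[OF assms] by blast
  define q where "q = mutual_energy (\<lambda>t. g \<bar>t\<bar>) M M"
  define U where "U x = (\<integral>s. g \<bar>x - s\<bar> \<partial>M)" for x
  have closedS: "closed S"
    using S by (simp add: compact_imp_closed)
  have ge: "q \<le> U t" if "t \<in> S" for t
    unfolding q_def U_def by (rule potential_ge_minimal_energy[OF g closedS S(3) M min that])
  interpret M: prob_space M using M by (simp add: prob_on_def)
  have cb: "carried_by {0..T} M"
    by (rule prob_on_carried_by[OF M S(3)])
  have bU: "bcont U"
    unfolding U_def using bcont_potential[OF cb scalar_kernel_bcont[OF g]] .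
  have AES: "AE t in M. t \<in> S"
    using M by (simp add: prob_on_def)
  \<comment> \<open>The potential averages to \<open>q\<close> under \<open>M\<close> and is at
    least \<open>q\<close> on \<open>S\<close>, so it can exceed \<open>q\<close> only on a null
    set.\<close>
  have "(\<integral>t. U t \<partial>M) = q"
    by (simp only: U_def q_def mutual_energy_def)
  then have "(\<integral>t. U t - q \<partial>M) = 0"
    using carried_by_integrable[OF cb bU] by (simp add: M.prob_space)
  moreover have "integrable M (\<lambda>t. U t - q)"
    using carried_by_integrable[OF cb bU] by simp
  moreover have "AE t in M. 0 \<le> U t - q"
    using AES by eventually_elim (use ge in simp)
  ultimately have "AE t in M. U t - q = 0"
    using integral_nonneg_eq_0_iff_AE by blast
  \<comment> \<open>Equality almost everywhere is recast as a compact carrier on which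
    \<open>U \<le> q\<close>, the form that the maximum principle takes as input.\<close>
  define Z where "Z = {t \<in> S. U t \<le> q}"
  have AEZ: "AE t in M. t \<in> Z"
    using \<open>AE t in M. U t - q = 0\<close> AES by eventually_elim (simp add: Z_def)
  have "closed {t. U t \<le> q}"
    using bU by (intro closed_Collect_le continuous_on_const) (simp add: bcont_def)
  moreover have "Z = S \<inter> {t. U t \<le> q}"
    by (auto simp: Z_def)
  ultimately have "compact Z"
    using S(1) by (simp add: compact_Int_closed)
  have "Z \<noteq> {}"
    using AEZ M.AE_False by (intro notI) simp
  have "carried_by Z M"
    using cb AEZ by (simp add: carried_by_def)
  have "U t \<le> q" for t
    unfolding U_def
    by (rule potential_maximum_principle[OF g \<open>compact Z\<close> \<open>Z \<noteq> {}\<close> \<open>carried_by Z M\<close>]) (simp add: Z_def U_def)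
  then have "U t = q" if "t \<in> S" for t
    using ge[OF that] by (intro antisym)
  then show ?thesis
    using M unfolding U_def by blast
qed

section \<open>Simultaneous diagonalization\<close>

definition self_adjoint_on :: "'v::euclidean_space set \<Rightarrow> ('v \<Rightarrow> 'v) \<Rightarrow> bool" where
  "self_adjoint_on V f \<longleftrightarrow> linear f \<and> f ` V \<subseteq> V \<and> (\<forall>x\<in>V. \<forall>y\<in>V. f x \<bullet> y = x \<bullet> f y)"

text \<open>For small \<open>t\<close> of the sign of \<open>a\<close> the linear term would win,
  and \<open>t = a / (\<bar>K\<bar> + 1)\<close> is small enough. This replaces differentiation at a
  maximum.\<close>

lemma zero_if_linear_le_quadratic:
  fixes a K :: real
  assumes "\<And>t. t * a \<le> t\<^sup>2 * K"
  shows "a = 0"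
proof (rule ccontr)
  assume "a \<noteq> 0"
  define t where "t = a / (\<bar>K\<bar> + 1)"
  have "t * a = a\<^sup>2 / (\<bar>K\<bar> + 1)"
    by (simp add: t_def power2_eq_square)
  moreover have "t\<^sup>2 * K < a\<^sup>2 / (\<bar>K\<bar> + 1)"
  proof -
    have "t\<^sup>2 * K \<le> t\<^sup>2 * \<bar>K\<bar>"
      by (intro mult_left_mono) auto
    also have "\<dots> < t\<^sup>2 * (\<bar>K\<bar> + 1)"
      using \<open>a \<noteq> 0\<close> by (intro mult_strict_left_mono) (auto simp: t_def)
    also have "\<dots> = a\<^sup>2 / (\<bar>K\<bar> + 1)"
      by (simp add: t_def power2_eq_square)
    finally show ?thesis .
  qed
  ultimately show False
    using assms[of t] by simp
qed

text \<open>A maximum point of the Rayleigh quotient is an eigenvector.\<close>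

lemma self_adjoint_eigenvector:
  fixes V :: "'v::euclidean_space set"
  assumes V: "subspace V" "V \<noteq> {0}" and f: "self_adjoint_on V f"
  shows "\<exists>v\<in>V. norm v = 1 \<and> (\<exists>c. f v = c *\<^sub>R v)"
proof -
  have lin: "linear f" and inv: "\<And>x. x \<in> V \<Longrightarrow> f x \<in> V"
    and sym: "\<And>x y. x \<in> V \<Longrightarrow> y \<in> V \<Longrightarrow> f x \<bullet> y = x \<bullet> f y"
    using f by (auto simp: self_adjoint_on_def)
  have "0 \<in> V" using V by (simp add: subspace_0)
  then obtain w where w: "w \<in> V" "w \<noteq> 0" using V by auto
  have "compact (V \<inter> sphere 0 1)"
    using V by (intro closed_Int_compact closed_subspace) auto
  moreover have "w /\<^sub>R norm w \<in> V \<inter> sphere 0 1"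
    using w V by (simp add: subspace_scale)
  then have "V \<inter> sphere 0 1 \<noteq> {}"
    by blast
  moreover have "continuous_on (V \<inter> sphere 0 1) (\<lambda>x. x \<bullet> f x)"
    by (intro continuous_intros linear_continuous_on lin linear_conv_bounded_linear[THEN iffD1])
  ultimately obtain v where v: "v \<in> V \<inter> sphere 0 1"
    and sup: "\<forall>x\<in>V \<inter> sphere 0 1. x \<bullet> f x \<le> v \<bullet> f v"
    using continuous_attains_sup[of "V \<inter> sphere 0 1" "\<lambda>x. x \<bullet> f x"] by blast
  have v: "v \<in> V" "norm v = 1"
    using v by auto
  have max: "x \<bullet> f x \<le> v \<bullet> f v" if "x \<in> V" "norm x = 1" for x
    using sup that by simp
  define c where "c = v \<bullet> f v"
  have vv: "v \<bullet> v = 1"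
    using v(2) by (simp add: norm_eq_1)
  have max': "x \<bullet> f x \<le> c * (x \<bullet> x)" if "x \<in> V" for x
  proof (cases "x = 0")
    case True
    then show ?thesis by simp
  next
    case False
    have "(x /\<^sub>R norm x) \<bullet> f (x /\<^sub>R norm x) \<le> c"
      unfolding c_def using that False V by (intro max) (auto simp: subspace_scale)
    then have "(x \<bullet> f x) / (norm x)\<^sup>2 \<le> c"
      by (simp add: linear_scale[OF lin] power2_eq_square divide_inverse mult_ac)
    then show ?thesis
      using False by (simp add: divide_le_eq dot_square_norm)
  qed
  \<comment> \<open>The maximum point \<open>v\<close> is varied in the direction \<open>w\<close>;
    the first-order change of the quadratic form has to vanish.\<close>
  have orth: "w \<bullet> f v = 0" if w: "w \<in> V" "w \<bullet> v = 0" for w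
  proof -
    have "t * (2 * (w \<bullet> f v)) \<le> t\<^sup>2 * (c * (w \<bullet> w) - w \<bullet> f w)" for t
    proof -
      have "v + t *\<^sub>R w \<in> V"
        using v w V by (simp add: subspace_add subspace_scale)
      from max'[OF this]
      have "c + t * (v \<bullet> f w) + (t * (w \<bullet> f v) + t * (t * (w \<bullet> f w))) \<le> c * (1 + t * (t * (w \<bullet> w)))"
        using w(2) by (simp add: linear_add[OF lin] linear_scale[OF lin] inner_add inner_commute[of v w] vv c_def[symmetric] algebra_simps)
      moreover have "v \<bullet> f w = w \<bullet> f v"
        using sym[OF v(1) w(1)] by (simp add: inner_commute)
      ultimately show ?thesis
        by (simp add: power2_eq_square algebra_simps)
    qed
    then have "2 * (w \<bullet> f v) = 0"
      by (rule zero_if_linear_le_quadratic)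
    then show ?thesis by simp
  qed
  \<comment> \<open>The part of \<open>f v\<close> orthogonal to \<open>v\<close> lies in
    \<open>V\<close>, so by \<open>orth\<close> it is orthogonal to \<open>f v\<close>, hence to
    itself.\<close>
  define u where "u = f v - c *\<^sub>R v"
  have u: "u \<in> V" "u \<bullet> v = 0"
    using v V inv by (auto simp: u_def subspace_diff subspace_scale inner_diff_left vv c_def inner_commute[of "f v" v])
  have "u \<bullet> u = u \<bullet> f v - c * (u \<bullet> v)"
    by (subst (2) u_def) (simp add: inner_diff_right)
  also have "\<dots> = 0"
    using orth[OF u] u(2) by simp
  finally have "f v = c *\<^sub>R v"
    by (simp add: u_def)
  then show ?thesis
    using v by blast
qed

text \<open>If every map acts as a scalar on \<open>V\<close>, any unit vector will do. Otherwise
  some \<open>f\<close> has an eigenspace within \<open>V\<close> that is nonzero and proper.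
  Commutativity makes it invariant under the whole family, which may be infinite, and the dimension
  drops.\<close>

lemma common_eigenvector:
  fixes V :: "'v::euclidean_space set"
  assumes "subspace V" "V \<noteq> {0}" "\<And>f. f \<in> \<F> \<Longrightarrow> self_adjoint_on V f"
    and comm: "\<forall>f\<in>\<F>. \<forall>h\<in>\<F>. \<forall>x. f (h x) = h (f x)"
  shows "\<exists>v\<in>V. norm v = 1 \<and> (\<forall>f\<in>\<F>. \<exists>c. f v = c *\<^sub>R v)"
  using assms(1-3)
proof (induction "dim V" arbitrary: V rule: less_induct)
  case less
  show ?case
  proof (cases "\<forall>f\<in>\<F>. \<exists>c. \<forall>x\<in>V. f x = c *\<^sub>R x")
    case True
    have "0 \<in> V" using less.prems by (simp add: subspace_0)
    then obtain w where w: "w \<in> V" "w \<noteq> 0" using less.prems by auto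
    then have "w /\<^sub>R norm w \<in> V" "norm (w /\<^sub>R norm w) = 1"
      using less.prems by (auto simp: subspace_scale)
    then show ?thesis
      using True by blast
  next
    case False
    then obtain f where f: "f \<in> \<F>" "\<And>c. \<exists>x\<in>V. f x \<noteq> c *\<^sub>R x"
      by blast
    obtain v c where v: "v \<in> V" "norm v = 1" "f v = c *\<^sub>R v"
      using self_adjoint_eigenvector[OF less.prems(1,2) less.prems(3)[OF f(1)]] by blast
    define W where "W = {x \<in> V. f x = c *\<^sub>R x}"
    have lin: "linear f"
      using less.prems(3)[OF f(1)] by (simp add: self_adjoint_on_def)
    have W: "subspace W"
      using less.prems(1) unfolding W_def subspace_def
      by (auto simp: linear_0[OF lin] linear_add[OF lin] linear_scale[OF lin] scaleR_add_right)
    have "W \<noteq> V"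
      using f(2)[of c] by (auto simp: W_def)
    moreover have "W \<subseteq> V"
      by (auto simp: W_def)
    ultimately have "dim W < dim V"
      using subspace_dim_equal[OF W less.prems(1)] by (meson dim_subset le_neq_implies_less not_le order_refl)
    moreover have "v \<in> W" "v \<noteq> 0"
      using v by (auto simp only: W_def mem_Collect_eq norm_zero)
    then have "W \<noteq> {0}"
      by blast
    moreover have "self_adjoint_on W h" if h: "h \<in> \<F>" for h
      unfolding self_adjoint_on_def
    proof (intro conjI ballI subsetI)
      show "linear h"
        using less.prems(3)[OF h] by (simp add: self_adjoint_on_def)
      then show "y \<in> W" if "y \<in> h ` W" for y
        using that less.prems(3)[OF h] comm[rule_format, OF f(1) h]
        by (auto simp: W_def self_adjoint_on_def linear_scale)
      show "h x \<bullet> y = x \<bullet> h y" if "x \<in> W" "y \<in> W" for x y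
        using that less.prems(3)[OF h] by (auto simp: W_def self_adjoint_on_def)
    qed
    ultimately obtain v where "v \<in> W" "norm v = 1" "\<forall>f\<in>\<F>. \<exists>c. f v = c *\<^sub>R v"
      using less.hyps[of W] W by blast
    then show ?thesis
      by (auto simp: W_def)
  qed
qed

text \<open>The orthogonal complement of a common eigenvector is invariant because the maps are
  self-adjoint. The expansion formula expresses completeness of the basis in the form in which
  coordinates are used later.\<close>

lemma common_eigenbasis:
  fixes V :: "'v::euclidean_space set"
  assumes "subspace V" "\<And>f. f \<in> \<F> \<Longrightarrow> self_adjoint_on V f"
    and comm: "\<forall>f\<in>\<F>. \<forall>h\<in>\<F>. \<forall>x. f (h x) = h (f x)"
  shows "\<exists>B\<subseteq>V. finite B \<and> (\<forall>b\<in>B. norm b = 1) \<and> (\<forall>b\<in>B. \<forall>b'\<in>B. b \<noteq> b' \<longrightarrow> b \<bullet> b' = 0) \<and>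
    (\<forall>x\<in>V. x = (\<Sum>b\<in>B. (x \<bullet> b) *\<^sub>R b)) \<and> (\<forall>b\<in>B. \<forall>f\<in>\<F>. \<exists>c. f b = c *\<^sub>R b)"
  using assms(1,2)
proof (induction "dim V" arbitrary: V rule: less_induct)
  case less
  show ?case
  proof (cases "V = {0}")
    case True
    then show ?thesis
      by (intro exI[of _ "{}"]) auto
  next
    case False
    obtain v where v: "v \<in> V" "norm v = 1" "\<forall>f\<in>\<F>. \<exists>c. f v = c *\<^sub>R v"
      using common_eigenvector[where V=V and \<F>=\<F>, OF less.prems(1) False less.prems(2) comm] by blast
    have vv: "v \<bullet> v = 1"
      using v(2) by (simp add: norm_eq_1)
    define W where "W = {x \<in> V. x \<bullet> v = 0}"
    have W: "subspace W"
      using less.prems(1) unfolding W_def subspace_def by (auto simp: inner_add_left)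
    have "v \<notin> W" by (simp add: W_def vv)
    then have "W \<noteq> V" using v by auto
    moreover have "W \<subseteq> V"
      by (auto simp: W_def)
    ultimately have "dim W < dim V"
      using subspace_dim_equal[OF W less.prems(1)] by (meson dim_subset le_neq_implies_less not_le order_refl)
    moreover have "self_adjoint_on W h" if h: "h \<in> \<F>" for h
      unfolding self_adjoint_on_def
    proof (intro conjI ballI subsetI)
      show "linear h"
        using less.prems(2)[OF h] by (simp add: self_adjoint_on_def)
      obtain c where c: "h v = c *\<^sub>R v" using v(3) h by blast
      show "y \<in> W" if "y \<in> h ` W" for y
      proof -
        obtain x where x: "x \<in> V" "x \<bullet> v = 0" "y = h x" using \<open>y \<in> h ` W\<close> by (auto simp: W_def)
        have "h x \<bullet> v = x \<bullet> h v" "h x \<in> V"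
          using less.prems(2)[OF h] x v(1) by (auto simp: self_adjoint_on_def)
        then show ?thesis
          using x c by (simp add: W_def)
      qed
      show "h x \<bullet> y = x \<bullet> h y" if "x \<in> W" "y \<in> W" for x y
        using that less.prems(2)[OF h] by (auto simp: W_def self_adjoint_on_def)
    qed
    ultimately obtain B where B: "B \<subseteq> W" "finite B" "\<forall>b\<in>B. norm b = 1"
      "\<forall>b\<in>B. \<forall>b'\<in>B. b \<noteq> b' \<longrightarrow> b \<bullet> b' = 0" "\<forall>x\<in>W. x = (\<Sum>b\<in>B. (x \<bullet> b) *\<^sub>R b)"
      "\<forall>b\<in>B. \<forall>f\<in>\<F>. \<exists>c. f b = c *\<^sub>R b"
      using less.hyps[of W] W by blast
    have bv: "b \<bullet> v = 0" "v \<bullet> b = 0" if "b \<in> B" for b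
      using B(1) that by (auto simp: W_def inner_commute)
    have vB: "v \<notin> B"
      using \<open>v \<notin> W\<close> B(1) by auto
    have "x = (\<Sum>b\<in>insert v B. (x \<bullet> b) *\<^sub>R b)" if x: "x \<in> V" for x
    proof -
      define y where "y = x - (x \<bullet> v) *\<^sub>R v"
      have "y \<in> W"
        using x v less.prems(1) by (simp add: W_def y_def subspace_diff subspace_scale inner_diff_left vv)
      then have "y = (\<Sum>b\<in>B. (y \<bullet> b) *\<^sub>R b)"
        using B(5) by blast
      also have "\<dots> = (\<Sum>b\<in>B. (x \<bullet> b) *\<^sub>R b)"
        by (intro sum.cong) (simp_all add: y_def inner_diff_left bv)
      finally show ?thesis
        using vB B(2) by (simp add: y_def algebra_simps)
    qed
    moreover have "insert v B \<subseteq> V"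
      using v B(1) by (auto simp: W_def)
    ultimately show ?thesis
      using v B bv by (intro exI[of _ "insert v B"]) auto
  qed
qed

text \<open>The eigenvalue of a unit eigenvector is its quadratic form, and one basis serves all
  times. In this form monotonicity, convexity and nonconstancy of the quadratic forms become
  properties of the eigenvalues as functions of time.\<close>

lemma kernel_eigenbasis:
  fixes G :: "real \<Rightarrow> real^'k^'k"
  assumes sym: "symmetric_kernel G" and comm: "commuting_kernel G"
  shows "\<exists>B. finite B \<and> (\<forall>b\<in>B. norm b = 1) \<and> (\<forall>b\<in>B. \<forall>b'\<in>B. b \<noteq> b' \<longrightarrow> b \<bullet> b' = 0) \<and>
    (\<forall>x. x = (\<Sum>b\<in>B. (x \<bullet> b) *\<^sub>R b)) \<and> (\<forall>b\<in>B. \<forall>t\<ge>0. G t *v b = (b \<bullet> (G t *v b)) *\<^sub>R b)"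
proof -
  define \<F> where "\<F> = (\<lambda>t. (*v) (G t)) ` {0..}"
  have "self_adjoint_on UNIV f" if f: "f \<in> \<F>" for f
  proof -
    obtain t where t: "t \<ge> 0" "f = (*v) (G t)" using f by (auto simp: \<F>_def)
    have "(G t *v x) \<bullet> y = x \<bullet> (G t *v y)" for x y
      using sym t unfolding symmetric_kernel_def
      by (metis dot_lmul_matrix transpose_matrix_vector)
    then show ?thesis
      using t by (simp add: self_adjoint_on_def)
  qed
  moreover have "f (h x) = h (f x)" if "f \<in> \<F>" "h \<in> \<F>" for f h x
    using that comm by (auto simp: \<F>_def commuting_kernel_def matrix_vector_mul_assoc)
  ultimately obtain B where B: "finite B" "\<forall>b\<in>B. norm b = 1" "\<forall>b\<in>B. \<forall>b'\<in>B. b \<noteq> b' \<longrightarrow> b \<bullet> b' = 0"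
    "\<forall>x. x = (\<Sum>b\<in>B. (x \<bullet> b) *\<^sub>R b)" "\<forall>b\<in>B. \<forall>f\<in>\<F>. \<exists>c. f b = c *\<^sub>R b"
    using common_eigenbasis[of UNIV \<F>] by auto
  have "G t *v b = (b \<bullet> (G t *v b)) *\<^sub>R b" if "b \<in> B" "t \<ge> 0" for b t
  proof -
    have "(*v) (G t) \<in> \<F>"
      using that by (simp add: \<F>_def)
    from B(5)[rule_format, OF that(1) this] obtain c where "G t *v b = c *\<^sub>R b" ..
    moreover have "b \<bullet> b = 1"
      using B(2) that by (simp add: norm_eq_1)
    ultimately show ?thesis
      by simp
  qed
  then show ?thesis
    using B(1-4) by (intro exI[of _ B] conjI) auto
qed

section \<open>Energy of scalar paths\<close>

definition potential :: "(real \<Rightarrow> real) \<Rightarrow> (real \<Rightarrow> real) \<Rightarrow> real \<Rightarrow> real" where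
  "potential g f t = path_integral (\<lambda>s. g \<bar>t - s\<bar>) f"

definition energy :: "(real \<Rightarrow> real) \<Rightarrow> (real \<Rightarrow> real) \<Rightarrow> real" where
  "energy g f = path_integral (potential g f) f"

lemma bcont_minus:
  assumes h: "bcont h"
  shows "bcont (\<lambda>t. - h t)"
proof -
  obtain C where "\<And>t. \<bar>h t\<bar> \<le> C"
    using bcont_bound[OF h] by metis
  moreover have "continuous_on UNIV (\<lambda>t. - h t)"
    using h by (intro continuous_on_minus) (simp add: bcont_def)
  ultimately show ?thesis
    by (intro bcontI[where C=C]) auto
qed

lemma bcont_diff: "bcont k \<Longrightarrow> bcont h \<Longrightarrow> bcont (\<lambda>t. k t - h t)"
  using bcont_add[OF _ bcont_minus, of k h] by simp

lemma bcont_potential_path: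
  assumes "fv_path T f" "bcont k"
  shows "bcont (\<lambda>t. path_integral (\<lambda>s. k (t - s)) f)"
  unfolding path_integral_def
  by (intro bcont_diff bcont_potential[OF pos_measure_carried_by[OF assms(1)] assms(2)]
      bcont_potential[OF neg_measure_carried_by[OF assms(1)] assms(2)])

lemma potential_bcont: "scalar_kernel g \<Longrightarrow> fv_path T f \<Longrightarrow> bcont (potential g f)"
  using bcont_potential_path[of T f "\<lambda>t. g \<bar>t\<bar>"] scalar_kernel_bcont[of g] by (simp add: potential_def[abs_def])

lemma path_integral_diff_integrand:
  assumes f: "fv_path T f" and "bcont k" "bcont h"
  shows "path_integral (\<lambda>t. k t - h t) f = path_integral k f - path_integral h f"
  using carried_by_integrable[OF pos_measure_carried_by[OF f]] carried_by_integrable[OF neg_measure_carried_by[OF f]] assms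
  by (simp add: path_integral_def)

lemma path_integral_scale_path:
  assumes "fv_path T f" "bcont g"
  shows "path_integral g (\<lambda>t. c * f t) = c * path_integral g f"
  using path_integral_sum_path[of "{()}" T "\<lambda>_. f" g "\<lambda>_. c"] assms by (simp add: fv_path_def)

lemma potential_diff:
  assumes "scalar_kernel g" "fv_path T f" "fv_path T h"
  shows "potential g (\<lambda>t. f t - h t) t = potential g f t - potential g h t"
  unfolding potential_def
  using bcont_shift[OF scalar_kernel_bcont[OF assms(1)]] by (intro path_integral_diff_path[OF assms(2,3)])

text \<open>The bilinear expansion into Jordan parts reduces symmetry and positivity of the energy
  of paths to the corresponding facts on pairs of measures.\<close>

lemma path_integral_potential:
  assumes g: "scalar_kernel g" and f: "fv_path T f" and h: "fv_path T h"
  shows "path_integral (potential g f) h =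
    (mutual_energy (\<lambda>t. g \<bar>t\<bar>) (pos_measure h) (pos_measure f) - mutual_energy (\<lambda>t. g \<bar>t\<bar>) (pos_measure h) (neg_measure f)) -
    (mutual_energy (\<lambda>t. g \<bar>t\<bar>) (neg_measure h) (pos_measure f) - mutual_energy (\<lambda>t. g \<bar>t\<bar>) (neg_measure h) (neg_measure f))"
proof -
  note k = scalar_kernel_bcont[OF g]
  note f' = pos_measure_carried_by[OF f] neg_measure_carried_by[OF f]
  note h' = pos_measure_carried_by[OF h] neg_measure_carried_by[OF h]
  note pots = bcont_potential[OF f'(1) k] bcont_potential[OF f'(2) k]
  show ?thesis
    unfolding path_integral_def[of "potential g f"] potential_def path_integral_def[of _ f] mutual_energy_def
    using carried_by_integrable[OF h'(1) pots(1)] carried_by_integrable[OF h'(1) pots(2)]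
      carried_by_integrable[OF h'(2) pots(1)] carried_by_integrable[OF h'(2) pots(2)]
    by simp
qed

lemma path_integral_potential_commute:
  assumes g: "scalar_kernel g" and f: "fv_path T f" and h: "fv_path T h"
  shows "path_integral (potential g f) h = path_integral (potential g h) f"
proof -
  note f' = pos_measure_carried_by[OF f] neg_measure_carried_by[OF f]
  note h' = pos_measure_carried_by[OF h] neg_measure_carried_by[OF h]
  have "mutual_energy (\<lambda>t. g \<bar>t\<bar>) A B = mutual_energy (\<lambda>t. g \<bar>t\<bar>) B A"
    if "carried_by {0..T} A" "carried_by {0..T} B" for A B
    using mutual_energy_commute[OF that scalar_kernel_bcont[OF g]] by simp
  then show ?thesis
    unfolding path_integral_potential[OF g f h] path_integral_potential[OF g h f] using f' h' by simp
qed

lemma energy_eq_diff_energy: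
  assumes g: "scalar_kernel g" and f: "fv_path T f"
  shows "energy g f = diff_energy (\<lambda>t. g \<bar>t\<bar>) (pos_measure f) (neg_measure f)"
  unfolding energy_def path_integral_potential[OF g f f] diff_energy_def
  using mutual_energy_commute[OF pos_measure_carried_by[OF f] neg_measure_carried_by[OF f] scalar_kernel_bcont[OF g]]
  by simp

lemma energy_nonneg: "scalar_kernel g \<Longrightarrow> fv_path T f \<Longrightarrow> 0 \<le> energy g f"
  using diff_energy_nonneg[OF _ pos_measure_carried_by neg_measure_carried_by] by (simp add: energy_eq_diff_energy)

text \<open>Zero energy makes the tails of the two Jordan measures equal. Their difference from
  \<open>t\<close> up to a time \<open>m\<close> beyond \<open>T\<close> is
  \<open>f m - f t\<close>, and \<open>f m = 0\<close>.\<close>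

lemma energy_zero:
  assumes g: "scalar_kernel g" and f: "fv_path T f" and zero: "energy g f = 0" and "0 \<le> t"
  shows "f t = 0"
proof -
  have T: "0 \<le> T" using f by (simp add: fv_path_def)
  define m where "m = max t (T + 1)"
  have split: "measure A {t..<m} = measure A {t..}" if A: "carried_by {0..T} A" for A
    using measure_Ico[OF A, of t m] measure_atLeast_eq_0[OF A, of m] by (simp add: m_def)
  have "measure (pos_measure f) {t..} = measure (neg_measure f) {t..}"
    using diff_energy_zero[OF g pos_measure_carried_by[OF f] neg_measure_carried_by[OF f]] zero
    by (simp add: energy_eq_diff_energy[OF g f])
  then have "pos_variation f m - pos_variation f t = neg_variation f m - neg_variation f t"
    using split[OF pos_measure_carried_by[OF f]] split[OF neg_measure_carried_by[OF f]]
    by (simp add: pos_measure_Ico[OF f] neg_measure_Ico[OF f] m_def)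
  then have "f (max 0 m) = f (max 0 t)"
    by (simp add: pos_variation_def neg_variation_def field_simps)
  moreover have "f m = 0"
    using f by (simp add: fv_path_def m_def)
  ultimately show ?thesis
    using \<open>0 \<le> t\<close> by (simp add: m_def max_def split: if_splits)
qed

lemma energy_diff:
  assumes g: "scalar_kernel g" and f: "fv_path T f" and h: "fv_path T h"
  shows "energy g (\<lambda>t. f t - h t) = energy g f - 2 * path_integral (potential g h) f + energy g h"
proof -
  have "energy g (\<lambda>t. f t - h t) = path_integral (\<lambda>t. potential g f t - potential g h t) (\<lambda>t. f t - h t)"
    unfolding energy_def potential_diff[OF g f h] ..
  also have "\<dots> = (path_integral (potential g f) f - path_integral (potential g h) f) - (path_integral (potential g f) h - path_integral (potential g h) h)"
    using potential_bcont[OF g f] potential_bcont[OF g h] f h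
    by (simp add: path_integral_diff_path[where T=T] path_integral_diff_integrand[where T=T] bcont_diff)
  finally show ?thesis
    using path_integral_potential_commute[OF g f h] by (simp add: energy_def)
qed

lemma charges_only_fv_path: "charges_only T S f \<Longrightarrow> fv_path T f"
  by (simp add: charges_only_def)

lemma path_integral_eq_const_on:
  assumes f: "charges_only T S f" and k: "bcont k" and const: "\<And>t. t \<in> S \<Longrightarrow> k t = c"
  shows "path_integral k f = - c * f 0"
proof -
  have "path_integral k f = path_integral (\<lambda>_. c) f"
    by (rule f[unfolded charges_only_def, THEN conjunct2, rule_format, OF k bcont_const]) (rule const)
  then show ?thesis
    using path_integral_const[OF charges_only_fv_path[OF f]] by simp
qed

text \<open>
  An equilibrium path \<open>h\<close> is orthogonal to all differences \<open>f - h\<close> with \<open>f 0 = h 0\<close>, because the total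
  mass of \<open>d(f - h)\<close> is zero.
\<close>

lemma energy_equilibrium:
  assumes g: "scalar_kernel g" and f: "charges_only T S f" and h: "charges_only T S h" and init: "f 0 = h 0"
    and eq: "\<And>t. t \<in> S \<Longrightarrow> potential g h t = q"
  shows "energy g f = energy g h + energy g (\<lambda>t. f t - h t)"
proof -
  note fv = charges_only_fv_path[OF f] charges_only_fv_path[OF h]
  have "path_integral (potential g h) f = - q * f 0" "path_integral (potential g h) h = - q * h 0"
    by (rule path_integral_eq_const_on[OF f potential_bcont[OF g fv(2)] eq] path_integral_eq_const_on[OF h potential_bcont[OF g fv(2)] eq]; assumption)+
  then show ?thesis
    using energy_diff[OF g fv] init by (simp add: energy_def)
qed

section \<open>Nondecreasing paths of measures, and step paths\<close>

definition tail_path :: "real measure \<Rightarrow> real \<Rightarrow> real" where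
  "tail_path A t = - measure A {t..}"

lemma
  assumes A: "carried_by {0..T} A" and T: "0 \<le> T"
  shows fv_path_tail_path: "fv_path T (tail_path A)"
    and path_integral_tail_path: "bcont k \<Longrightarrow> path_integral k (tail_path A) = (\<integral>t. k t \<partial>A)"
    and potential_tail_path: "scalar_kernel g \<Longrightarrow> potential g (tail_path A) t = (\<integral>s. g \<bar>t - s\<bar> \<partial>A)"
    and energy_tail_path: "scalar_kernel g \<Longrightarrow> energy g (tail_path A) = mutual_energy (\<lambda>t. g \<bar>t\<bar>) A A"
proof -
  show fv: "fv_path T (tail_path A)"
    by (rule fv_path_measure[OF A T]) (simp add: tail_path_def)
  show path_integral: "path_integral k (tail_path A) = (\<integral>t. k t \<partial>A)" if "bcont k" for k
    by (rule path_integral_measure[OF A T _ that]) (simp add: tail_path_def)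
  show potential: "potential g (tail_path A) t = (\<integral>s. g \<bar>t - s\<bar> \<partial>A)" if "scalar_kernel g" for t
    unfolding potential_def by (rule path_integral[OF bcont_shift[OF scalar_kernel_bcont[OF that]]])
  show "energy g (tail_path A) = mutual_energy (\<lambda>t. g \<bar>t\<bar>) A A" if "scalar_kernel g"
    unfolding energy_def path_integral[OF potential_bcont[OF that fv]] potential[OF that] mutual_energy_def ..
qed

lemma charges_only_tail_path:
  assumes A: "carried_by {0..T} A" and T: "0 \<le> T" and S: "AE t in A. t \<in> S"
  shows "charges_only T S (tail_path A)"
  unfolding charges_only_def
proof (intro conjI allI impI fv_path_tail_path A T)
  fix k h assume *: "bcont k" "bcont h" "\<forall>t\<in>S. k t = h t"
  have "sets A = sets borel" using A by (simp add: carried_by_def)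
  then have "(\<integral>t. k t \<partial>A) = (\<integral>t. h t \<partial>A)"
    using * S bcont_measurable[OF *(1)] bcont_measurable[OF *(2)]
    by (intro integral_cong_AE) (auto simp: cong: measurable_cong_sets)
  then show "path_integral k (tail_path A) = path_integral h (tail_path A)"
    using path_integral_tail_path[OF A T] * by simp
qed

lemma charges_only_scale: "charges_only T S f \<Longrightarrow> charges_only T S (\<lambda>t. c * f t)"
  using charges_only_sum[of "{()}" T S "\<lambda>_. f" "\<lambda>_. c"] charges_only_fv_path[of T S f] by (simp add: fv_path_def)

lemma potential_scale:
  assumes g: "scalar_kernel g" and f: "fv_path T f"
  shows "potential g (\<lambda>t. c * f t) t = c * potential g f t"
  unfolding potential_def by (rule path_integral_scale_path[OF f bcont_shift[OF scalar_kernel_bcont[OF g]]])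

lemma energy_scale:
  assumes g: "scalar_kernel g" and f: "fv_path T f"
  shows "energy g (\<lambda>t. c * f t) = c\<^sup>2 * energy g f"
proof -
  have "energy g (\<lambda>t. c * f t) = c * path_integral (\<lambda>t. c * potential g f t) f"
    unfolding energy_def potential_scale[OF g f]
    using bcont_sum[of "{()}" "\<lambda>_. potential g f" "\<lambda>_. c"] potential_bcont[OF g f]
    by (intro path_integral_scale_path[OF f]) simp
  also have "path_integral (\<lambda>t. c * potential g f t) f = c * path_integral (potential g f) f"
    by (simp add: path_integral_def right_diff_distrib)
  finally show ?thesis
    by (simp add: energy_def power2_eq_square)
qed

text \<open>For times in \<open>S\<close>, the value at \<open>t\<close> is minus the sum of all
  \<open>c s\<close> with \<open>s \<ge> t\<close>: the position that the remaining trades bring to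
  \<open>0\<close>.\<close>

definition step_path :: "real set \<Rightarrow> (real \<Rightarrow> real) \<Rightarrow> real \<Rightarrow> real" where
  "step_path S c t = (\<Sum>s\<in>S. c s * tail_path (return borel s) t)"

lemma return_carried_by: "s \<in> S \<Longrightarrow> S \<in> sets borel \<Longrightarrow> carried_by S (return borel s)"
  using prob_space_return[of s borel]
  by (auto simp: carried_by_def prob_space_def AE_return pred_def)

lemma
  assumes S: "finite S" "S \<subseteq> {0..T}" "0 \<le> T"
  shows charges_only_step_path: "charges_only T S (step_path S c)"
    and path_integral_step_path: "bcont k \<Longrightarrow> path_integral k (step_path S c) = (\<Sum>s\<in>S. c s * k s)"
    and energy_step_path: "scalar_kernel g \<Longrightarrow>
      energy g (step_path S c) = (\<Sum>t\<in>S. \<Sum>s\<in>S. c t * c s * g \<bar>t - s\<bar>)"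
proof -
  have r: "carried_by {0..T} (return borel s)" if "s \<in> S" for s
    using that S by (intro return_carried_by) auto
  have Sb: "S \<in> sets borel"
    using S(1) by (simp add: finite_imp_closed)
  have "AE t in return borel s. t \<in> S" if "s \<in> S" for s
    using return_carried_by[OF that Sb] by (simp add: carried_by_def)
  then show co: "charges_only T S (step_path S c)"
    unfolding step_path_def by (intro charges_only_sum charges_only_tail_path r S)
  show path_integral: "path_integral k (step_path S c) = (\<Sum>s\<in>S. c s * k s)" if "bcont k" for k
  proof -
    have [measurable]: "k \<in> borel_measurable borel"
      using that by (rule bcont_measurable)
    have "path_integral k (step_path S c) = (\<Sum>s\<in>S. c s * path_integral k (tail_path (return borel s)))"
      unfolding step_path_def by (rule path_integral_sum_path[OF S(1) fv_path_tail_path[OF r S(3)] S(3) that])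
    also have "\<dots> = (\<Sum>s\<in>S. c s * k s)"
    proof (intro sum.cong refl arg_cong2[where f="(*)"])
      fix s assume "s \<in> S"
      have "path_integral k (tail_path (return borel s)) = (\<integral>t. k t \<partial>return borel s)"
        by (rule path_integral_tail_path[OF r[OF \<open>s \<in> S\<close>] S(3) that])
      also have "\<dots> = k s"
        by (rule integral_return) auto
      finally show "path_integral k (tail_path (return borel s)) = k s" .
    qed
    finally show ?thesis .
  qed
  show "energy g (step_path S c) = (\<Sum>t\<in>S. \<Sum>s\<in>S. c t * c s * g \<bar>t - s\<bar>)" if g: "scalar_kernel g"
  proof -
    have potential: "potential g (step_path S c) t = (\<Sum>s\<in>S. c s * g \<bar>t - s\<bar>)" for t
      unfolding potential_def by (rule path_integral[OF bcont_shift[OF scalar_kernel_bcont[OF g]]])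
    show ?thesis
      unfolding energy_def path_integral[OF potential_bcont[OF g charges_only_fv_path[OF co]]] potential
      by (simp add: sum_distrib_left mult_ac)
  qed
qed

lemma step_path_0:
  assumes S: "S \<subseteq> {0..}"
  shows "step_path S c 0 = - (\<Sum>s\<in>S. c s)"
proof -
  have "tail_path (return borel s) 0 = - 1" if "s \<in> S" for s
    using that S by (auto simp: tail_path_def measure_return)
  then have "step_path S c 0 = (\<Sum>s\<in>S. c s * - 1)"
    unfolding step_path_def by (intro sum.cong) auto
  then show ?thesis
    by (simp add: sum_negf)
qed

lemma tail_path_finite:
  assumes A: "prob_on S A" and S: "finite S" 
  shows "tail_path A = step_path S (\<lambda>s. measure A {s})"
proof
  fix t
  interpret prob_space A using A by (simp add: prob_on_def)
  have [simp]: "sets A = sets borel" using A by (simp add: prob_on_def)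
  have "measure A {t..} = measure A ({t..} \<inter> S)"
  proof (rule finite_measure_eq_AE)
    show "AE x in A. x \<in> {t..} \<longleftrightarrow> x \<in> {t..} \<inter> S"
      using A unfolding prob_on_def by (auto elim: eventually_mono)
  qed (use S in \<open>auto simp: finite_imp_closed\<close>)
  also have "\<dots> = (\<Sum>s\<in>{t..} \<inter> S. measure A {s})"
    using S by (intro finite_measure_eq_sum_singleton) auto
  also have "\<dots> = (\<Sum>s\<in>S. if t \<le> s then measure A {s} else 0)"
    using S by (intro sum.mono_neutral_cong_left) auto
  also have "\<dots> = - step_path S (\<lambda>s. measure A {s}) t"
    unfolding step_path_def sum_negf[symmetric] tail_path_def
    by (intro sum.cong) (auto simp: measure_return)
  finally show "tail_path A t = step_path S (\<lambda>s. measure A {s}) t"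
    by (simp add: tail_path_def)
qed

section \<open>Paths in the common eigenbasis\<close>

definition eigval :: "(real \<Rightarrow> real^'k^'k) \<Rightarrow> real^'k \<Rightarrow> real \<Rightarrow> real" where
  "eigval G b t = b \<bullet> (G t *v b)"

lemma continuous_on_quadratic_form:
  fixes G :: "real \<Rightarrow> real^'k^'k"
  assumes "continuous_on S G"
  shows "continuous_on S (\<lambda>t. x \<bullet> (G t *v x))"
  unfolding inner_vec_def matrix_vector_mult_def
  using assms by (simp, intro continuous_intros continuous_on_component) auto

text \<open>Nonconstancy of the quadratic form in every nonzero direction makes each single
  eigenvalue nonconstant, and so its energy strictly positive definite.\<close>

lemma scalar_kernel_eigval:
  fixes G :: "real \<Rightarrow> real^'k^'k"
  assumes "decay_kernel G" "nonnegative_kernel G" "nonincreasing_kernel G" "convex_kernel G"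
    "nonconstant_kernel G" "b \<noteq> 0"
  shows "scalar_kernel (eigval G b)"
  using assms continuous_on_quadratic_form[of "{0..}" G b]
  unfolding scalar_kernel_def eigval_def decay_kernel_def nonnegative_kernel_def nonincreasing_kernel_def
    convex_kernel_def nonconstant_kernel_def by blast

lemma path_integral_cong_path:
  assumes "fv_path T f" "fv_path T h" "\<And>t. 0 \<le> t \<Longrightarrow> f t = h t" "bcont k"
  shows "path_integral k f = path_integral k h"
proof (rule LIMSEQ_unique)
  have "rs_sum T n k f = rs_sum T n k h" for n
    unfolding rs_sum_def using assms(3) by (intro sum.cong) auto
  then show "(\<lambda>n. rs_sum T n k f) \<longlonglongrightarrow> path_integral k h"
    using rs_sum_tendsto_path_integral[OF assms(2,4)] by simp
qed (rule rs_sum_tendsto_path_integral[OF assms(1,4)])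

lemma charges_only_mono: "charges_only T S' f \<Longrightarrow> S' \<subseteq> S \<Longrightarrow> charges_only T S f"
  unfolding charges_only_def by blast

definition supported_path :: "real \<Rightarrow> real set \<Rightarrow> (real \<Rightarrow> real^'k) \<Rightarrow> bool" where
  "supported_path T S x \<longleftrightarrow> (\<forall>i. fv_path T (\<lambda>t. x t $ i) \<and> supported_on (\<lambda>t. x t $ i) S)"

lemma admissible_supported_path:
  assumes x: "admissible_path T S x0 x" and "0 \<le> T"
  shows "supported_path T S x"
  unfolding supported_path_def fv_path_def locally_bv_def
proof (intro allI conjI impI \<open>0 \<le> T\<close>)
  fix i and t :: real
  show "continuous (at_left t) (\<lambda>s. x s $ i)" if "0 < t"
    using x that unfolding admissible_path_def continuous_within by (auto intro: tendsto_vec_nth)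
  show "x t $ i = 0" if "T < t"
    using x that unfolding admissible_path_def by simp
qed (use x in \<open>auto simp: admissible_path_def\<close>)

text \<open>The eigenbasis belongs to the kernel alone. With \<open>S\<close> as a parameter,
  everything can be reused with a finite grid in place of \<open>S\<close>.\<close>

locale diagonal_kernel =
  fixes G :: "real \<Rightarrow> real^'k^'k" and B :: "(real^'k) set" and T :: real and S :: "real set"
  assumes finite_B: "finite B"
    and unit: "\<And>b. b \<in> B \<Longrightarrow> norm b = 1"
    and orth: "\<And>b b'. b \<in> B \<Longrightarrow> b' \<in> B \<Longrightarrow> b \<noteq> b' \<Longrightarrow> b \<bullet> b' = 0"
    and expand: "\<And>x. x = (\<Sum>b\<in>B. (x \<bullet> b) *\<^sub>R b)"
    and eigen: "\<And>b t. b \<in> B \<Longrightarrow> 0 \<le> t \<Longrightarrow> G t *v b = eigval G b t *\<^sub>R b"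
    and scalar: "\<And>b. b \<in> B \<Longrightarrow> scalar_kernel (eigval G b)"
    and T_nonneg: "0 \<le> T"
    and S: "compact S" "S \<noteq> {}" "S \<subseteq> {0..T}"
begin

lemma closed_S: "closed S"
  using S by (simp add: compact_imp_closed)

lemma inner_combination: "b \<in> B \<Longrightarrow> (\<Sum>b'\<in>B. c b' *\<^sub>R b') \<bullet> b = c b"
proof -
  assume b: "b \<in> B"
  have "(\<Sum>b'\<in>B. c b' *\<^sub>R b') \<bullet> b = (\<Sum>b'\<in>B. if b' = b then c b' else 0)"
    unfolding inner_sum_left using unit orth b by (intro sum.cong) (auto simp: dot_square_norm)
  then show ?thesis
    using finite_B b by simp
qed

lemma eq_if_coordinates_eq: "(\<And>b. b \<in> B \<Longrightarrow> x \<bullet> b = y \<bullet> b) \<Longrightarrow> x = y"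
  using expand[of x] expand[of y] by simp

lemma kernel_mult: "0 \<le> t \<Longrightarrow> G t *v x = (\<Sum>b\<in>B. (eigval G b t * (x \<bullet> b)) *\<^sub>R b)"
proof -
  assume t: "0 \<le> t"
  have "G t *v x = G t *v (\<Sum>b\<in>B. (x \<bullet> b) *\<^sub>R b)"
    using expand[of x] by simp
  also have "\<dots> = (\<Sum>b\<in>B. (x \<bullet> b) *\<^sub>R (G t *v b))"
    by (simp add: linear_sum[OF matrix_vector_mul_linear] matrix_vector_mult_scaleR)
  also have "\<dots> = (\<Sum>b\<in>B. (eigval G b t * (x \<bullet> b)) *\<^sub>R b)"
    by (intro sum.cong) (auto simp: eigen[OF _ t])
  finally show ?thesis .
qed

lemma sym_ext_form: "x \<bullet> (sym_ext G r *v y) = (\<Sum>b\<in>B. eigval G b \<bar>r\<bar> * (x \<bullet> b) * (y \<bullet> b))"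
  unfolding sym_ext_def kernel_mult[OF abs_ge_zero] inner_sum_right by (simp add: mult_ac)

text \<open>The costs are defined through matrix entries and standard components; expanding the
  entries in the eigenvalues decouples the costs once the sums are interchanged.\<close>

lemma sym_ext_entry: "sym_ext G r $ i $ j = (\<Sum>b\<in>B. (b $ i * b $ j) * eigval G b \<bar>r\<bar>)"
proof -
  have "sym_ext G r $ i $ j = axis i 1 \<bullet> (sym_ext G r *v axis j 1)"
    by (simp add: matrix_vector_mult_basis column_def inner_axis')
  then show ?thesis
    unfolding sym_ext_form by (simp add: inner_axis' mult_ac)
qed

lemma bcont_eigval: "b \<in> B \<Longrightarrow> bcont (\<lambda>r. eigval G b \<bar>r\<bar>)"
  by (rule scalar_kernel_bcont[OF scalar])

lemma bcont_entry: "bcont (\<lambda>r. sym_ext G r $ i $ j)"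
  unfolding sym_ext_entry by (intro bcont_sum bcont_eigval)

lemma coordinate_charges_only:
  assumes x: "supported_path T S x"
  shows "charges_only T S (\<lambda>s. x s \<bullet> b)"
proof -
  have "charges_only T S (\<lambda>s. \<Sum>i\<in>UNIV. b $ i * x s $ i)"
    using x closed_S S T_nonneg unfolding supported_path_def
    by (intro charges_only_sum supported_on_charges_only) auto
  then show ?thesis
    by (simp add: inner_vec_def mult.commute)
qed

lemma kernel_integral_component:
  assumes x: "supported_path T S x"
  shows "kernel_integral G S x t $ i = (\<Sum>j\<in>UNIV. path_integral (\<lambda>s. sym_ext G (t - s) $ i $ j) (\<lambda>s. x s $ j))"
proof -
  have "stieltjes_integral S (\<lambda>s. sym_ext G (t - s) $ i $ j) (\<lambda>s. x s $ j)
      = path_integral (\<lambda>s. sym_ext G (t - s) $ i $ j) (\<lambda>s. x s $ j)" for j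
    using x unfolding supported_path_def
    by (intro stieltjes_integral_eq_path_integral[OF _ _ closed_S S(2)] bcont_shift[OF bcont_entry]) auto
  then show ?thesis
    by (simp add: kernel_integral_def)
qed

lemma kernel_integral_eq:
  assumes x: "supported_path T S x"
  shows "kernel_integral G S x t = (\<Sum>b\<in>B. potential (eigval G b) (\<lambda>s. x s \<bullet> b) t *\<^sub>R b)"
proof (rule vec_eq_iff[THEN iffD2], rule allI)
  fix i
  have fv: "fv_path T (\<lambda>s. x s $ j)" for j
    using x by (simp add: supported_path_def)
  note bc = bcont_shift[OF bcont_eigval]
  have "kernel_integral G S x t $ i =
      (\<Sum>j\<in>UNIV. \<Sum>b\<in>B. (b $ i * b $ j) * path_integral (\<lambda>s. eigval G b \<bar>t - s\<bar>) (\<lambda>s. x s $ j))"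
    unfolding kernel_integral_component[OF x] sym_ext_entry
    by (intro sum.cong refl path_integral_sum_integrand[OF fv] bc)
  also have "\<dots> = (\<Sum>b\<in>B. b $ i * (\<Sum>j\<in>UNIV. b $ j * path_integral (\<lambda>s. eigval G b \<bar>t - s\<bar>) (\<lambda>s. x s $ j)))"
    by (subst sum.swap) (simp add: sum_distrib_left mult_ac)
  also have "\<dots> = (\<Sum>b\<in>B. b $ i * potential (eigval G b) (\<lambda>s. x s \<bullet> b) t)"
  proof (intro sum.cong refl arg_cong2[where f="(*)"])
    fix b assume b: "b \<in> B"
    have "(\<Sum>j\<in>UNIV. b $ j * path_integral (\<lambda>s. eigval G b \<bar>t - s\<bar>) (\<lambda>s. x s $ j))
        = path_integral (\<lambda>s. eigval G b \<bar>t - s\<bar>) (\<lambda>s. \<Sum>j\<in>UNIV. b $ j * x s $ j)"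
      by (rule path_integral_sum_path[OF finite fv T_nonneg bc[OF b], symmetric])
    then show "(\<Sum>j\<in>UNIV. b $ j * path_integral (\<lambda>s. eigval G b \<bar>t - s\<bar>) (\<lambda>s. x s $ j)) = potential (eigval G b) (\<lambda>s. x s \<bullet> b) t"
      by (simp add: potential_def inner_vec_def mult.commute)
  qed
  finally show "kernel_integral G S x t $ i = (\<Sum>b\<in>B. potential (eigval G b) (\<lambda>s. x s \<bullet> b) t *\<^sub>R b) $ i"
    by (simp add: mult.commute)
qed

definition total_energy :: "(real \<Rightarrow> real^'k) \<Rightarrow> real" where
  "total_energy x = 1/2 * (\<Sum>b\<in>B. energy (eigval G b) (\<lambda>s. x s \<bullet> b))"

lemma bcont_coordinate_potential: "supported_path T S x \<Longrightarrow> b \<in> B \<Longrightarrow> bcont (potential (eigval G b) (\<lambda>s. x s \<bullet> b))"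
  by (rule potential_bcont[OF scalar charges_only_fv_path[OF coordinate_charges_only]])

lemma bcont_kernel_integral:
  assumes "supported_path T S x"
  shows "bcont (\<lambda>t. kernel_integral G S x t $ i)"
proof -
  have "bcont (\<lambda>t. \<Sum>b\<in>B. b $ i * potential (eigval G b) (\<lambda>s. x s \<bullet> b) t)"
    by (intro bcont_sum bcont_coordinate_potential assms)
  then show ?thesis
    by (simp add: kernel_integral_eq[OF assms] mult.commute)
qed

lemma path_cost_path_integral:
  assumes x: "supported_path T S x"
  shows "path_cost G S x = 1/2 * (\<Sum>i\<in>UNIV. path_integral (\<lambda>t. kernel_integral G S x t $ i) (\<lambda>t. x t $ i))"
proof -
  have "stieltjes_integral S (\<lambda>t. kernel_integral G S x t $ i) (\<lambda>t. x t $ i)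
      = path_integral (\<lambda>t. kernel_integral G S x t $ i) (\<lambda>t. x t $ i)" for i
    using x bcont_kernel_integral[OF x] unfolding supported_path_def
    by (intro stieltjes_integral_eq_path_integral[OF _ _ closed_S S(2)]) auto
  then show ?thesis
    by (simp add: path_cost_def)
qed

text \<open>The integrand is already expanded in the eigenbasis; linearity of the integral in the
  path recombines the integrators into the coordinates \<open>x s \<bullet> b\<close>.\<close>

lemma path_cost_eq:
  assumes x: "supported_path T S x"
  shows "path_cost G S x = total_energy x"
proof -
  have fv: "fv_path T (\<lambda>s. x s $ i)" for i
    using x by (simp add: supported_path_def)
  have "(\<Sum>i\<in>UNIV. path_integral (\<lambda>t. kernel_integral G S x t $ i) (\<lambda>t. x t $ i)) =
      (\<Sum>i\<in>UNIV. path_integral (\<lambda>t. \<Sum>b\<in>B. b $ i * potential (eigval G b) (\<lambda>s. x s \<bullet> b) t) (\<lambda>t. x t $ i))"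
    by (simp add: kernel_integral_eq[OF x] mult.commute)
  also have "\<dots> = (\<Sum>i\<in>UNIV. \<Sum>b\<in>B. b $ i * path_integral (potential (eigval G b) (\<lambda>s. x s \<bullet> b)) (\<lambda>t. x t $ i))"
    by (intro sum.cong refl path_integral_sum_integrand[OF fv] bcont_coordinate_potential[OF x])
  also have "\<dots> = (\<Sum>b\<in>B. \<Sum>i\<in>UNIV. b $ i * path_integral (potential (eigval G b) (\<lambda>s. x s \<bullet> b)) (\<lambda>t. x t $ i))"
    by (rule sum.swap)
  also have "\<dots> = (\<Sum>b\<in>B. energy (eigval G b) (\<lambda>s. x s \<bullet> b))"
  proof (intro sum.cong refl)
    fix b assume b: "b \<in> B"
    have "(\<Sum>i\<in>UNIV. b $ i * path_integral (potential (eigval G b) (\<lambda>s. x s \<bullet> b)) (\<lambda>t. x t $ i))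
        = path_integral (potential (eigval G b) (\<lambda>s. x s \<bullet> b)) (\<lambda>s. \<Sum>i\<in>UNIV. b $ i * x s $ i)"
      by (rule path_integral_sum_path[OF finite fv T_nonneg bcont_coordinate_potential[OF x b], symmetric])
    then show "(\<Sum>i\<in>UNIV. b $ i * path_integral (potential (eigval G b) (\<lambda>s. x s \<bullet> b)) (\<lambda>t. x t $ i)) = energy (eigval G b) (\<lambda>s. x s \<bullet> b)"
      by (simp add: energy_def inner_vec_def mult.commute)
  qed
  finally show ?thesis
    by (simp add: path_cost_path_integral[OF x] total_energy_def)
qed

section \<open>Equilibrium paths: Fredholm equation, minimality and existence\<close>

definition equilibrium :: "(real \<Rightarrow> real^'k) \<Rightarrow> bool" where
  "equilibrium x \<longleftrightarrow> (\<forall>b\<in>B. charges_only T S (\<lambda>s. x s \<bullet> b) \<and>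
     (\<exists>q. \<forall>t\<in>S. potential (eigval G b) (\<lambda>s. x s \<bullet> b) t = q))"

lemma equilibrium_iff_fredholm:
  assumes x: "supported_path T S x"
  shows "equilibrium x \<longleftrightarrow> (\<exists>l. fredholm_solution G S l x)"
proof
  assume "equilibrium x"
  then have "\<forall>b\<in>B. \<exists>q. \<forall>t\<in>S. potential (eigval G b) (\<lambda>s. x s \<bullet> b) t = q"
    unfolding equilibrium_def by blast
  from bchoice[OF this] obtain q where "\<forall>b\<in>B. \<forall>t\<in>S. potential (eigval G b) (\<lambda>s. x s \<bullet> b) t = q b" ..
  then have "fredholm_solution G S (\<Sum>b\<in>B. q b *\<^sub>R b) x"
    by (auto simp: fredholm_solution_def kernel_integral_eq[OF x] intro!: sum.cong)
  then show "\<exists>l. fredholm_solution G S l x" ..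
next
  assume "\<exists>l. fredholm_solution G S l x"
  then obtain l where l: "\<And>t. t \<in> S \<Longrightarrow> kernel_integral G S x t = l"
    by (auto simp: fredholm_solution_def)
  show "equilibrium x"
    unfolding equilibrium_def
  proof (intro ballI conjI coordinate_charges_only[OF x] exI)
    fix b t assume "b \<in> B" "t \<in> S"
    then show "potential (eigval G b) (\<lambda>s. x s \<bullet> b) t = l \<bullet> b"
      using l[of t] inner_combination[of b "\<lambda>b. potential (eigval G b) (\<lambda>s. x s \<bullet> b) t"]
      by (simp add: kernel_integral_eq[OF x])
  qed
qed

text \<open>Orthogonality in each coordinate gives the excess energy of \<open>y\<close> as half the
  sum of the energies of the coordinates of \<open>y - x\<close>. Strict positive definiteness
  settles the case of no excess.\<close>

lemma
  assumes x: "equilibrium x" and y: "\<And>b. b \<in> B \<Longrightarrow> charges_only T S (\<lambda>s. y s \<bullet> b)" and init: "y 0 = x 0"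
  shows equilibrium_minimal: "total_energy x \<le> total_energy y"
    and equilibrium_strict: "total_energy y \<le> total_energy x \<Longrightarrow> 0 \<le> t \<Longrightarrow> y t = x t"
proof -
  define D where "D b = energy (eigval G b) (\<lambda>s. y s \<bullet> b - x s \<bullet> b)" for b
  have x_charges: "charges_only T S (\<lambda>s. x s \<bullet> b)" if "b \<in> B" for b
    using x that by (simp add: equilibrium_def)
  have fv: "fv_path T (\<lambda>s. y s \<bullet> b - x s \<bullet> b)" if "b \<in> B" for b
    by (rule fv_path_diff[OF charges_only_fv_path[OF y[OF that]] charges_only_fv_path[OF x_charges[OF that]]])
  have eq: "energy (eigval G b) (\<lambda>s. y s \<bullet> b) = energy (eigval G b) (\<lambda>s. x s \<bullet> b) + D b" if b: "b \<in> B" for b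
  proof -
    have "\<exists>q. \<forall>t\<in>S. potential (eigval G b) (\<lambda>s. x s \<bullet> b) t = q"
      using x b unfolding equilibrium_def by blast
    then obtain q where q: "\<And>t. t \<in> S \<Longrightarrow> potential (eigval G b) (\<lambda>s. x s \<bullet> b) t = q"
      by auto
    show ?thesis
      unfolding D_def by (rule energy_equilibrium[OF scalar[OF b] y[OF b] x_charges[OF b] _ q]) (simp_all add: init)
  qed
  have D_nonneg: "0 \<le> D b" if "b \<in> B" for b
    unfolding D_def by (rule energy_nonneg[OF scalar[OF that] fv[OF that]])
  have sum: "total_energy y = total_energy x + 1/2 * (\<Sum>b\<in>B. D b)"
    unfolding total_energy_def by (simp add: eq sum.distrib)
  then show "total_energy x \<le> total_energy y"
    using sum_nonneg[of B D] D_nonneg by simp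
  assume "total_energy y \<le> total_energy x" "0 \<le> t"
  then have "(\<Sum>b\<in>B. D b) = 0"
    using sum sum_nonneg[of B D] D_nonneg by simp
  then have "D b = 0" if "b \<in> B" for b
    using sum_nonneg_eq_0_iff[OF finite_B D_nonneg] that by simp
  then have "y t \<bullet> b - x t \<bullet> b = 0" if "b \<in> B" for b
    using energy_zero[OF scalar[OF that] fv[OF that] _ \<open>0 \<le> t\<close>] that by (simp add: D_def)
  then show "y t = x t"
    by (intro eq_if_coordinates_eq) simp
qed

lemma equilibrium_cong:
  assumes x: "equilibrium x" and y: "\<And>b. b \<in> B \<Longrightarrow> charges_only T S (\<lambda>s. y s \<bullet> b)"
    and eq: "\<And>t. 0 \<le> t \<Longrightarrow> y t = x t"
  shows "equilibrium y"
  unfolding equilibrium_def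
proof (intro ballI conjI y)
  fix b assume b: "b \<in> B"
  have "\<exists>q. \<forall>t\<in>S. potential (eigval G b) (\<lambda>s. x s \<bullet> b) t = q" and xc: "charges_only T S (\<lambda>s. x s \<bullet> b)"
    using x b unfolding equilibrium_def by blast+
  moreover have "potential (eigval G b) (\<lambda>s. y s \<bullet> b) t = potential (eigval G b) (\<lambda>s. x s \<bullet> b) t" for t
    unfolding potential_def
    using eq by (intro path_integral_cong_path[OF charges_only_fv_path[OF y[OF b]] charges_only_fv_path[OF xc]]
        bcont_shift[OF bcont_eigval[OF b]]) simp
  ultimately show "\<exists>q. \<forall>t\<in>S. potential (eigval G b) (\<lambda>s. y s \<bullet> b) t = q"
    by simp
qed

text \<open>In each eigendirection the position is moved from \<open>x0 \<bullet> b\<close> to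
  \<open>0\<close> monotonically, with the trades distributed over time according to
  \<open>M b\<close>.\<close>

definition mixed_path :: "(real^'k \<Rightarrow> real measure) \<Rightarrow> real^'k \<Rightarrow> real \<Rightarrow> real^'k" where
  "mixed_path M x0 t = (\<Sum>b\<in>B. (- (x0 \<bullet> b) * tail_path (M b) t) *\<^sub>R b)"

lemma mixed_path_coordinate: "b \<in> B \<Longrightarrow> mixed_path M x0 t \<bullet> b = - (x0 \<bullet> b) * tail_path (M b) t"
  unfolding mixed_path_def by (rule inner_combination)

lemma mixed_path_component: "mixed_path M x0 t $ i = (\<Sum>b\<in>B. (- (x0 \<bullet> b) * b $ i) * tail_path (M b) t)"
  by (simp add: mixed_path_def mult_ac)

context
  fixes M :: "real^'k \<Rightarrow> real measure" and x0 :: "real^'k"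
  assumes M: "\<And>b. b \<in> B \<Longrightarrow> prob_on S (M b)"
begin

lemma M_carried_by: "b \<in> B \<Longrightarrow> carried_by {0..T} (M b)"
  by (rule prob_on_carried_by[OF M S(3)])

lemma mixed_path_charges_only: "b \<in> B \<Longrightarrow> charges_only T S (\<lambda>s. mixed_path M x0 s \<bullet> b)"
proof -
  assume b: "b \<in> B"
  have "charges_only T S (tail_path (M b))"
    using M[OF b] by (intro charges_only_tail_path[OF M_carried_by[OF b] T_nonneg]) (simp add: prob_on_def)
  then show ?thesis
    unfolding mixed_path_coordinate[OF b] by (rule charges_only_scale)
qed

lemma mixed_path_energy:
  "total_energy (mixed_path M x0) =
    1/2 * (\<Sum>b\<in>B. (x0 \<bullet> b)\<^sup>2 * mutual_energy (\<lambda>t. eigval G b \<bar>t\<bar>) (M b) (M b))"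
proof -
  have "energy (eigval G b) (\<lambda>s. mixed_path M x0 s \<bullet> b) =
      (x0 \<bullet> b)\<^sup>2 * mutual_energy (\<lambda>t. eigval G b \<bar>t\<bar>) (M b) (M b)" if b: "b \<in> B" for b
    unfolding mixed_path_coordinate[OF b]
      energy_scale[OF scalar[OF b] fv_path_tail_path[OF M_carried_by[OF b] T_nonneg]]
      energy_tail_path[OF M_carried_by[OF b] T_nonneg scalar[OF b]]
    by simp
  then show ?thesis
    unfolding total_energy_def by simp
qed

lemma tail_path_M_0: "b \<in> B \<Longrightarrow> tail_path (M b) 0 = - 1"
proof -
  assume b: "b \<in> B"
  interpret prob_space "M b" using M[OF b] by (simp add: prob_on_def)
  have "AE t in M b. t \<in> {0..}"
    using M_carried_by[OF b] unfolding carried_by_def by (auto elim: eventually_mono)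
  moreover have "{0..} \<in> sets (M b)"
    using M[OF b] by (simp add: prob_on_def)
  ultimately show ?thesis
    by (simp add: tail_path_def prob_eq_1)
qed

lemma mixed_path_0: "mixed_path M x0 0 = x0"
  using expand[of x0] by (simp add: mixed_path_def tail_path_M_0)

lemma mixed_path_fv: "fv_path T (\<lambda>t. mixed_path M x0 t $ i)"
  unfolding mixed_path_component by (intro fv_path_sum finite_B fv_path_tail_path M_carried_by T_nonneg)

text \<open>One bound for the norm and for the total variation of each component: each tail path
  rises from \<open>- 1\<close> to \<open>0\<close>, and entries of unit vectors are at most
  \<open>1\<close> in modulus.\<close>

definition weight :: real where
  "weight = (\<Sum>b\<in>B. \<bar>x0 \<bullet> b\<bar>)"

lemma tail_path_incr: "b \<in> B \<Longrightarrow> p \<le> q \<Longrightarrow> tail_path (M b) q - tail_path (M b) p = measure (M b) {p..<q}"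
  using measure_Ico[OF M_carried_by] by (simp add: tail_path_def)

lemma mixed_path_increment:
  assumes "p \<le> q"
  shows "\<bar>mixed_path M x0 q $ i - mixed_path M x0 p $ i\<bar> \<le>
    (\<Sum>b\<in>B. \<bar>x0 \<bullet> b\<bar> * tail_path (M b) q) - (\<Sum>b\<in>B. \<bar>x0 \<bullet> b\<bar> * tail_path (M b) p)"
proof -
  have "mixed_path M x0 q $ i - mixed_path M x0 p $ i = (\<Sum>b\<in>B. (- (x0 \<bullet> b) * b $ i) * measure (M b) {p..<q})"
    unfolding mixed_path_component
    by (simp only: sum_subtractf[symmetric] right_diff_distrib[symmetric] tail_path_incr[OF _ assms] cong: sum.cong)
  also have "\<bar>\<dots>\<bar> \<le> (\<Sum>b\<in>B. \<bar>x0 \<bullet> b\<bar> * measure (M b) {p..<q})"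
  proof (rule order_trans[OF sum_abs], rule sum_mono)
    fix b assume b: "b \<in> B"
    have "\<bar>b $ i\<bar> \<le> 1"
      using component_le_norm_cart[of b i] unit[OF b] by simp
    then have "\<bar>x0 \<bullet> b\<bar> * \<bar>b $ i\<bar> * measure (M b) {p..<q} \<le> \<bar>x0 \<bullet> b\<bar> * 1 * measure (M b) {p..<q}"
      by (intro mult_right_mono mult_left_mono) auto
    then show "\<bar>- (x0 \<bullet> b) * b $ i * measure (M b) {p..<q}\<bar> \<le> \<bar>x0 \<bullet> b\<bar> * measure (M b) {p..<q}"
      by (simp add: abs_mult)
  qed
  also have "\<dots> = (\<Sum>b\<in>B. \<bar>x0 \<bullet> b\<bar> * tail_path (M b) q) - (\<Sum>b\<in>B. \<bar>x0 \<bullet> b\<bar> * tail_path (M b) p)"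
    by (simp only: sum_subtractf[symmetric] right_diff_distrib[symmetric] tail_path_incr[OF _ assms] cong: sum.cong)
  finally show ?thesis .
qed

lemma mixed_path_total_variation: "total_variation {0..} (\<lambda>t. mixed_path M x0 t $ i) \<le> ennreal weight"
proof (rule total_variation_le_increment[where W="\<lambda>t. \<Sum>b\<in>B. \<bar>x0 \<bullet> b\<bar> * tail_path (M b) t"])
  show "0 \<le> weight" by (simp add: weight_def sum_nonneg)
  fix t :: real assume "t \<in> {0..}"
  have "\<bar>x0 \<bullet> b\<bar> * tail_path (M b) t - \<bar>x0 \<bullet> b\<bar> * tail_path (M b) 0 \<le> \<bar>x0 \<bullet> b\<bar>" if "b \<in> B" for b
    using tail_path_M_0[OF that] measure_nonneg[of "M b" "{t..}"] by (simp add: tail_path_def mult_nonneg_nonneg)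
  then show "(\<Sum>b\<in>B. \<bar>x0 \<bullet> b\<bar> * tail_path (M b) t) - (\<Sum>b\<in>B. \<bar>x0 \<bullet> b\<bar> * tail_path (M b) 0) \<le> weight"
    unfolding weight_def sum_subtractf[symmetric] by (intro sum_mono)
qed (simp_all add: mixed_path_increment)

lemma mixed_path_norm: "norm (mixed_path M x0 t) \<le> weight"
  unfolding mixed_path_def weight_def
proof (rule order_trans[OF norm_sum], rule sum_mono)
  fix b assume b: "b \<in> B"
  interpret prob_space "M b" using M[OF b] by (simp add: prob_on_def)
  have "\<bar>x0 \<bullet> b\<bar> * prob {t..} \<le> \<bar>x0 \<bullet> b\<bar> * 1"
    by (intro mult_left_mono) auto
  then show "norm ((- (x0 \<bullet> b) * tail_path (M b) t) *\<^sub>R b) \<le> \<bar>x0 \<bullet> b\<bar>"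
    by (simp add: unit[OF b] tail_path_def abs_mult)
qed

text \<open>The variation measure of a standard component is not linear in the coordinates. On
  intervals it is dominated by the combination of the \<open>M b\<close> with weights
  \<open>\<bar>x0 \<bullet> b\<bar>\<close>, and these measures are carried by
  \<open>S\<close>.\<close>

lemma mixed_path_supported_on: "supported_on (\<lambda>t. mixed_path M x0 t $ i) S"
proof -
  let ?f = "\<lambda>t. mixed_path M x0 t $ i" and ?W = "\<lambda>t. \<Sum>b\<in>B. \<bar>x0 \<bullet> b\<bar> * tail_path (M b) t"
  let ?V = "left_interval_measure (variation_fun ?f)"
  have bv: "locally_bv ?f"
    using mixed_path_fv by (simp add: fv_path_def)
  have "AE t in ?V. t \<in> S"
  proof (rule AE_dominated[OF variation_measure_carried_by[OF mixed_path_fv] _ T_nonneg closed_S S(2)])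
    show "carried_by {0..T} (M b)" if "b \<in> B" for b
      by (rule M_carried_by[OF that])
    show "AE t in M b. t \<in> S" if "b \<in> B" for b
      using M[OF that] by (simp add: prob_on_def)
    fix s t :: real assume st: "0 \<le> s" "s \<le> t"
    have "measure ?V {s..<t} = variation_fun ?f t - variation_fun ?f s"
      by (rule variation_measure_Ico[OF mixed_path_fv st(2)])
    also have "\<dots> \<le> ?W t - ?W s"
      by (rule variation_fun_diff_le[OF bv st mixed_path_increment])
    also have "\<dots> = (\<Sum>b\<in>B. \<bar>x0 \<bullet> b\<bar> * measure (M b) {s..<t})"
      by (simp only: sum_subtractf[symmetric] right_diff_distrib[symmetric] tail_path_incr[OF _ st(2)] cong: sum.cong)
    finally show "measure ?V {s..<t} \<le> (\<Sum>b\<in>B. \<bar>x0 \<bullet> b\<bar> * measure (M b) {s..<t})" .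
  qed
  moreover have "- S \<in> sets ?V"
    using closed_S by simp
  ultimately have "- S \<in> null_sets ?V"
    by (subst AE_iff_null_sets) (auto elim: eventually_mono)
  then show ?thesis
    by (simp add: supported_on_def null_setsD1)
qed

lemma mixed_path_admissible: "admissible_path T S x0 (mixed_path M x0)"
  unfolding admissible_path_def
proof (intro conjI allI impI mixed_path_0 mixed_path_supported_on)
  fix t :: real
  show "continuous (at_left t) (mixed_path M x0)" if "0 < t"
    unfolding mixed_path_def[abs_def] tail_path_def
    using M_carried_by by (intro continuous_intros measure_atLeast_left_continuous) auto
  show "mixed_path M x0 t = 0" if "T < t"
    using that by (simp add: mixed_path_def tail_path_def measure_atLeast_eq_0[OF M_carried_by])
  show "total_variation {0..t} (\<lambda>s. mixed_path M x0 s $ i) < \<infinity>" if "0 \<le> t" for i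
    using mixed_path_fv that by (auto simp: fv_path_def locally_bv_def)
qed

end

lemma equilibrium_exists_mixed: "\<exists>M. (\<forall>b\<in>B. prob_on S (M b)) \<and> equilibrium (mixed_path M x0)"
proof -
  have "\<forall>b\<in>B. \<exists>M. prob_on S M \<and> (\<exists>q. \<forall>t\<in>S. (\<integral>s. eigval G b \<bar>t - s\<bar> \<partial>M) = q)"
    using equilibrium_exists[OF scalar S] by blast
  from bchoice[OF this] obtain M where M: "\<And>b. b \<in> B \<Longrightarrow> prob_on S (M b)"
    and q: "\<And>b. b \<in> B \<Longrightarrow> \<exists>q. \<forall>t\<in>S. (\<integral>s. eigval G b \<bar>t - s\<bar> \<partial>M b) = q"
    by blast
  have "equilibrium (mixed_path M x0)"
    unfolding equilibrium_def
  proof (intro ballI conjI mixed_path_charges_only[OF M])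
    fix b assume b: "b \<in> B"
    obtain c where c: "\<And>t. t \<in> S \<Longrightarrow> (\<integral>s. eigval G b \<bar>t - s\<bar> \<partial>M b) = c"
      using q[OF b] by auto
    have "potential (eigval G b) (\<lambda>s. mixed_path M x0 s \<bullet> b) t = - (x0 \<bullet> b) * c" if "t \<in> S" for t
      unfolding mixed_path_coordinate[OF b]
        potential_scale[OF scalar[OF b] fv_path_tail_path[OF prob_on_carried_by[OF M[OF b] S(3)] T_nonneg]]
        potential_tail_path[OF prob_on_carried_by[OF M[OF b] S(3)] T_nonneg scalar[OF b]] c[OF that] ..
    then show "\<exists>q. \<forall>t\<in>S. potential (eigval G b) (\<lambda>s. mixed_path M x0 s \<bullet> b) t = q"
      by blast
  qed auto
  then show ?thesis
    using M by blast
qed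

section \<open>Strategies on finite grids as paths\<close>

definition grid_path :: "real set \<Rightarrow> (real \<Rightarrow> real^'k) \<Rightarrow> real \<Rightarrow> real^'k" where
  "grid_path S' \<xi> t = (\<Sum>b\<in>B. step_path S' (\<lambda>s. \<xi> s \<bullet> b) t *\<^sub>R b)"

lemma grid_path_coordinate: "b \<in> B \<Longrightarrow> grid_path S' \<xi> t \<bullet> b = step_path S' (\<lambda>s. \<xi> s \<bullet> b) t"
  unfolding grid_path_def by (rule inner_combination)

lemma
  assumes S': "S' \<in> time_grids S"
  shows grid_path_charges_only: "b \<in> B \<Longrightarrow> charges_only T S' (\<lambda>s. grid_path S' \<xi> s \<bullet> b)"
    and grid_path_0: "grid_path S' \<xi> 0 = - (\<Sum>t\<in>S'. \<xi> t)"
    and grid_path_energy: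
      "1/2 * (\<Sum>t\<in>S'. \<Sum>s\<in>S'. \<xi> t \<bullet> (sym_ext G (t - s) *v \<xi> s)) = total_energy (grid_path S' \<xi>)"
proof -
  have S'': "finite S'" "S' \<subseteq> {0..T}"
    using S' S(3) by (auto simp: time_grids_def)
  show "charges_only T S' (\<lambda>s. grid_path S' \<xi> s \<bullet> b)" if "b \<in> B"
    unfolding grid_path_coordinate[OF that] using charges_only_step_path[OF S'' T_nonneg] .
  have S0: "S' \<subseteq> {0..}"
    using S'' by auto
  show "grid_path S' \<xi> 0 = - (\<Sum>t\<in>S'. \<xi> t)"
  proof (rule eq_if_coordinates_eq)
    fix b assume "b \<in> B"
    then show "grid_path S' \<xi> 0 \<bullet> b = - (\<Sum>t\<in>S'. \<xi> t) \<bullet> b"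
      by (simp add: grid_path_coordinate step_path_0[OF S0] inner_sum_left)
  qed
  have "(\<Sum>t\<in>S'. \<Sum>s\<in>S'. \<xi> t \<bullet> (sym_ext G (t - s) *v \<xi> s)) =
      (\<Sum>b\<in>B. \<Sum>t\<in>S'. \<Sum>s\<in>S'. eigval G b \<bar>t - s\<bar> * (\<xi> t \<bullet> b) * (\<xi> s \<bullet> b))"
    unfolding sym_ext_form by (simp only: sum.swap[where B=B])
  also have "\<dots> = (\<Sum>b\<in>B. energy (eigval G b) (\<lambda>s. grid_path S' \<xi> s \<bullet> b))"
  proof (intro sum.cong refl)
    fix b assume b: "b \<in> B"
    show "(\<Sum>t\<in>S'. \<Sum>s\<in>S'. eigval G b \<bar>t - s\<bar> * (\<xi> t \<bullet> b) * (\<xi> s \<bullet> b)) = energy (eigval G b) (\<lambda>s. grid_path S' \<xi> s \<bullet> b)"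
      unfolding grid_path_coordinate[OF b] energy_step_path[OF S'' T_nonneg scalar[OF b]]
      by (simp add: mult_ac)
  qed
  finally show "1/2 * (\<Sum>t\<in>S'. \<Sum>s\<in>S'. \<xi> t \<bullet> (sym_ext G (t - s) *v \<xi> s)) = total_energy (grid_path S' \<xi>)"
    by (simp add: total_energy_def)
qed

definition grid_trades :: "(real^'k \<Rightarrow> real measure) \<Rightarrow> real^'k \<Rightarrow> real \<Rightarrow> real^'k" where
  "grid_trades M x0 s = (\<Sum>b\<in>B. (- (x0 \<bullet> b) * measure (M b) {s}) *\<^sub>R b)"

lemma grid_path_trades:
  assumes S': "S' \<in> time_grids S" and M: "\<And>b. b \<in> B \<Longrightarrow> prob_on S' (M b)"
  shows "grid_path S' (grid_trades M x0) = mixed_path M x0"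
proof (rule ext, rule eq_if_coordinates_eq)
  fix t b assume b: "b \<in> B"
  have "finite S'" using S' by (simp add: time_grids_def)
  have "grid_path S' (grid_trades M x0) t \<bullet> b = step_path S' (\<lambda>s. - (x0 \<bullet> b) * measure (M b) {s}) t"
    unfolding grid_path_coordinate[OF b] grid_trades_def inner_combination[OF b] ..
  also have "\<dots> = - (x0 \<bullet> b) * tail_path (M b) t"
    unfolding tail_path_finite[OF M[OF b] \<open>finite S'\<close>] step_path_def sum_distrib_left by (simp add: mult_ac)
  finally show "grid_path S' (grid_trades M x0) t \<bullet> b = mixed_path M x0 t \<bullet> b"
    by (simp add: mixed_path_coordinate[OF b])
qed

text \<open>A finite grid is itself a compact set, so equilibria on it exist and minimize by the
  same theory.\<close>

lemma time_grid_diagonal_kernel: "S' \<in> time_grids S \<Longrightarrow> diagonal_kernel G B T S'"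
  using finite_B unit orth expand eigen scalar T_nonneg S(3)
  by (unfold_locales) (auto simp: time_grids_def finite_imp_compact)

end

text \<open>
  Each cell \<open>{k / Suc n..<(k + 1) / Suc n}\<close> that meets \<open>S\<close> is contracted to one of its points in \<open>S\<close>.
\<close>

definition contraction :: "real set \<Rightarrow> nat \<Rightarrow> real \<Rightarrow> real" where
  "contraction S n t = (SOME x. x \<in> S \<and> \<lfloor>x * real (Suc n)\<rfloor> = \<lfloor>t * real (Suc n)\<rfloor>)"

text \<open>The function factors through an integer, and every function of an integer is measurable,
  however the points are chosen.\<close>

lemma contraction_measurable [measurable]: "contraction S n \<in> borel_measurable borel"
proof -
  have "(\<lambda>k::int. SOME x. x \<in> S \<and> \<lfloor>x * real (Suc n)\<rfloor> = k) \<in> measurable (count_space UNIV) borel"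
    by simp
  moreover have "(\<lambda>t::real. \<lfloor>t * real (Suc n)\<rfloor>) \<in> measurable borel (count_space UNIV)"
    by measurable
  ultimately show ?thesis
    unfolding contraction_def[abs_def] by (rule measurable_compose_rev)
qed

lemma
  assumes t: "t \<in> S"
  shows contraction_in: "contraction S n t \<in> S"
    and contraction_close: "\<bar>contraction S n t - t\<bar> \<le> 1 / Suc n"
proof -
  have *: "contraction S n t \<in> S \<and> \<lfloor>contraction S n t * real (Suc n)\<rfloor> = \<lfloor>t * real (Suc n)\<rfloor>"
    unfolding contraction_def by (rule someI[of _ t]) (use t in simp)
  then show "contraction S n t \<in> S" by simp
  have "\<bar>contraction S n t * real (Suc n) - t * real (Suc n)\<bar> \<le> 1"
    using * by linarith
  then have "\<bar>contraction S n t - t\<bar> * real (Suc n) \<le> 1"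
    by (simp only: left_diff_distrib[symmetric] abs_mult abs_of_nat)
  then show "\<bar>contraction S n t - t\<bar> \<le> 1 / Suc n"
    by (simp add: field_simps)
qed

lemma contraction_finite:
  assumes "S \<subseteq> {0..T}"
  shows "finite (contraction S n ` S)"
proof -
  have "contraction S n ` S \<subseteq> (\<lambda>k. SOME x. x \<in> S \<and> \<lfloor>x * real (Suc n)\<rfloor> = k) ` {0..\<lfloor>T * real (Suc n)\<rfloor>}"
  proof
    fix u assume "u \<in> contraction S n ` S"
    then obtain t where t: "t \<in> S" "u = contraction S n t"
      by blast
    then have "\<lfloor>t * real (Suc n)\<rfloor> \<in> {0..\<lfloor>T * real (Suc n)\<rfloor>}"
      using assms by (auto intro!: floor_mono mult_right_mono)
    then show "u \<in> (\<lambda>k. SOME x. x \<in> S \<and> \<lfloor>x * real (Suc n)\<rfloor> = k) ` {0..\<lfloor>T * real (Suc n)\<rfloor>}"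
      unfolding t(2) contraction_def by (rule imageI)
  qed
  then show ?thesis
    by (rule finite_subset) simp
qed

lemma contraction_grid: "S \<noteq> {} \<Longrightarrow> S \<subseteq> {0..T} \<Longrightarrow> contraction S n ` S \<in> time_grids S"
  using contraction_finite contraction_in by (auto simp: time_grids_def)

lemma contraction_tendsto:
  assumes t: "t \<in> S"
  shows "(\<lambda>n. contraction S n t) \<longlonglongrightarrow> t"
proof (rule Lim_null[THEN iffD2], rule tendsto_rabs_zero_cancel)
  have "\<bar>contraction S n t - t\<bar> \<le> inverse (real (Suc n))" for n
    using contraction_close[OF t, of n] by (simp only: inverse_eq_divide)
  then show "(\<lambda>n. \<bar>contraction S n t - t\<bar>) \<longlonglongrightarrow> 0"
    by (intro tendsto_sandwich[OF _ _ tendsto_const LIMSEQ_inverse_real_of_nat] always_eventually allI) auto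
qed

lemma distr_contraction_prob_on:
  assumes A: "prob_on S A" and S: "S \<subseteq> {0..T}"
  shows "prob_on (contraction S n ` S) (distr A borel (contraction S n))"
proof -
  interpret prob_space A using A by (simp add: prob_on_def)
  have [measurable_cong]: "sets A = sets borel" using A by (simp add: prob_on_def)
  have meas: "contraction S n \<in> borel_measurable A" by measurable
  have "AE t in distr A borel (contraction S n). t \<in> contraction S n ` S"
  proof (subst AE_distr_iff[OF meas])
    show "{x \<in> space borel. x \<in> contraction S n ` S} \<in> sets borel"
      using contraction_finite[OF S] by (simp add: finite_imp_closed)
    show "AE t in A. contraction S n t \<in> contraction S n ` S"
      using A unfolding prob_on_def by (auto elim: eventually_mono)
  qed
  then show ?thesis
    using prob_space_distr[OF meas] by (simp add: prob_on_def)
qed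

text \<open>After a change of variables only the arguments of \<open>k\<close> depend on
  \<open>n\<close>, and they converge for points of \<open>S\<close>. Dominated convergence is
  applied to the inner and to the outer integral.\<close>

lemma mutual_energy_contraction:
  assumes A: "prob_on S A" and k: "bcont k"
  shows "(\<lambda>n. mutual_energy k (distr A borel (contraction S n)) (distr A borel (contraction S n)))
    \<longlonglongrightarrow> mutual_energy k A A"
proof -
  interpret prob_space A using A by (simp add: prob_on_def)
  have [measurable_cong]: "sets A = sets borel" using A by (simp add: prob_on_def)
  have [measurable]: "k \<in> borel_measurable borel"
    using k by (rule bcont_measurable)
  have S: "AE t in A. t \<in> S" using A by (simp add: prob_on_def)
  obtain C where C: "0 \<le> C" "\<And>t. \<bar>k t\<bar> \<le> C"
    using bcont_bound[OF k] by metis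
  let ?D = "\<lambda>n. distr A borel (contraction S n)"
  have eq: "mutual_energy k (?D n) (?D n) = (\<integral>t. (\<integral>s. k (contraction S n t - contraction S n s) \<partial>A) \<partial>A)" for n
    unfolding mutual_energy_def by (subst integral_distr, measurable)+
  have inner: "(\<lambda>n. \<integral>s. k (contraction S n t - contraction S n s) \<partial>A) \<longlonglongrightarrow> (\<integral>s. k (t - s) \<partial>A)" if t: "t \<in> S" for t
  proof (rule integral_dominated_convergence[where w="\<lambda>_. C"])
    show "AE s in A. (\<lambda>n. k (contraction S n t - contraction S n s)) \<longlonglongrightarrow> k (t - s)"
      using S
    proof eventually_elim
      case (elim s)
      show ?case
        by (rule isCont_tendsto_compose[OF bcont_isCont[OF k]]) (intro tendsto_diff contraction_tendsto t elim)
    qed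
    show "AE s in A. norm (k (contraction S n t - contraction S n s)) \<le> C" for n
      using C by simp
  qed simp_all
  have "(\<lambda>n. \<integral>t. (\<integral>s. k (contraction S n t - contraction S n s) \<partial>A) \<partial>A) \<longlonglongrightarrow> (\<integral>t. (\<integral>s. k (t - s) \<partial>A) \<partial>A)"
  proof (rule integral_dominated_convergence[where w="\<lambda>_. C"])
    show "AE t in A. (\<lambda>n. \<integral>s. k (contraction S n t - contraction S n s) \<partial>A) \<longlonglongrightarrow> (\<integral>s. k (t - s) \<partial>A)"
      using S by eventually_elim (rule inner)
    have "norm (\<integral>s. k (contraction S n t - contraction S n s) \<partial>A) \<le> C" for n t
    proof -
      have "norm (\<integral>s. k (contraction S n t - contraction S n s) \<partial>A) \<le> (\<integral>s. norm (k (contraction S n t - contraction S n s)) \<partial>A)"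
        by (rule integral_norm_bound)
      also have "\<dots> \<le> (\<integral>s. C \<partial>A)"
        by (intro integral_mono integrable_norm integrable_const_bound[of _ C]) (auto simp: C)
      finally have "norm (\<integral>s. k (contraction S n t - contraction S n s) \<partial>A) \<le> (\<integral>s. C \<partial>A)" .
      then show ?thesis by (simp add: prob_space)
    qed
    then show "AE t in A. norm (\<integral>s. k (contraction S n t - contraction S n s) \<partial>A) \<le> C" for n
      by simp
  qed simp_all
  then show ?thesis
    unfolding eq unfolding mutual_energy_def .
qed

section \<open>Random strategies\<close>

lemma measurable_completion_AE:
  fixes f h :: "'a \<Rightarrow> real"
  assumes f: "f \<in> borel_measurable M" and eq: "AE x in M. f x = h x"
  shows "h \<in> borel_measurable (completion M)"
proof (rule measurableI)
  interpret completion: complete_measure "completion M"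
    by (rule completion.complete_measure_axioms)
  fix A :: "real set" assume A: "A \<in> sets borel"
  show "h -` A \<inter> space (completion M) \<in> sets (completion M)"
  proof (rule completion.in_sets_AE)
    show "f -` A \<inter> space (completion M) \<in> sets (completion M)"
      using measurable_sets[OF f A] by simp
    show "AE x in completion M. x \<in> f -` A \<inter> space (completion M) \<longleftrightarrow> x \<in> h -` A \<inter> space (completion M)"
      using AE_completion[OF eq] by eventually_elim simp
  qed auto
qed simp

text \<open>A lower bound that is approached by attained values is the infimum. In
  \<open>ereal\<close> the nested infima need no side conditions of boundedness.\<close>

lemma INF_eq_limit:
  fixes c :: real
  assumes lower: "\<And>i j. i \<in> I \<Longrightarrow> j \<in> J i \<Longrightarrow> c \<le> f i j"
    and approx: "\<And>n. i n \<in> I" "\<And>n. j n \<in> J (i n)" "(\<lambda>n. f (i n) (j n)) \<longlonglongrightarrow> c"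
  shows "(INF i\<in>I. INF j\<in>J i. ereal (f i j)) = ereal c"
proof (rule antisym)
  show "ereal c \<le> (INF i\<in>I. INF j\<in>J i. ereal (f i j))"
    using lower by (auto intro!: INF_greatest)
  have le: "(INF i\<in>I. INF j\<in>J i. ereal (f i j)) \<le> ereal (f (i n) (j n))" for n
    using approx(1,2) by (intro INF_lower2[of "i n"] INF_lower2[of "j n"]) auto
  have "(\<lambda>n. ereal (f (i n) (j n))) \<longlonglongrightarrow> ereal c"
    using approx(3) by simp
  then show "(INF i\<in>I. INF j\<in>J i. ereal (f i j)) \<le> ereal c"
    by (rule LIMSEQ_le_const) (use le in blast)
qed

section \<open>Expected costs of random strategies\<close>

locale execution = diagonal_kernel G B T S
  for G :: "real \<Rightarrow> real^'k^'k" and B T S +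
  fixes M :: "'a measure" and F :: "real \<Rightarrow> 'a measure"
  assumes filtered: "filtered_prob_space T M F"
begin

sublocale prob_space M
  using filtered by (simp add: filtered_prob_space_def)

lemma F_measurable: "t \<in> {0..T} \<Longrightarrow> f \<in> measurable (F t) N \<Longrightarrow> f \<in> measurable M N"
  using filtered measurable_from_subalg unfolding filtered_prob_space_def by blast

lemma const_det_strategy:
  assumes "admissible_path T S x0 x" "\<And>t. 0 \<le> t \<Longrightarrow> norm (x t) \<le> c"
    "\<And>i. total_variation {0..} (\<lambda>t. x t $ i) \<le> ennreal v"
  shows "x \<in> det_strategies T M F S x0"
  using assms by (auto simp: det_strategies_def strategies_def)

lemma det_strategy_admissible: "x \<in> det_strategies T M F S x0 \<Longrightarrow> admissible_path T S x0 x"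
  by (simp add: det_strategies_def strategies_def AE_const)

lemma expected_cost_const: "expected_cost M G S (\<lambda>t \<omega>. x t) = path_cost G S x"
  using prob_space.prob_space[OF prob_space_completion] by (simp add: expected_cost_def)

text \<open>The order of quantifiers matters: \<open>C\<close> is chosen before the path, so an
  almost sure bound on the variation of random paths bounds their costs by a constant.\<close>

lemma path_cost_bound:
  "\<exists>C. \<forall>x v. supported_path T S x \<longrightarrow> 0 \<le> v \<longrightarrow>
    (\<forall>i. total_variation {0..} (\<lambda>t. x t $ i) \<le> ennreal v) \<longrightarrow> \<bar>path_cost G S x\<bar> \<le> C * v\<^sup>2"
proof -
  have "\<exists>C\<ge>0. \<forall>r. \<bar>sym_ext G r $ i $ j\<bar> \<le> C" for i j
    using bcont_bound[OF bcont_entry[of i j]] by metis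
  then obtain C where C: "\<And>i j. 0 \<le> C i j" "\<And>i j r. \<bar>sym_ext G r $ i $ j\<bar> \<le> C i j"
    by metis
  have bound: "\<bar>path_cost G S x\<bar> \<le> (1/2 * (\<Sum>i\<in>UNIV. \<Sum>j\<in>UNIV. C i j)) * v\<^sup>2"
    if x: "supported_path T S x" and v: "0 \<le> v" "\<And>i. total_variation {0..} (\<lambda>t. x t $ i) \<le> ennreal v" for x v
  proof -
    have fv: "fv_path T (\<lambda>t. x t $ i)" for i
      using x by (simp add: supported_path_def)
    have "\<bar>kernel_integral G S x t $ i\<bar> \<le> (\<Sum>j\<in>UNIV. C i j * v)" for t i
      unfolding kernel_integral_component[OF x]
      by (intro order_trans[OF sum_abs] sum_mono path_integral_bound[OF fv bcont_shift[OF bcont_entry] C(2) v(2,1)])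
    then have "\<bar>path_integral (\<lambda>t. kernel_integral G S x t $ i) (\<lambda>t. x t $ i)\<bar> \<le> (\<Sum>j\<in>UNIV. C i j * v) * v" for i
      by (rule path_integral_bound[OF fv bcont_kernel_integral[OF x] _ v(2,1)])
    then have "(\<Sum>i\<in>UNIV. \<bar>path_integral (\<lambda>t. kernel_integral G S x t $ i) (\<lambda>t. x t $ i)\<bar>) \<le> (\<Sum>i\<in>UNIV. (\<Sum>j\<in>UNIV. C i j * v) * v)"
      by (intro sum_mono)
    then have "\<bar>\<Sum>i\<in>UNIV. path_integral (\<lambda>t. kernel_integral G S x t $ i) (\<lambda>t. x t $ i)\<bar> \<le> (\<Sum>i\<in>UNIV. (\<Sum>j\<in>UNIV. C i j * v) * v)"
      by (rule order_trans[OF sum_abs])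
    moreover have "(\<Sum>i\<in>UNIV. (\<Sum>j\<in>UNIV. C i j * v) * v) = (\<Sum>i\<in>UNIV. \<Sum>j\<in>UNIV. C i j) * v\<^sup>2"
      by (simp add: sum_distrib_right power2_eq_square mult.assoc)
    ultimately show ?thesis
      unfolding path_cost_path_integral[OF x] by simp
  qed
  then show ?thesis
    by blast
qed

text \<open>Measurability in \<open>\<omega>\<close> cannot be read off from the Jordan
  decomposition of a random path. Riemann sums involve the strategy at fixed times only, so their
  iterated limits form a random variable that equals the costs almost surely; the completion absorbs
  the exceptional set.\<close>

lemma strategy_cost_integrable:
  assumes X: "X \<in> strategies T M F S x0"
  shows "integrable (completion M) (\<lambda>\<omega>. path_cost G S (\<lambda>t. X t \<omega>))"
proof -
  have adm: "AE \<omega> in M. admissible_path T S x0 (\<lambda>t. X t \<omega>)"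
    using X by (simp add: strategies_def)
  obtain v0 where tv: "AE \<omega> in M. \<forall>i. total_variation {0..} (\<lambda>t. X t \<omega> $ i) \<le> ennreal v0"
    using X by (auto simp: strategies_def)
  define v where "v = max 0 v0"
  have v: "0 \<le> v" "ennreal v0 \<le> ennreal v"
    by (auto simp: v_def intro!: ennreal_leI)
  from path_cost_bound obtain C where C: "\<forall>x v. supported_path T S x \<longrightarrow> 0 \<le> v \<longrightarrow>
    (\<forall>i. total_variation {0..} (\<lambda>t. x t $ i) \<le> ennreal v) \<longrightarrow> \<bar>path_cost G S x\<bar> \<le> C * v\<^sup>2" ..
  have bound: "AE \<omega> in M. \<bar>path_cost G S (\<lambda>t. X t \<omega>)\<bar> \<le> C * v\<^sup>2"
    using adm tv
  proof eventually_elim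
    case (elim \<omega>)
    have "total_variation {0..} (\<lambda>t. X t \<omega> $ i) \<le> ennreal v" for i
      using elim(2) v(2) order_trans by blast
    then show ?case
      using C admissible_supported_path[OF elim(1) T_nonneg] v(1) by blast
  qed
  \<comment> \<open>Measurability of \<open>X t\<close> is given for times in \<open>{0..T}\<close>,
    but the grid runs beyond \<open>T\<close>, where almost every path is \<open>0\<close>.\<close>
  define Y where "Y t \<omega> = (if 0 \<le> t \<and> t \<le> T then X t \<omega> else 0)" for t \<omega>
  have Y_meas [measurable]: "(\<lambda>\<omega>. Y t \<omega> $ i) \<in> borel_measurable M" for t i
  proof (cases "0 \<le> t \<and> t \<le> T")
    case True
    then have [measurable]: "X t \<in> borel_measurable M"
      using X F_measurable[of t "X t"] by (simp add: strategies_def)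
    have "(\<lambda>\<omega>. X t \<omega> \<bullet> axis i 1) \<in> borel_measurable M"
      by measurable
    then show ?thesis
      using True by (simp add: Y_def inner_axis)
  next
    case False
    then have "(\<lambda>\<omega>. Y t \<omega> $ i) = (\<lambda>\<omega>. 0)"
      by (auto simp: Y_def)
    then show ?thesis
      by simp
  qed
  \<comment> \<open>\<open>lim\<close> is a total function, so \<open>K\<close> and \<open>L\<close>
    are defined and measurable on the whole space; convergence is used only on the almost sure
    event.\<close>
  define K where "K i \<omega> t = (\<Sum>j\<in>UNIV. lim (\<lambda>m. rs_sum T m (\<lambda>s. sym_ext G (t - s) $ i $ j) (\<lambda>s. Y s \<omega> $ j)))" for i \<omega> t
  define L where "L \<omega> = 1/2 * (\<Sum>i\<in>UNIV. lim (\<lambda>n. rs_sum T n (K i \<omega>) (\<lambda>s. Y s \<omega> $ i)))" for \<omega>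
  have [measurable]: "(\<lambda>\<omega>. K i \<omega> t) \<in> borel_measurable M" for i t
    unfolding K_def rs_sum_def by measurable
  have L_meas: "L \<in> borel_measurable M"
    unfolding L_def[abs_def] rs_sum_def by measurable
  have "AE \<omega> in M. L \<omega> = path_cost G S (\<lambda>t. X t \<omega>)"
    using adm
  proof eventually_elim
    case (elim \<omega>)
    let ?x = "\<lambda>t. X t \<omega>"
    have x: "supported_path T S ?x"
      by (rule admissible_supported_path[OF elim T_nonneg])
    then have fv: "fv_path T (\<lambda>t. X t \<omega> $ i)" for i
      by (simp add: supported_path_def)
    have Yx: "Y t \<omega> = X t \<omega>" if "0 \<le> t" for t
      using elim that by (simp add: Y_def admissible_path_def)
    have rs: "rs_sum T n k (\<lambda>s. Y s \<omega> $ i) = rs_sum T n k (\<lambda>s. X s \<omega> $ i)" for n k i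
      unfolding rs_sum_def by (intro sum.cong refl) (simp add: Yx)
    have lim_rs: "lim (\<lambda>n. rs_sum T n k (\<lambda>s. Y s \<omega> $ i)) = path_integral k (\<lambda>s. X s \<omega> $ i)" if "bcont k" for k i
      unfolding rs by (rule limI[OF rs_sum_tendsto_path_integral[OF fv that]])
    have K: "K i \<omega> = (\<lambda>t. kernel_integral G S ?x t $ i)" for i
      unfolding K_def kernel_integral_component[OF x] lim_rs[OF bcont_shift[OF bcont_entry]] ..
    show ?case
      unfolding L_def K path_cost_path_integral[OF x] lim_rs[OF bcont_kernel_integral[OF x]] ..
  qed
  then have "(\<lambda>\<omega>. path_cost G S (\<lambda>t. X t \<omega>)) \<in> borel_measurable (completion M)"
    by (rule measurable_completion_AE[OF L_meas])
  moreover have "AE \<omega> in completion M. norm (path_cost G S (\<lambda>t. X t \<omega>)) \<le> C * v\<^sup>2"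
    using AE_completion[OF bound] by simp
  moreover have "finite_measure (completion M)"
    using prob_space_completion by (simp add: prob_space_def)
  ultimately show ?thesis
    by (intro finite_measure.integrable_const_bound)
qed

text \<open>Almost every path of \<open>X\<close> is a deterministic competitor of \<open>x\<close>.
  If the expectation does not exceed the minimum, the costs agree for almost every
  \<open>\<omega>\<close>. Strictness then holds for the whole path at once, which gives
  indistinguishability.\<close>

lemma
  assumes x: "equilibrium x" "x 0 = x0" and X: "X \<in> strategies T M F S x0"
  shows expected_cost_ge: "total_energy x \<le> expected_cost M G S X"
    and expected_cost_strict: "expected_cost M G S X \<le> total_energy x \<Longrightarrow> indistinguishable M X (\<lambda>t \<omega>. x t)"
proof -
  interpret completion: prob_space "completion M"
    by (rule prob_space_completion)
  have adm: "AE \<omega> in M. admissible_path T S x0 (\<lambda>t. X t \<omega>)"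
    using X by (simp add: strategies_def)
  have path: "total_energy x \<le> path_cost G S y \<and> (path_cost G S y \<le> total_energy x \<longrightarrow> (\<forall>t\<ge>0. y t = x t))"
    if y: "admissible_path T S x0 y" for y
  proof -
    have sp: "supported_path T S y"
      by (rule admissible_supported_path[OF y T_nonneg])
    have y0: "y 0 = x 0"
      using y x(2) by (simp add: admissible_path_def)
    show ?thesis
      unfolding path_cost_eq[OF sp]
    proof (intro conjI impI allI)
      show "total_energy x \<le> total_energy y"
        by (rule equilibrium_minimal[OF x(1) coordinate_charges_only[OF sp] y0])
      show "y t = x t" if "total_energy y \<le> total_energy x" "0 \<le> t" for t
        by (rule equilibrium_strict[OF x(1) coordinate_charges_only[OF sp] y0 that])
    qed
  qed
  have int: "integrable (completion M) (\<lambda>\<omega>. path_cost G S (\<lambda>t. X t \<omega>))"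
    by (rule strategy_cost_integrable[OF X])
  have nonneg: "AE \<omega> in completion M. 0 \<le> path_cost G S (\<lambda>t. X t \<omega>) - total_energy x"
    using AE_completion[OF adm] by eventually_elim (use path in auto)
  have int': "integrable (completion M) (\<lambda>\<omega>. path_cost G S (\<lambda>t. X t \<omega>) - total_energy x)"
    using int by simp
  have eq: "(\<integral>\<omega>. path_cost G S (\<lambda>t. X t \<omega>) - total_energy x \<partial>completion M) = expected_cost M G S X - total_energy x"
    unfolding expected_cost_def using int completion.prob_space by simp
  then show "total_energy x \<le> expected_cost M G S X"
    using integral_nonneg_AE[OF nonneg] by simp
  assume "expected_cost M G S X \<le> total_energy x"
  then have "(\<integral>\<omega>. path_cost G S (\<lambda>t. X t \<omega>) - total_energy x \<partial>completion M) = 0"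
    using eq integral_nonneg_AE[OF nonneg] by simp
  then have "AE \<omega> in completion M. path_cost G S (\<lambda>t. X t \<omega>) - total_energy x = 0"
    using integral_nonneg_eq_0_iff_AE[OF int' nonneg] by blast
  then have "AE \<omega> in M. path_cost G S (\<lambda>t. X t \<omega>) - total_energy x = 0"
    by (simp add: AE_completion_iff)
  with adm show "indistinguishable M X (\<lambda>t \<omega>. x t)"
    unfolding indistinguishable_def by eventually_elim (use path in auto)
qed

text \<open>The set \<open>R\<close> on which \<open>x\<close> is an equilibrium is separate from
  the grid: \<open>R = S'\<close> gives minimality on the grid, \<open>R = S\<close> the lower bound
  for the infimum over all grids.\<close>

lemma expected_grid_cost_ge:
  assumes S': "S' \<in> time_grids S" and R: "S' \<subseteq> R" "diagonal_kernel G B T R"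
    and x: "diagonal_kernel.equilibrium G B T R x" "x 0 = x0"
    and \<xi>: "\<xi> \<in> grid_strategies M F S' x0"
  shows "total_energy x \<le> expected_grid_cost M G S' \<xi>"
proof -
  interpret R: diagonal_kernel G B T R by (rule R(2))
  let ?c = "\<lambda>\<omega>. 1/2 * (\<Sum>t\<in>S'. \<Sum>s\<in>S'. \<xi> t \<omega> \<bullet> (sym_ext G (t - s) *v \<xi> s \<omega>))"
  have S'': "S' \<subseteq> {0..T}" using S' S(3) by (auto simp: time_grids_def)
  have int: "integrable M ?c"
  proof -
    have "integrable M (\<lambda>\<omega>. (\<xi> t \<omega> \<bullet> b) * (\<xi> s \<omega> \<bullet> b))" if "t \<in> S'" "s \<in> S'" for t s b
    proof -
      have [measurable]: "\<xi> t \<in> borel_measurable M" "\<xi> s \<in> borel_measurable M"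
        using \<xi> that S'' F_measurable[of t "\<xi> t"] F_measurable[of s "\<xi> s"] by (auto simp: grid_strategies_def)
      have "\<exists>c. \<forall>\<omega>\<in>space M. norm (\<xi> u \<omega>) \<le> c" if "u \<in> S'" for u
        using \<xi> that by (simp add: grid_strategies_def)
      from this[OF \<open>t \<in> S'\<close>] this[OF \<open>s \<in> S'\<close>]
      obtain c d where cd: "\<forall>\<omega>\<in>space M. norm (\<xi> t \<omega>) \<le> c" "\<forall>\<omega>\<in>space M. norm (\<xi> s \<omega>) \<le> d"
        by (elim exE)
      have "AE \<omega> in M. norm ((\<xi> t \<omega> \<bullet> b) * (\<xi> s \<omega> \<bullet> b)) \<le> (c * norm b) * (d * norm b)"
      proof (rule AE_I2)
        fix \<omega> assume \<omega>: "\<omega> \<in> space M"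
        have t: "\<bar>\<xi> t \<omega> \<bullet> b\<bar> \<le> c * norm b"
          by (rule order_trans[OF Cauchy_Schwarz_ineq2], rule mult_right_mono) (use cd \<omega> in auto)
        have s: "\<bar>\<xi> s \<omega> \<bullet> b\<bar> \<le> d * norm b"
          by (rule order_trans[OF Cauchy_Schwarz_ineq2], rule mult_right_mono) (use cd \<omega> in auto)
        show "norm ((\<xi> t \<omega> \<bullet> b) * (\<xi> s \<omega> \<bullet> b)) \<le> (c * norm b) * (d * norm b)"
          unfolding real_norm_def abs_mult using t
          by (intro mult_mono t s) (auto intro: order_trans[OF abs_ge_zero])
      qed
      then show ?thesis
        by (intro integrable_const_bound) auto
    qed
    then have "integrable M (\<lambda>\<omega>. 1/2 * (\<Sum>t\<in>S'. \<Sum>s\<in>S'. \<Sum>b\<in>B. eigval G b \<bar>t - s\<bar> * ((\<xi> t \<omega> \<bullet> b) * (\<xi> s \<omega> \<bullet> b))))"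
      by (intro integrable_mult_right Bochner_Integration.integrable_sum)
    then show ?thesis
      unfolding sym_ext_form by (simp add: mult.assoc)
  qed
  have "AE \<omega> in M. x0 + (\<Sum>t\<in>S'. \<xi> t \<omega>) = 0"
    using \<xi> by (simp add: grid_strategies_def)
  then have "AE \<omega> in M. total_energy x \<le> ?c \<omega>"
  proof eventually_elim
    case (elim \<omega>)
    let ?y = "grid_path S' (\<lambda>t. \<xi> t \<omega>)"
    have "?y 0 = x 0"
      using elim x(2) by (simp add: grid_path_0[OF S'] eq_neg_iff_add_eq_0[symmetric])
    then have "total_energy x \<le> total_energy ?y"
      using charges_only_mono[OF grid_path_charges_only[OF S'] R(1)]
      by (intro R.equilibrium_minimal[OF x(1)]) auto
    then show ?case
      unfolding grid_path_energy[OF S'] .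
  qed
  then have "(\<integral>\<omega>. total_energy x \<partial>M) \<le> (\<integral>\<omega>. ?c \<omega> \<partial>M)"
    by (intro integral_mono_AE int) auto
  then show ?thesis
    by (simp add: expected_grid_cost_def prob_space)
qed

lemma
  assumes S': "S' \<in> time_grids S" and N: "\<And>b. b \<in> B \<Longrightarrow> prob_on S' (N b)"
  shows grid_trades_strategy: "(\<lambda>t \<omega>. grid_trades N x0 t) \<in> grid_strategies M F S' x0"
    and grid_trades_cost: "expected_grid_cost M G S' (\<lambda>t \<omega>. grid_trades N x0 t) = total_energy (mixed_path N x0)"
proof -
  interpret S': diagonal_kernel G B T S' by (rule time_grid_diagonal_kernel[OF S'])
  have path: "grid_path S' (grid_trades N x0) = mixed_path N x0"
    using N by (rule grid_path_trades[OF S'])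
  have "- (\<Sum>t\<in>S'. grid_trades N x0 t) = mixed_path N x0 0"
    unfolding path[symmetric] by (rule grid_path_0[OF S', symmetric])
  also have "\<dots> = x0"
    using N by (rule S'.mixed_path_0)
  finally have "- (\<Sum>t\<in>S'. grid_trades N x0 t) = x0" .
  then have "x0 + (\<Sum>t\<in>S'. grid_trades N x0 t) = 0"
    by (metis add.left_inverse)
  then show "(\<lambda>t \<omega>. grid_trades N x0 t) \<in> grid_strategies M F S' x0"
    by (auto simp: grid_strategies_def)
  show "expected_grid_cost M G S' (\<lambda>t \<omega>. grid_trades N x0 t) = total_energy (mixed_path N x0)"
    unfolding expected_grid_cost_def grid_path_energy[OF S'] path
    by (simp add: prob_space)
qed

lemma grid_minimizer_exists:
  assumes S': "S' \<in> time_grids S"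
  shows "\<exists>\<xi>. is_arg_min (expected_grid_cost M G S') (\<lambda>\<xi>. \<xi> \<in> grid_strategies M F S' x0) \<xi>"
proof -
  interpret S': diagonal_kernel G B T S' by (rule time_grid_diagonal_kernel[OF S'])
  obtain N where N: "\<And>b. b \<in> B \<Longrightarrow> prob_on S' (N b)" and eq: "S'.equilibrium (mixed_path N x0)"
    using S'.equilibrium_exists_mixed[of x0] by blast
  have "total_energy (mixed_path N x0) \<le> expected_grid_cost M G S' \<xi>" if "\<xi> \<in> grid_strategies M F S' x0" for \<xi>
    by (rule expected_grid_cost_ge[OF S' order_refl S'.diagonal_kernel_axioms eq S'.mixed_path_0[OF N] that])
  then show ?thesis
    using grid_trades_strategy[OF S' N] grid_trades_cost[OF S' N]
    by (intro exI[of _ "\<lambda>t \<omega>. grid_trades N x0 t"]) (force simp: is_arg_min_def)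
qed

lemma optimal_execution:
  "\<exists>x \<in> det_strategies T M F S x0.
     is_arg_min (expected_cost M G S) (\<lambda>X. X \<in> strategies T M F S x0) (\<lambda>t \<omega>. x t) \<and>
     (\<forall>X. is_arg_min (expected_cost M G S) (\<lambda>X. X \<in> strategies T M F S x0) X \<longrightarrow>
        indistinguishable M X (\<lambda>t \<omega>. x t)) \<and>
     (\<forall>y \<in> det_strategies T M F S x0.
        (\<exists>l. fredholm_solution G S l y) \<longleftrightarrow> (\<forall>t\<ge>0. y t = x t)) \<and>
     (\<forall>S' \<in> time_grids S. \<exists>\<xi>.
        is_arg_min (expected_grid_cost M G S') (\<lambda>\<xi>. \<xi> \<in> grid_strategies M F S' x0) \<xi>) \<and>
     (INF S' \<in> time_grids S. INF \<xi> \<in> grid_strategies M F S' x0.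
        ereal (expected_grid_cost M G S' \<xi>)) = ereal (expected_cost M G S (\<lambda>t \<omega>. x t))"
proof -
  obtain N where N: "\<And>b. b \<in> B \<Longrightarrow> prob_on S (N b)" and eq: "equilibrium (mixed_path N x0)"
    using equilibrium_exists_mixed[of x0] by blast
  define x where "x = mixed_path N x0"
  have x0: "x 0 = x0"
    unfolding x_def by (rule mixed_path_0[OF N])
  have eq: "equilibrium x"
    using eq by (simp add: x_def)
  have adm: "admissible_path T S x0 x"
    unfolding x_def by (rule mixed_path_admissible[OF N])
  have det: "x \<in> det_strategies T M F S x0"
    by (rule const_det_strategy[OF adm]) (unfold x_def, rule mixed_path_norm[OF N], assumption, rule mixed_path_total_variation[OF N])
  have cost: "expected_cost M G S (\<lambda>t \<omega>. x t) = total_energy x"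
    unfolding expected_cost_const by (rule path_cost_eq[OF admissible_supported_path[OF adm T_nonneg]])
  have strat: "(\<lambda>t \<omega>. x t) \<in> strategies T M F S x0"
    using det by (simp add: det_strategies_def)
  have min: "is_arg_min (expected_cost M G S) (\<lambda>X. X \<in> strategies T M F S x0) (\<lambda>t \<omega>. x t)"
    using strat expected_cost_ge[OF eq x0] unfolding is_arg_min_def cost by (auto simp: not_less)
  have uniq: "indistinguishable M X (\<lambda>t \<omega>. x t)"
    if "is_arg_min (expected_cost M G S) (\<lambda>X. X \<in> strategies T M F S x0) X" for X
  proof -
    have "X \<in> strategies T M F S x0" "\<not> expected_cost M G S (\<lambda>t \<omega>. x t) < expected_cost M G S X"
      using that strat by (auto simp: is_arg_min_def)
    then show ?thesis
      using expected_cost_strict[OF eq x0] cost by simp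
  qed
  have fred: "(\<exists>l. fredholm_solution G S l y) \<longleftrightarrow> (\<forall>t\<ge>0. y t = x t)"
    if "y \<in> det_strategies T M F S x0" for y
  proof -
    have y: "admissible_path T S x0 y"
      by (rule det_strategy_admissible[OF that])
    have sp: "supported_path T S y"
      by (rule admissible_supported_path[OF y T_nonneg])
    have y0: "y 0 = x 0"
      using y x0 by (simp add: admissible_path_def)
    have xc: "charges_only T S (\<lambda>s. x s \<bullet> b)" if "b \<in> B" for b
      using eq that by (simp add: equilibrium_def)
    have "equilibrium y \<longleftrightarrow> (\<forall>t\<ge>0. y t = x t)"
    proof
      assume "equilibrium y"
      \<comment> \<open>The roles are exchanged: as an equilibrium, \<open>y\<close> has at most the
        energy of its competitor \<open>x\<close>, and strictness for the equilibrium
        \<open>x\<close> then forces equality.\<close>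
      then have "total_energy y \<le> total_energy x"
        by (rule equilibrium_minimal[where x=y and y=x, OF _ xc y0[symmetric]])
      then show "\<forall>t\<ge>0. y t = x t"
        by (intro allI impI) (rule equilibrium_strict[where x=x and y=y, OF eq coordinate_charges_only[OF sp] y0])
    next
      assume "\<forall>t\<ge>0. y t = x t"
      then show "equilibrium y"
        by (intro equilibrium_cong[OF eq coordinate_charges_only[OF sp]]) auto
    qed
    then show ?thesis
      using equilibrium_iff_fredholm[OF sp] by simp
  qed
  have inf: "(INF S' \<in> time_grids S. INF \<xi> \<in> grid_strategies M F S' x0. ereal (expected_grid_cost M G S' \<xi>)) =
      ereal (total_energy x)"
  proof (rule INF_eq_limit)
    fix S' \<xi> assume S': "S' \<in> time_grids S" and \<xi>: "\<xi> \<in> grid_strategies M F S' x0"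
    have "S' \<subseteq> S" using S' by (simp add: time_grids_def)
    then show "total_energy x \<le> expected_grid_cost M G S' \<xi>"
      by (rule expected_grid_cost_ge[OF S' _ diagonal_kernel_axioms eq x0 \<xi>])
  next
    \<comment> \<open>The optimal measures pushed forward to finite subsets of \<open>S\<close>
      remain probability measures, so the trades they define have the required total, and their
      energies converge.\<close>
    define D where "D n b = distr (N b) borel (contraction S n)" for n b
    have D: "prob_on (contraction S n ` S) (D n b)" if "b \<in> B" for n b
      unfolding D_def by (rule distr_contraction_prob_on[OF N[OF that] S(3)])
    have grid: "contraction S n ` S \<in> time_grids S" for n
      by (rule contraction_grid[OF S(2,3)])
    then show "contraction S n ` S \<in> time_grids S" for n .
    show "(\<lambda>t \<omega>. grid_trades (D n) x0 t) \<in> grid_strategies M F (contraction S n ` S) x0" for n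
      by (rule grid_trades_strategy[where N="D n", OF grid D])
    have "expected_grid_cost M G (contraction S n ` S) (\<lambda>t \<omega>. grid_trades (D n) x0 t) =
        1/2 * (\<Sum>b\<in>B. (x0 \<bullet> b)\<^sup>2 * mutual_energy (\<lambda>t. eigval G b \<bar>t\<bar>) (D n b) (D n b))" for n
    proof -
      interpret S': diagonal_kernel G B T "contraction S n ` S"
        by (rule time_grid_diagonal_kernel[OF grid])
      have "expected_grid_cost M G (contraction S n ` S) (\<lambda>t \<omega>. grid_trades (D n) x0 t) = total_energy (mixed_path (D n) x0)"
        using D[of _ n] by (rule grid_trades_cost[OF grid])
      also have "\<dots> = 1/2 * (\<Sum>b\<in>B. (x0 \<bullet> b)\<^sup>2 * mutual_energy (\<lambda>t. eigval G b \<bar>t\<bar>) (D n b) (D n b))"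
        using D[of _ n] by (rule S'.mixed_path_energy)
      finally show ?thesis .
    qed
    moreover have "(\<lambda>n. 1/2 * (\<Sum>b\<in>B. (x0 \<bullet> b)\<^sup>2 * mutual_energy (\<lambda>t. eigval G b \<bar>t\<bar>) (D n b) (D n b)))
        \<longlonglongrightarrow> 1/2 * (\<Sum>b\<in>B. (x0 \<bullet> b)\<^sup>2 * mutual_energy (\<lambda>t. eigval G b \<bar>t\<bar>) (N b) (N b))"
      unfolding D_def by (intro tendsto_intros mutual_energy_contraction N bcont_eigval)
    moreover have "total_energy x = 1/2 * (\<Sum>b\<in>B. (x0 \<bullet> b)\<^sup>2 * mutual_energy (\<lambda>t. eigval G b \<bar>t\<bar>) (N b) (N b))"
      unfolding x_def using N by (rule mixed_path_energy)
    ultimately show "(\<lambda>n. expected_grid_cost M G (contraction S n ` S) (\<lambda>t \<omega>. grid_trades (D n) x0 t)) \<longlonglongrightarrow> total_energy x"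
      by (simp only:)
  qed
  show ?thesis
    by (intro bexI[OF _ det] conjI allI impI ballI)
      (rule min, erule uniq, erule fred, erule grid_minimizer_exists, rule inf[folded cost])
qed

end

theorem theorem2p23:
  fixes G :: "real \<Rightarrow> real^'k^'k"
    and T :: real
    and M :: "'a measure"
    and F :: "real \<Rightarrow> 'a measure"
    and TT :: "real set"
    and x0 :: "real^'k"
  assumes "T > 0"
    and "filtered_prob_space T M F"
    and "decay_kernel G"
    and "symmetric_kernel G"
    and "nonnegative_kernel G"
    and "nonincreasing_kernel G"
    and "convex_kernel G"
    and "nonconstant_kernel G"
    and "commuting_kernel G"
    and "compact TT" and "TT \<noteq> {}" and "TT \<subseteq> {0..T}"
  shows "\<exists>x \<in> det_strategies T M F TT x0.
     is_arg_min (expected_cost M G TT) (\<lambda>X. X \<in> strategies T M F TT x0) (\<lambda>t \<omega>. x t) \<and>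
     (\<forall>X. is_arg_min (expected_cost M G TT) (\<lambda>X. X \<in> strategies T M F TT x0) X \<longrightarrow>
        indistinguishable M X (\<lambda>t \<omega>. x t)) \<and>
     (\<forall>y \<in> det_strategies T M F TT x0.
        (\<exists>l. fredholm_solution G TT l y) \<longleftrightarrow> (\<forall>t\<ge>0. y t = x t)) \<and>
     (\<forall>S \<in> time_grids TT. \<exists>\<xi>.
        is_arg_min (expected_grid_cost M G S) (\<lambda>\<xi>. \<xi> \<in> grid_strategies M F S x0) \<xi>) \<and>
     (INF S \<in> time_grids TT. INF \<xi> \<in> grid_strategies M F S x0.
        ereal (expected_grid_cost M G S \<xi>)) = ereal (expected_cost M G TT (\<lambda>t \<omega>. x t))"
proof -
  from kernel_eigenbasis[OF \<open>symmetric_kernel G\<close> \<open>commuting_kernel G\<close>]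
  obtain B where B: "finite B" "\<forall>b\<in>B. norm b = 1" "\<forall>b\<in>B. \<forall>b'\<in>B. b \<noteq> b' \<longrightarrow> b \<bullet> b' = 0"
    "\<forall>x. x = (\<Sum>b\<in>B. (x \<bullet> b) *\<^sub>R b)" "\<forall>b\<in>B. \<forall>t\<ge>0. G t *v b = (b \<bullet> (G t *v b)) *\<^sub>R b"
    by (elim exE conjE)
  have scalar: "scalar_kernel (eigval G b)" if "b \<in> B" for b
    by (rule scalar_kernel_eigval) (use assms B(2) that in auto)
  interpret execution G B T TT M F
  proof
    show "x = (\<Sum>b\<in>B. (x \<bullet> b) *\<^sub>R b)" for x
      using B(4) by (rule spec)
    show "G t *v b = eigval G b t *\<^sub>R b" if "b \<in> B" "0 \<le> t" for b t
      unfolding eigval_def using B(5) that by blast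
  qed (use assms B(1-3) scalar in auto)
  show ?thesis
    by (rule optimal_execution)
qed

end
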